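(* Work over $\mathbb{Q}$. Every multilinear polynomial identity of degree 7 satisfied by the anti-tetrad $[a,b,c,d]=abcd-dcba$ in every associative algebra is a consequence of the skew-symmetry $[a,b,c,d]+[d,c,b,a]\equiv0$ and the following two identities of the anti-tetrad in degree 7: (1) $[[a,b,c,d],e,f,g]-[[a,b,f,e],d,c,g]+[[d,c,f,e],a,b,g]+[g,[b,a,d,c],f,e]-[g,[b,a,e,f],c,d]+[g,[c,d,e,f],b,a]\equiv0$; (2) $[[a,b,c,d],e,f,g]-[[a,f,g,c],b,e,d]+[[c,a,b,d],g,e,f]-[[c,b,a,f],g,e,d]-[[c,g,d,b],a,e,f]-[[c,g,e,f],a,b,d]+[[c,g,e,d],b,a,f]-[[b,a,c,f],e,d,g]-[[b,c,f,g],a,e,d]+[[b,e,d,g],a,c,f]-[[g,f,e,d],c,b,a]+[[g,d,e,f],c,a,b]-[[f,a,b,d],e,g,c]-[[f,c,e,d],g,a,b]-[a,[b,c,g,f],e,d]-[c,[a,b,d,g],e,f]+[c,[b,a,f,g],e,d]+[b,[a,c,g,d],e,f]-[b,[a,g,f,c],e,d]+[b,[a,g,d,e],c,f]+[d,[c,b,a,e],f,g]\equiv0$.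
   Context: A quaternary algebra is a vector space with one quadrilinear operation $[-,-,-,-]$. A multilinear polynomial of degree 7 is a linear combination of nonassociative monomials in which two operation symbols are applied to seven distinct variables $a,\dots,g$, each occurring exactly once. Such a polynomial $I$ is an identity satisfied by the anti-tetrad if it vanishes in the free associative algebra when every occurrence of the operation is expanded by $[x,y,z,w]=xyzw-wzyx$ (equivalently, $I\equiv0$ in every associative algebra with the anti-tetrad as operation). An identity $I$ is a consequence of a set $S$ of identities if every quaternary algebra satisfying all identities in $S$ also satisfies $I$. The symbol $\equiv$ means equality for all values of the arguments. *)

theory Defs
  imports Complex_Main "HOL-Library.Poly_Mapping"
begin

datatype 'x monomial =
    Var 'x
  | Op "'x monomial" "'x monomial" "'x monomial" "'x monomial"
      (\<open>(\<langle>_,/ _,/ _,/ _\<rangle>)\<close>)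

fun leaves :: "'x monomial \<Rightarrow> 'x list" where
  "leaves (Var x) = [x]"
| "leaves \<langle>s, t, u, w\<rangle> = leaves s @ leaves t @ leaves u @ leaves w"

type_synonym 'x polynomial = "'x monomial \<Rightarrow>\<^sub>0 rat"

abbreviation mon :: "'x monomial \<Rightarrow> 'x polynomial" where
  "mon m \<equiv> Poly_Mapping.single m 1"

text \<open>Every variable in \<open>V\<close> occurs exactly once in each monomial, and no others occur.
  A monomial with \<open>k\<close> operation symbols has \<open>3 * k + 1\<close> leaves, so for seven variables
  each monomial contains exactly two operation symbols.\<close>

definition multilinear :: "'x set \<Rightarrow> 'x polynomial \<Rightarrow> bool" where
  "multilinear V I \<longleftrightarrow> (\<forall>m \<in> Poly_Mapping.keys I. distinct (leaves m) \<and> set (leaves m) = V)"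

locale quaternary_algebra = vector_space scale
  for scale :: "rat \<Rightarrow> 'v::ab_group_add \<Rightarrow> 'v" +
  fixes br :: "'v \<Rightarrow> 'v \<Rightarrow> 'v \<Rightarrow> 'v \<Rightarrow> 'v"
  assumes linear1: "Vector_Spaces.linear scale scale (\<lambda>x. br x y z w)"
    and linear2: "Vector_Spaces.linear scale scale (\<lambda>y. br x y z w)"
    and linear3: "Vector_Spaces.linear scale scale (\<lambda>z. br x y z w)"
    and linear4: "Vector_Spaces.linear scale scale (\<lambda>w. br x y z w)"

fun eval_monomial :: "('v \<Rightarrow> 'v \<Rightarrow> 'v \<Rightarrow> 'v \<Rightarrow> 'v) \<Rightarrow> ('x \<Rightarrow> 'v) \<Rightarrow> 'x monomial \<Rightarrow> 'v" where
  "eval_monomial br v (Var x) = v x"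
| "eval_monomial br v \<langle>s, t, u, w\<rangle> =
     br (eval_monomial br v s) (eval_monomial br v t)
        (eval_monomial br v u) (eval_monomial br v w)"

definition eval_poly ::
  "(rat \<Rightarrow> 'v::ab_group_add \<Rightarrow> 'v) \<Rightarrow> ('v \<Rightarrow> 'v \<Rightarrow> 'v \<Rightarrow> 'v \<Rightarrow> 'v) \<Rightarrow> ('x \<Rightarrow> 'v) \<Rightarrow> 'x polynomial \<Rightarrow> 'v"
where
  "eval_poly scale br v I = (\<Sum>m \<in> Poly_Mapping.keys I. scale (Poly_Mapping.lookup I m) (eval_monomial br v m))"

definition satisfies ::
  "(rat \<Rightarrow> 'v::ab_group_add \<Rightarrow> 'v) \<Rightarrow> ('v \<Rightarrow> 'v \<Rightarrow> 'v \<Rightarrow> 'v \<Rightarrow> 'v) \<Rightarrow> 'x polynomial \<Rightarrow> bool"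
where
  "satisfies scale br I \<longleftrightarrow> (\<forall>v. eval_poly scale br v I = 0)"

text \<open>Here the quaternary algebras are those with underlying type \<open>'v\<close>; a statement about
  \<open>consequence TYPE('v)\<close> with \<open>'v\<close> a free type variable concerns all quaternary algebras.\<close>

definition consequence :: "'v::ab_group_add itself \<Rightarrow> 'x polynomial set \<Rightarrow> 'x polynomial \<Rightarrow> bool" where
  "consequence (_ :: 'v itself) S I \<longleftrightarrow>
     (\<forall>(scale :: rat \<Rightarrow> 'v \<Rightarrow> 'v) br.
        quaternary_algebra scale br \<longrightarrow> (\<forall>J \<in> S. satisfies scale br J) \<longrightarrow> satisfies scale br I)"

text \<open>A copy of the type of lists carrying the (additively written) free monoid structure, so
  that the convolution product of \<open>poly_mapping\<close> is the product of the free unital associative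
  algebra.\<close>

datatype 'x word = Word (letters: "'x list")

instantiation word :: (type) monoid_add
begin

definition zero_word :: "'a word" where
  "0 = Word []"

definition plus_word :: "'a word \<Rightarrow> 'a word \<Rightarrow> 'a word" where
  "u + v = Word (letters u @ letters v)"

instance
  by standard (simp_all add: zero_word_def plus_word_def)

end

type_synonym 'x free_algebra = "'x word \<Rightarrow>\<^sub>0 rat"

definition free_scale :: "rat \<Rightarrow> 'x free_algebra \<Rightarrow> 'x free_algebra" where
  "free_scale c p = Poly_Mapping.map (\<lambda>r. c * r) p"

definition generator :: "'x \<Rightarrow> 'x free_algebra" where
  "generator x = Poly_Mapping.single (Word [x]) 1"

definition antitetrad :: "'r::ring \<Rightarrow> 'r \<Rightarrow> 'r \<Rightarrow> 'r \<Rightarrow> 'r" where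
  "antitetrad x y z w = x * y * z * w - w * z * y * x"

definition antitetrad_identity :: "'x polynomial \<Rightarrow> bool" where
  "antitetrad_identity I \<longleftrightarrow> eval_poly free_scale antitetrad generator I = 0"

datatype var = Va | Vb | Vc | Vd | Ve | Vf | Vg

definition skew_symmetry_at ::
  "'x monomial \<Rightarrow> 'x monomial \<Rightarrow> 'x monomial \<Rightarrow> 'x monomial \<Rightarrow> 'x polynomial"
where
  "skew_symmetry_at a b c d = mon \<langle>a, b, c, d\<rangle> + mon \<langle>d, c, b, a\<rangle>"

definition identity1_at ::
  "'x monomial \<Rightarrow> 'x monomial \<Rightarrow> 'x monomial \<Rightarrow> 'x monomial \<Rightarrow>
   'x monomial \<Rightarrow> 'x monomial \<Rightarrow> 'x monomial \<Rightarrow> 'x polynomial"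
where
  "identity1_at a b c d e f g =
       mon \<langle>\<langle>a, b, c, d\<rangle>, e, f, g\<rangle>
     - mon \<langle>\<langle>a, b, f, e\<rangle>, d, c, g\<rangle>
     + mon \<langle>\<langle>d, c, f, e\<rangle>, a, b, g\<rangle>
     + mon \<langle>g, \<langle>b, a, d, c\<rangle>, f, e\<rangle>
     - mon \<langle>g, \<langle>b, a, e, f\<rangle>, c, d\<rangle>
     + mon \<langle>g, \<langle>c, d, e, f\<rangle>, b, a\<rangle>"

definition identity2_at ::
  "'x monomial \<Rightarrow> 'x monomial \<Rightarrow> 'x monomial \<Rightarrow> 'x monomial \<Rightarrow>
   'x monomial \<Rightarrow> 'x monomial \<Rightarrow> 'x monomial \<Rightarrow> 'x polynomial"
where
  "identity2_at a b c d e f g =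
       mon \<langle>\<langle>a, b, c, d\<rangle>, e, f, g\<rangle>
     - mon \<langle>\<langle>a, f, g, c\<rangle>, b, e, d\<rangle>
     + mon \<langle>\<langle>c, a, b, d\<rangle>, g, e, f\<rangle>
     - mon \<langle>\<langle>c, b, a, f\<rangle>, g, e, d\<rangle>
     - mon \<langle>\<langle>c, g, d, b\<rangle>, a, e, f\<rangle>
     - mon \<langle>\<langle>c, g, e, f\<rangle>, a, b, d\<rangle>
     + mon \<langle>\<langle>c, g, e, d\<rangle>, b, a, f\<rangle>
     - mon \<langle>\<langle>b, a, c, f\<rangle>, e, d, g\<rangle>
     - mon \<langle>\<langle>b, c, f, g\<rangle>, a, e, d\<rangle>
     + mon \<langle>\<langle>b, e, d, g\<rangle>, a, c, f\<rangle>
     - mon \<langle>\<langle>g, f, e, d\<rangle>, c, b, a\<rangle>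
     + mon \<langle>\<langle>g, d, e, f\<rangle>, c, a, b\<rangle>
     - mon \<langle>\<langle>f, a, b, d\<rangle>, e, g, c\<rangle>
     - mon \<langle>\<langle>f, c, e, d\<rangle>, g, a, b\<rangle>
     - mon \<langle>a, \<langle>b, c, g, f\<rangle>, e, d\<rangle>
     - mon \<langle>c, \<langle>a, b, d, g\<rangle>, e, f\<rangle>
     + mon \<langle>c, \<langle>b, a, f, g\<rangle>, e, d\<rangle>
     + mon \<langle>b, \<langle>a, c, g, d\<rangle>, e, f\<rangle>
     - mon \<langle>b, \<langle>a, g, f, c\<rangle>, e, d\<rangle>
     + mon \<langle>b, \<langle>a, g, d, e\<rangle>, c, f\<rangle>
     + mon \<langle>d, \<langle>c, b, a, e\<rangle>, f, g\<rangle>"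

definition skew_symmetry :: "var polynomial" where
  "skew_symmetry = skew_symmetry_at (Var Va) (Var Vb) (Var Vc) (Var Vd)"

definition identity1 :: "var polynomial" where
  "identity1 = identity1_at (Var Va) (Var Vb) (Var Vc) (Var Vd) (Var Ve) (Var Vf) (Var Vg)"

definition identity2 :: "var polynomial" where
  "identity2 = identity2_at (Var Va) (Var Vb) (Var Vc) (Var Vd) (Var Ve) (Var Vf) (Var Vg)"

end

theory Submission
  imports Defs
begin

text \<open>Modulo reversal, the \<open>7!\<close> words in seven letters form 2520 classes. Expanded in the free algebra, a
  monomial with two brackets is the difference \<open>W(w) - W(w')\<close>, where \<open>W(w)\<close> is the sum of \<open>w\<close> and its
  reversal and \<open>w'\<close> arises from \<open>w\<close> by reversing a block of four consecutive letters. So, up to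
  skew-symmetry, the monomials are the 5040 edges of a graph on these classes (a Cayley graph of the
  alternating group of degree 7), and the identities of the anti-tetrad are the cycles of this
  graph. The identities (1) and (2) are closed walks of lengths 6 and 21, and the claim is that
  their images under permutations of the letters span the cycle space over the rationals.

  In an algebra that satisfies the identities, the monomials define a cochain on the edges which
  vanishes on these closed walks. Linear combinations of them yield further closed walks on which it
  vanishes, finally the Coxeter relations for suitable walks that realise the adjacent
  transpositions of a rearranged word. Hence the cochain is the coboundary of a potential on words,
  and the linear extension of the potential to the free algebra shows that every polynomial with
  zero expansion vanishes in the algebra.\<close>

section \<open>Words, brackets and walks\<close>

text \<open>Each block reversal is a product of two transpositions, hence even, so block reversals
  alone never realise a single transposition. The reversal of the whole word is a product of three
  transpositions: it is odd, and since \<open>W\<close> does not see it, it costs nothing. With it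
  as a fifth generator \<open>GR\<close> of value 0, adjacent transpositions become reachable and no
  presentation of the alternating group is needed. Words can then be sorted by removing descents,
  and the commutation and braid relations are exactly what makes the accumulated value independent
  of the order of the swaps.

  The cycle space has dimension 5040 - 2520 + 1 = 2521. Instead of one elimination there, each
  closed walk gets its own linear system, cut down by averaging over the permutations of the letters
  that preserve the walk up to orientation. Averaging and clearing denominators multiply the walk by
  nonzero integers, which is harmless over the rationals. Every walk obtained in this way is
  available as a relator for the later ones.\<close>

datatype gen = GA | GB | GC | GD | GR

fun act :: "gen \<Rightarrow> 'a list \<Rightarrow> 'a list" where
  "act GA [a, b, c, d, e, f, g] = [d, c, b, a, e, f, g]"
| "act GB [a, b, c, d, e, f, g] = [a, b, c, g, f, e, d]"
| "act GC [a, b, c, d, e, f, g] = [a, e, d, c, b, f, g]"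
| "act GD [a, b, c, d, e, f, g] = [a, b, f, e, d, c, g]"
| "act GR [a, b, c, d, e, f, g] = [g, f, e, d, c, b, a]"

primrec acts :: "gen list \<Rightarrow> 'a list \<Rightarrow> 'a list" where
  "acts [] x = x"
| "acts (s # r) x = acts r (act s x)"

lemma length_eq_7_iff: "length x = 7 \<longleftrightarrow> (\<exists>a b c d e f g. x = [a, b, c, d, e, f, g])"
  by (auto simp: length_Suc_conv numeral_eq_Suc)

lemma length_eq_7E:
  assumes "length x = 7"
  obtains a b c d e f g where "x = [a, b, c, d, e, f, g]"
  using assms unfolding length_eq_7_iff by blast

lemma length_act [simp]: "length x = 7 \<Longrightarrow> length (act s x) = 7"
  by (erule length_eq_7E, cases s) auto

lemma act_act [simp]: "length x = 7 \<Longrightarrow> act s (act s x) = x"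
  by (erule length_eq_7E, cases s) auto

lemma act_map: "length x = 7 \<Longrightarrow> act s (map f x) = map f (act s x)"
  by (erule length_eq_7E, cases s) auto

lemma distinct_act [simp]: "length x = 7 \<Longrightarrow> distinct (act s x) = distinct x"
  by (erule length_eq_7E, cases s) auto

lemma length_acts [simp]: "length x = 7 \<Longrightarrow> length (acts r x) = 7"
  by (induction r arbitrary: x) auto

lemma acts_append [simp]: "acts (r @ r') x = acts r' (acts r x)"
  by (induction r arbitrary: x) auto

lemma acts_map: "length x = 7 \<Longrightarrow> acts r (map f x) = map f (acts r x)"
  by (induction r arbitrary: x) (auto simp: act_map)

locale skew_bracket =
  fixes br :: "'v::ab_group_add \<Rightarrow> 'v \<Rightarrow> 'v \<Rightarrow> 'v \<Rightarrow> 'v"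
  assumes skew: "br w z y x = - br x y z w"
    and minus1: "br (- x) y z w = - br x y z w"
    and minus2: "br x (- y) z w = - br x y z w"
begin

text \<open>Under \<open>br x y z w = xyzw - wzyx\<close>, \<open>val s x\<close> becomes \<open>W x - W (act s x)\<close>, where
  \<open>W x\<close> is the sum of the word \<open>x\<close> and its reversal. So \<open>val\<close> is a 1-cochain on the graph whose
  vertices are the words of length 7 up to reversal.\<close>

fun val :: "gen \<Rightarrow> 'v list \<Rightarrow> 'v" where
  "val GA [a, b, c, d, e, f, g] = br (br a b c d) e f g"
| "val GB [a, b, c, d, e, f, g] = br (br g f e d) c b a"
| "val GC [a, b, c, d, e, f, g] = br a (br b c d e) f g"
| "val GD [a, b, c, d, e, f, g] = br g (br f e d c) b a"
| "val GR [a, b, c, d, e, f, g] = 0"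

primrec walk :: "gen list \<Rightarrow> 'v list \<Rightarrow> 'v" where
  "walk [] x = 0"
| "walk (s # r) x = val s x + walk r (act s x)"

definition vanishes :: "gen list \<Rightarrow> bool" where
  "vanishes r \<longleftrightarrow> (\<forall>x. length x = 7 \<longrightarrow> walk r x = 0)"

lemma flip1: "br (br d c b a) e f g = - br (br a b c d) e f g"
  by (subst skew[of d c b a]) (rule minus1)

lemma flip2: "br e (br d c b a) f g = - br e (br a b c d) f g"
  by (subst skew[of d c b a]) (rule minus2)

lemma val_act: "length x = 7 \<Longrightarrow> val s (act s x) = - val s x"
proof (erule length_eq_7E)
  fix a b c d e f g
  assume "x = [a, b, c, d, e, f, g]"
  then show ?thesis
    using flip1[of d c b a e f g] flip1[of d e f g c b a] flip2[of a e d c b f g] flip2[of g c d e f b a]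
    by (cases s) simp_all
qed

lemma val_GB: "length x = 7 \<Longrightarrow> val GB x = val GA (act GR x)"
  and val_GD: "length x = 7 \<Longrightarrow> val GD x = val GC (act GR x)"
  and val_GR: "length x = 7 \<Longrightarrow> val GR x = 0"
  by (auto elim!: length_eq_7E)

lemma walk_append: "walk (r @ r') x = walk r x + walk r' (acts r x)"
  by (induction r arbitrary: x) (auto simp: algebra_simps)

end

text \<open>Conjugation of a generator by the full reversal. Since reversal has value 0, every
  vanishing walk has a vanishing mirror image, and almost half of the later Coxeter relations follow
  without certificates of their own.\<close>

fun mirror :: "gen \<Rightarrow> gen" where
  "mirror GA = GB" | "mirror GB = GA" | "mirror GC = GD" | "mirror GD = GC" | "mirror GR = GR"

lemma act_mirror: "length x = 7 \<Longrightarrow> act GR (act (mirror s) x) = act s (act GR x)"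
  by (erule length_eq_7E, cases s) auto

lemma (in skew_bracket) walk_mirror:
  "length x = 7 \<Longrightarrow> walk (map mirror r) x = walk r (act GR x)"
proof (induction r arbitrary: x)
  case (Cons s r)
  have "val (mirror s) x = val s (act GR x)"
    using Cons.prems by (cases s) (auto elim!: length_eq_7E)
  with Cons show ?case
    by (simp add: act_mirror)
qed simp

lemma (in skew_bracket) vanishes_mirror: "vanishes r \<Longrightarrow> vanishes (map mirror r)"
  by (simp add: vanishes_def walk_mirror)

section \<open>Certificates for linear dependence of closed walks\<close>

text \<open>A list of length 7 encodes an assignment of the seven variables. The same encoding
  serves for permutations of the letters and for substituting elements of an algebra, so that
  \<open>map_sub_map\<close> covers both compositions.\<close>

fun sub :: "'a list \<Rightarrow> var \<Rightarrow> 'a" where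
  "sub [a, b, c, d, e, f, g] Va = a"
| "sub [a, b, c, d, e, f, g] Vb = b"
| "sub [a, b, c, d, e, f, g] Vc = c"
| "sub [a, b, c, d, e, f, g] Vd = d"
| "sub [a, b, c, d, e, f, g] Ve = e"
| "sub [a, b, c, d, e, f, g] Vf = f"
| "sub [a, b, c, d, e, f, g] Vg = g"

abbreviation alphabet :: "var list" where
  "alphabet \<equiv> [Va, Vb, Vc, Vd, Ve, Vf, Vg]"

lemma sub_map: "length x = 7 \<Longrightarrow> sub (map f x) v = f (sub x v)"
  by (erule length_eq_7E, cases v) auto

lemma map_sub_map: "length h = 7 \<Longrightarrow> map (sub x) (map (sub h) w) = map (sub (map (sub x) h)) w"
  by (simp add: sub_map)

lemma map_sub_alphabet: "length x = 7 \<Longrightarrow> map (sub x) alphabet = x"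
  by (erule length_eq_7E) auto

lemma sub_alphabet: "sub alphabet v = v"
  by (cases v) auto

section \<open>Integer chains of edges as search trees, arranged for evaluation by rewriting\<close>

datatype cmp = Lt | Eq | Gt

fun cmp_var :: "var \<Rightarrow> var \<Rightarrow> cmp" where
  "cmp_var Va Va = Eq" | "cmp_var Va _ = Lt" | "cmp_var _ Va = Gt"
| "cmp_var Vb Vb = Eq" | "cmp_var Vb _ = Lt" | "cmp_var _ Vb = Gt"
| "cmp_var Vc Vc = Eq" | "cmp_var Vc _ = Lt" | "cmp_var _ Vc = Gt"
| "cmp_var Vd Vd = Eq" | "cmp_var Vd _ = Lt" | "cmp_var _ Vd = Gt"
| "cmp_var Ve Ve = Eq" | "cmp_var Ve _ = Lt" | "cmp_var _ Ve = Gt"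
| "cmp_var Vf Vf = Eq" | "cmp_var Vf _ = Lt" | "cmp_var _ Vf = Gt"
| "cmp_var Vg Vg = Eq"

text \<open>The rest of the comparison is passed as a function, separately from its last argument. A
  partial application matches no defining equation, so evaluation by rewriting unfolds it only when
  the first letters agree. \<open>insert_at\<close> and \<open>split_at\<close> delay their
  recursive calls in the same way.\<close>

fun cmp_then :: "cmp \<Rightarrow> (var list \<Rightarrow> cmp) \<Rightarrow> var list \<Rightarrow> cmp" where
  "cmp_then Lt f ys = Lt" | "cmp_then Gt f ys = Gt" | "cmp_then Eq f ys = f ys"

fun cmp_word :: "var list \<Rightarrow> var list \<Rightarrow> cmp" where
  "cmp_word [] [] = Eq"
| "cmp_word [] (y # ys) = Lt"
| "cmp_word (x # xs) [] = Gt"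
| "cmp_word (x # xs) (y # ys) = cmp_then (cmp_var x y) (cmp_word xs) ys"

lemma cmp_var_Eq: "cmp_var x y = Eq \<Longrightarrow> x = y"
  by (cases x; cases y) auto

lemma cmp_word_Eq: "cmp_word u w = Eq \<Longrightarrow> u = w"
proof (induction u w rule: cmp_word.induct)
  case (4 x xs y ys)
  then show ?case
    by (cases "cmp_var x y") (auto dest: cmp_var_Eq)
qed auto

type_synonym key = "gen \<times> var list"

fun cmp_key :: "key \<Rightarrow> key \<Rightarrow> cmp" where
  "cmp_key (GA, u) (GA, w) = cmp_word u w"
| "cmp_key (GC, u) (GC, w) = cmp_word u w"
| "cmp_key (GA, u) _ = Lt"
| "cmp_key _ _ = Gt"

lemma cmp_key_Eq: "cmp_key k k' = Eq \<Longrightarrow> k = k'"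
  by (induction k k' rule: cmp_key.induct) (auto dest: cmp_word_Eq)

datatype tree = Leaf | Node tree key int tree

fun insert_at ::
  "cmp \<Rightarrow> (key \<Rightarrow> int \<Rightarrow> tree) \<Rightarrow> (key \<Rightarrow> int \<Rightarrow> tree) \<Rightarrow> key \<Rightarrow> int \<Rightarrow> tree \<Rightarrow> key \<Rightarrow> int \<Rightarrow> tree \<Rightarrow> tree"
where
  "insert_at Eq f g k c l k' c' r = Node l k' (c' + c) r"
| "insert_at Lt f g k c l k' c' r = Node (f k c) k' c' r"
| "insert_at Gt f g k c l k' c' r = Node l k' c' (g k c)"

primrec insert_tree :: "tree \<Rightarrow> key \<Rightarrow> int \<Rightarrow> tree" where
  "insert_tree Leaf k c = Node Leaf k c Leaf"
| "insert_tree (Node l k' c' r) k c =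
     insert_at (cmp_key k k') (insert_tree l) (insert_tree r) k c l k' c' r"

fun graft_left :: "tree \<times> int \<times> tree \<Rightarrow> key \<Rightarrow> int \<Rightarrow> tree \<Rightarrow> tree \<times> int \<times> tree" where
  "graft_left (a, n, b) k c r = (a, n, Node b k c r)"

fun graft_right :: "tree \<Rightarrow> key \<Rightarrow> int \<Rightarrow> tree \<times> int \<times> tree \<Rightarrow> tree \<times> int \<times> tree" where
  "graft_right l k c (a, n, b) = (Node l k c a, n, b)"

fun split_at ::
  "cmp \<Rightarrow> (key \<Rightarrow> tree \<times> int \<times> tree) \<Rightarrow> (key \<Rightarrow> tree \<times> int \<times> tree) \<Rightarrow> key \<Rightarrow>
   tree \<Rightarrow> key \<Rightarrow> int \<Rightarrow> tree \<Rightarrow> tree \<times> int \<times> tree"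
where
  "split_at Eq f g k l k' c r = (l, c, r)"
| "split_at Lt f g k l k' c r = graft_left (f k) k' c r"
| "split_at Gt f g k l k' c r = graft_right l k' c (g k)"

primrec split_tree :: "tree \<Rightarrow> key \<Rightarrow> tree \<times> int \<times> tree" where
  "split_tree Leaf k = (Leaf, 0, Leaf)"
| "split_tree (Node l k' c r) k = split_at (cmp_key k k') (split_tree l) (split_tree r) k l k' c r"

fun merge_at :: "(tree \<Rightarrow> tree) \<Rightarrow> (tree \<Rightarrow> tree) \<Rightarrow> key \<Rightarrow> int \<Rightarrow> tree \<times> int \<times> tree \<Rightarrow> tree" where
  "merge_at f g k c (l, c', r) = Node (f l) k (c + c') (g r)"

primrec merge_tree :: "tree \<Rightarrow> tree \<Rightarrow> tree" where
  "merge_tree Leaf t = t"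
| "merge_tree (Node l k c r) t = merge_at (merge_tree l) (merge_tree r) k c (split_tree t k)"

text \<open>Keys whose contributions cancel stay in the tree with coefficient 0, so a vanishing
  chain need not be \<open>Leaf\<close>.\<close>

primrec zero_tree :: "tree \<Rightarrow> bool" where
  "zero_tree Leaf = True"
| "zero_tree (Node l k c r) = (c = 0 \<and> zero_tree l \<and> zero_tree r)"

text \<open>The letters of a certificate are permuted by a group \<open>Hs\<close> of signed substitutions, and an edge
  is replaced by the least element of its orbit, with coefficient 0 if the orbit contains the edge
  with both signs.\<close>

type_synonym subst = "var list \<times> int"

fun smaller_at :: "cmp \<Rightarrow> subst \<Rightarrow> subst \<Rightarrow> subst" where
  "smaller_at Lt p q = p"
| "smaller_at Gt p q = q"
| "smaller_at Eq (u, c) (w, d) = (u, if c = d then c else 0)"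

fun smaller :: "subst \<Rightarrow> subst \<Rightarrow> subst" where
  "smaller (u, c) (w, d) = smaller_at (cmp_word u w) (u, c) (w, d)"

fun least :: "subst \<Rightarrow> subst list \<Rightarrow> subst" where
  "least p [] = p"
| "least p (q # qs) = least (smaller p q) qs"

text \<open>The second image is the same edge entered from its other end \<open>w'\<close>; running
  backwards changes the sign of the cochain.\<close>

fun images :: "var list \<Rightarrow> var list \<Rightarrow> subst list \<Rightarrow> subst list" where
  "images w w' [] = []"
| "images w w' ((h, c) # Hs) = (map (sub h) w, c) # (map (sub h) w', - c) # images w w' Hs"

fun add_key :: "gen \<Rightarrow> subst \<Rightarrow> int \<Rightarrow> tree \<Rightarrow> tree" where
  "add_key s (w, e) c t = insert_tree t (s, w) (c * e)"

fun add_edge :: "subst list \<Rightarrow> gen \<Rightarrow> var list \<Rightarrow> int \<Rightarrow> tree \<Rightarrow> tree" where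
  "add_edge Hs s w c t = add_key s (least (w, 1) (images w (act s w) Hs)) c t"

text \<open>After reversal of the word, a \<open>GB\<close> edge is a \<open>GA\<close> edge and a
  \<open>GD\<close> edge is a \<open>GC\<close> edge. Hence \<open>GA\<close> and \<open>GC\<close>
  are the only kinds of key that occur, and steps \<open>GR\<close> leave no trace.\<close>

fun add_step :: "subst list \<Rightarrow> gen \<Rightarrow> var list \<Rightarrow> int \<Rightarrow> tree \<Rightarrow> tree" where
  "add_step Hs GA w c t = add_edge Hs GA w c t"
| "add_step Hs GB w c t = add_edge Hs GA (act GR w) c t"
| "add_step Hs GC w c t = add_edge Hs GC w c t"
| "add_step Hs GD w c t = add_edge Hs GC (act GR w) c t"
| "add_step Hs GR w c t = t"

primrec add_walk :: "subst list \<Rightarrow> int \<Rightarrow> gen list \<Rightarrow> var list \<Rightarrow> tree \<Rightarrow> tree" where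
  "add_walk Hs c [] w t = t"
| "add_walk Hs c (s # r) w t = add_walk Hs c r (act s w) (add_step Hs s w c t)"

text \<open>\<open>R1\<close> and \<open>R2\<close> are the identities (1) and (2). In the other names a final number is either the
  exponent of the preceding word, as in \<open>AB6\<close>, or, after a single letter, the length of the walk.\<close>

datatype relator = R1 | R2 | Q12 | AB6 | ABAD4 | CD5 | Y12 | X12 | ACDC3 | AC5 | ACBD3 | Z12 | ABCD7 | ACD4 | P10

primrec relator_word :: "relator \<Rightarrow> gen list" where
  "relator_word R1 = [GA, GD, GA, GD, GA, GD]"
| "relator_word R2 = [GA, GC, GB, GD, GA, GD, GB, GA, GB, GC, GA, GC, GA, GB, GA, GB, GA, GC, GA, GC, GB]"
| "relator_word Q12 = [GA, GC, GB, GC, GA, GD, GA, GC, GB, GC, GA, GD]"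
| "relator_word AB6 = [GA, GB, GA, GB, GA, GB, GA, GB, GA, GB, GA, GB]"
| "relator_word ABAD4 = [GA, GB, GA, GD, GA, GB, GA, GD, GA, GB, GA, GD, GA, GB, GA, GD]"
| "relator_word CD5 = [GC, GD, GC, GD, GC, GD, GC, GD, GC, GD]"
| "relator_word Y12 = [GA, GB, GC, GA, GC, GB, GA, GC, GB, GD, GB, GC]"
| "relator_word X12 = [GA, GB, GD, GB, GA, GC, GA, GB, GD, GB, GA, GC]"
| "relator_word ACDC3 = [GA, GC, GD, GC, GA, GC, GD, GC, GA, GC, GD, GC]"
| "relator_word AC5 = [GA, GC, GA, GC, GA, GC, GA, GC, GA, GC]"
| "relator_word ACBD3 = [GA, GC, GB, GD, GA, GC, GB, GD, GA, GC, GB, GD]"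
| "relator_word Z12 = [GA, GB, GA, GD, GC, GD, GA, GB, GA, GD, GC, GD]"
| "relator_word ABCD7 = [GA, GB, GC, GD, GA, GB, GC, GD, GA, GB, GC, GD, GA, GB, GC, GD, GA, GB, GC, GD, GA, GB, GC, GD, GA, GB, GC, GD]"
| "relator_word ACD4 = [GA, GC, GD, GA, GC, GD, GA, GC, GD, GA, GC, GD]"
| "relator_word P10 = [GA, GB, GA, GC, GD, GB, GA, GB, GD, GC]"

text \<open>Summands are nested as a binary tree rather than a list, so that
  \<open>merge_tree\<close> can be applied to chains of comparable size.\<close>

datatype certificate = In int relator "var list" | Br certificate certificate

primrec chain :: "subst list \<Rightarrow> certificate \<Rightarrow> tree" where
  "chain Hs (In c r w) = add_walk Hs c (relator_word r) w Leaf"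
| "chain Hs (Br p q) = merge_tree (chain Hs p) (chain Hs q)"

primrec uses_only :: "relator list \<Rightarrow> certificate \<Rightarrow> bool" where
  "uses_only K (In c r w) \<longleftrightarrow> r \<in> set K \<and> length w = 7"
| "uses_only K (Br p q) \<longleftrightarrow> uses_only K p \<and> uses_only K q"

fun compose_right :: "subst \<Rightarrow> subst \<Rightarrow> subst" where
  "compose_right (h, c) (h', c') = (map (sub h') h, c' * c)"

text \<open>The test asks only that every translate of the finite list covers the list. Counting
  then shows that translation by a member permutes it, which is all that averaging requires.\<close>

definition is_group :: "subst list \<Rightarrow> bool" where
  "is_group Hs \<longleftrightarrow> Hs \<noteq> [] \<and> distinct Hs \<and>
     list_all (\<lambda>p. length (fst p) = 7 \<and> (snd p = 1 \<or> snd p = - 1) \<and>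
       list_all (\<lambda>q. q \<in> set (map (compose_right p) Hs)) Hs) Hs"

text \<open>Under the trivial group no two different edges are identified. A zero tree therefore
  expresses an identity of edge chains: the translate of \<open>X\<close> by the substitution is
  \<open>X\<close> itself or its negative.\<close>

definition semi_invariant :: "subst list \<Rightarrow> gen list \<Rightarrow> bool" where
  "semi_invariant Hs X \<longleftrightarrow> list_all (\<lambda>p. zero_tree
     (add_walk [(alphabet, 1)] (- snd p) X alphabet (add_walk [(alphabet, 1)] 1 X (fst p) Leaf))) Hs"

text \<open>By semi-invariance all signed translates of \<open>X\<close> agree, so averaging
  multiplies \<open>X\<close> by the order of the group. The final test compares the averages of the
  combination \<open>T\<close> and of \<open>d\<close> copies of \<open>X\<close>, which is why
  neither \<open>T\<close> nor its number of terms has to reflect the symmetry.\<close>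

definition certifies :: "relator list \<Rightarrow> subst list \<Rightarrow> certificate \<Rightarrow> int \<Rightarrow> gen list \<Rightarrow> bool" where
  "certifies K Hs T d X \<longleftrightarrow> is_group Hs \<and> semi_invariant Hs X \<and> uses_only K T \<and> d \<noteq> 0 \<and>
     zero_tree (merge_tree (chain Hs T) (add_walk Hs (- d) X alphabet Leaf))"

section \<open>Soundness of the certificates\<close>

locale skew_algebra = quaternary_algebra scale br
  for scale :: "rat \<Rightarrow> 'v::ab_group_add \<Rightarrow> 'v" and br +
  assumes br_skew: "br w z y x = - br x y z w"
begin

sublocale skew_bracket br
proof
  show "br w z y x = - br x y z w" for x y z w
    by (rule br_skew)
  show "br (- x) y z w = - br x y z w" for x y z w
    using module_hom.neg[OF Vector_Spaces.linear.axioms(3)[OF linear1]] by blast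
  show "br x (- y) z w = - br x y z w" for x y z w
    using module_hom.neg[OF Vector_Spaces.linear.axioms(3)[OF linear2]] by blast
qed

abbreviation iscale :: "int \<Rightarrow> 'v \<Rightarrow> 'v" where
  "iscale c \<equiv> scale (of_int c)"

primrec total :: "(key \<Rightarrow> 'v) \<Rightarrow> tree \<Rightarrow> 'v" where
  "total f Leaf = 0"
| "total f (Node l k c r) = total f l + iscale c (f k) + total f r"

lemma total_insert_tree: "total f (insert_tree t k c) = total f t + iscale c (f k)"
proof (induction t)
  case (Node l k' c' r)
  then show ?case
    by (cases "cmp_key k k'") (auto dest: cmp_key_Eq simp: scale_left_distrib algebra_simps)
qed simp

lemma total_split_tree:
  "split_tree t k = (a, n, b) \<Longrightarrow> total f t = total f a + iscale n (f k) + total f b"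
proof (induction t arbitrary: a n b)
  case (Node l k' c r)
  show ?case
  proof (cases "cmp_key k k'")
    case Lt
    obtain a' n' b' where "split_tree l k = (a', n', b')"
      using prod_cases3 by blast
    with Lt Node show ?thesis
      by (auto simp: algebra_simps)
  next
    case Eq
    with Node.prems show ?thesis
      by (auto dest: cmp_key_Eq)
  next
    case Gt
    obtain a' n' b' where "split_tree r k = (a', n', b')"
      using prod_cases3 by blast
    with Gt Node show ?thesis
      by (auto simp: algebra_simps)
  qed
qed simp

lemma total_merge_tree: "total f (merge_tree t u) = total f t + total f u"
proof (induction t arbitrary: u)
  case (Node l k c r)
  obtain a n b where u: "split_tree u k = (a, n, b)"
    using prod_cases3 by blast
  from total_split_tree[OF u, of f] Node show ?case
    by (simp add: u scale_left_distrib algebra_simps)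
qed simp

lemma total_zero_tree: "zero_tree t \<Longrightarrow> total f t = 0"
  by (induction t) auto

text \<open>Up to the factor \<open>length Hs\<close>, this is the projection of the cochain onto
  its semi-invariant part. It depends on an edge only through its orbit, up to sign, which justifies
  storing one representative per orbit.\<close>

definition sym_val :: "'v list \<Rightarrow> subst list \<Rightarrow> gen \<Rightarrow> var list \<Rightarrow> 'v" where
  "sym_val x Hs s w = (\<Sum>(h, c)\<leftarrow>Hs. iscale c (val s (map (sub x) (map (sub h) w))))"

definition sym_walk :: "'v list \<Rightarrow> subst list \<Rightarrow> gen list \<Rightarrow> var list \<Rightarrow> 'v" where
  "sym_walk x Hs r w = (\<Sum>(h, c)\<leftarrow>Hs. iscale c (walk r (map (sub x) (map (sub h) w))))"

lemma sym_val_act: "length w = 7 \<Longrightarrow> sym_val x Hs s (act s w) = - sym_val x Hs s w"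
  unfolding sym_val_def
  by (induction Hs) (auto simp: act_map[symmetric] val_act simp del: map_map)

lemma sym_walk_Cons:
  "length w = 7 \<Longrightarrow> sym_walk x Hs (s # r) w = sym_val x Hs s w + sym_walk x Hs r (act s w)"
  unfolding sym_walk_def sym_val_def
  by (induction Hs) (auto simp: act_map scale_right_distrib algebra_simps simp del: map_map)

text \<open>A list of translates that covers \<open>Hs\<close> and has the same length as the
  repetition-free \<open>Hs\<close> can neither leave \<open>Hs\<close> nor repeat an entry.\<close>

lemma is_groupD:
  assumes "is_group Hs" "(h, c) \<in> set Hs"
  shows "length h = 7" "c = 1 \<or> c = - 1" "distinct Hs"
    "distinct (map (compose_right (h, c)) Hs)" "set (map (compose_right (h, c)) Hs) = set Hs"
proof -
  let ?L = "map (compose_right (h, c)) Hs"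
  have *: "length h = 7 \<and> (c = 1 \<or> c = - 1) \<and> set Hs \<subseteq> set ?L" and d: "distinct Hs"
    using assms by (force simp: is_group_def list_all_iff)+
  then show "length h = 7" "c = 1 \<or> c = - 1" "distinct Hs"
    by auto
  have "card (set ?L) \<le> length Hs"
    using card_length[of ?L] by simp
  then have "card (set ?L) \<le> card (set Hs)"
    by (simp add: distinct_card[OF d] del: set_map)
  with * show eq: "set ?L = set Hs"
    by (metis List.finite_set card_seteq)
  then have "card (set ?L) = length ?L"
    by (simp add: distinct_card[OF d] del: set_map)
  then show "distinct ?L"
    by (rule card_distinct)
qed

lemma sym_val_subst:
  assumes "is_group Hs" "(h, c) \<in> set Hs"
  shows "sym_val x Hs s (map (sub h) w) = iscale c (sym_val x Hs s w)"
proof -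
  let ?g = "\<lambda>(h, c). iscale c (val s (map (sub x) (map (sub h) w)))"
  note H = is_groupD[OF assms]
  \<comment> \<open>Translation by a group element only reorders the sum; the sign \<open>c\<close>
    of that element comes out as a common factor.\<close>
  have "(\<Sum>p\<leftarrow>map (compose_right (h, c)) Hs. ?g p) = (\<Sum>p\<leftarrow>Hs. ?g p)"
    using H(3-5) by (simp only: sum_list_distinct_conv_sum_set)
  then have "sym_val x Hs s w = (\<Sum>p\<leftarrow>Hs. ?g (compose_right (h, c) p))"
    by (simp add: sym_val_def o_def)
  also have "\<dots> = iscale c (sym_val x Hs s (map (sub h) w))"
    unfolding sym_val_def
    by (induction Hs) (auto simp: map_sub_map[OF H(1)] scale_right_distrib mult.commute simp del: map_map)
  finally show ?thesis
    using H(2) by auto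
qed

definition represents :: "(var list \<Rightarrow> 'v) \<Rightarrow> 'v \<Rightarrow> subst \<Rightarrow> bool" where
  "represents G v p \<longleftrightarrow> v = iscale (snd p) (G (fst p))"

lemma represents_smaller:
  assumes "represents G v p" "represents G v q"
  shows "represents G v (smaller p q)"
proof (cases p; cases q)
  fix u c w d
  assume pq: "p = (u, c)" "q = (w, d)"
  show ?thesis
  proof (cases "cmp_word u w")
    case Eq
    then have "u = w"
      by (rule cmp_word_Eq)
    \<comment> \<open>If the orbit reaches the same word with two different coefficients, the value
      there is annihilated by their nonzero difference. Recording the coefficient 0 is then
      correct.\<close>
    moreover from this have "c \<noteq> d \<Longrightarrow> G u = 0"
      using assms scale_cancel_right[of "of_int c" "G u" "of_int d"]
      by (auto simp: represents_def pq)
    ultimately show ?thesis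
      using assms Eq by (auto simp: represents_def pq)
  qed (use assms in \<open>auto simp: pq\<close>)
qed

lemma represents_least:
  "represents G v p \<Longrightarrow> (\<And>q. q \<in> set qs \<Longrightarrow> represents G v q) \<Longrightarrow> represents G v (least p qs)"
  by (induction qs arbitrary: p) (simp_all add: represents_smaller del: smaller.simps)

lemma represents_images:
  assumes "is_group Hs" "length w = 7" "set Hs' \<subseteq> set Hs" "q \<in> set (images w (act s w) Hs')"
  shows "represents (sym_val x Hs s) (sym_val x Hs s w) q"
  using assms(3,4)
proof (induction Hs')
  case (Cons p Hs')
  obtain h c where p: "p = (h, c)"
    by (cases p)
  with Cons.prems have hc: "(h, c) \<in> set Hs"
    by auto
  have "iscale c (iscale c v) = v" for v
    using is_groupD(2)[OF assms(1) hc] by auto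
  then have "represents (sym_val x Hs s) (sym_val x Hs s w) (map (sub h) w, c)"
    "represents (sym_val x Hs s) (sym_val x Hs s w) (map (sub h) (act s w), - c)"
    using sym_val_subst[OF assms(1) hc] assms(2)
    by (simp_all add: represents_def sym_val_act)
  with Cons p show ?case
    by auto
qed simp

abbreviation sym_key :: "'v list \<Rightarrow> subst list \<Rightarrow> key \<Rightarrow> 'v" where
  "sym_key x Hs k \<equiv> sym_val x Hs (fst k) (snd k)"

lemma total_add_edge:
  assumes "is_group Hs" "length w = 7"
  shows "total (sym_key x Hs) (add_edge Hs s w c t) =
    total (sym_key x Hs) t + iscale c (sym_val x Hs s w)"
proof -
  obtain u e where ue: "least (w, 1) (images w (act s w) Hs) = (u, e)"
    by (cases "least (w, 1) (images w (act s w) Hs)")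
  have "represents (sym_val x Hs s) (sym_val x Hs s w) (u, e)"
    unfolding ue[symmetric]
    by (rule represents_least) (simp add: represents_def, rule represents_images[OF assms subset_refl])
  then show ?thesis
    by (simp add: ue total_insert_tree represents_def)
qed

lemma total_add_step:
  assumes "is_group Hs" "length w = 7"
  shows "total (sym_key x Hs) (add_step Hs s w c t) =
    total (sym_key x Hs) t + iscale c (sym_val x Hs s w)"
proof -
  have "sym_val x Hs GB w = sym_val x Hs GA (act GR w)" "sym_val x Hs GD w = sym_val x Hs GC (act GR w)"
    "sym_val x Hs GR w = 0"
    unfolding sym_val_def using assms(2)
    by (induction Hs) (auto simp: act_map val_GB val_GD val_GR simp del: map_map)
  then show ?thesis
    using assms by (cases s) (simp_all add: total_add_edge del: add_edge.simps)
qed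

lemma total_add_walk:
  assumes "is_group Hs" "length w = 7"
  shows "total (sym_key x Hs) (add_walk Hs c r w t) =
    total (sym_key x Hs) t + iscale c (sym_walk x Hs r w)"
  using assms(2)
proof (induction r arbitrary: w t)
  case Nil
  have "sym_walk x Hs [] w = 0"
    unfolding sym_walk_def by (induction Hs) auto
  then show ?case
    by simp
next
  case (Cons s r)
  then show ?case
    by (simp add: total_add_step[OF assms(1)] sym_walk_Cons scale_right_distrib algebra_simps)
qed

lemma total_chain_vanishing:
  assumes "is_group Hs" "uses_only K T" "\<And>r. r \<in> set K \<Longrightarrow> vanishes (relator_word r)"
  shows "total (sym_key x Hs) (chain Hs T) = 0"
  using assms(2)
proof (induction T)
  case (In c r w)
  then have "vanishes (relator_word r)" "length w = 7"
    using assms(3) by auto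
  then have "sym_walk x Hs (relator_word r) w = 0"
    unfolding sym_walk_def vanishes_def by (induction Hs) (auto simp del: map_map)
  with \<open>length w = 7\<close> show ?case
    by (simp add: total_add_walk[OF assms(1)])
qed (simp add: total_merge_tree)

lemma semi_invariantD:
  assumes "is_group Hs" "semi_invariant Hs X" "(h, c) \<in> set Hs" "length x = 7"
  shows "walk X (map (sub x) h) = iscale c (walk X x)"
proof -
  have triv: "is_group [(alphabet, 1)]"
    by (simp add: is_group_def)
  have len: "length h = 7"
    by (rule is_groupD(1)[OF assms(1,3)])
  have w: "sym_walk x [(alphabet, 1)] X w = walk X (map (sub x) w)" for w
    by (simp add: sym_walk_def sub_alphabet o_def)
  have "zero_tree (add_walk [(alphabet, 1)] (- c) X alphabet (add_walk [(alphabet, 1)] 1 X h Leaf))"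
    using assms(2,3) by (auto simp: semi_invariant_def list_all_iff)
  from total_zero_tree[OF this, of "sym_key x [(alphabet, 1)]"] show ?thesis
    using map_sub_alphabet[OF assms(4)] w[of alphabet]
    by (simp add: total_add_walk[OF triv] len w del: map_map list.map)
qed

theorem certifies_vanishes:
  assumes "certifies K Hs T d X" "\<And>r. r \<in> set K \<Longrightarrow> vanishes (relator_word r)"
  shows "vanishes X"
  unfolding vanishes_def
proof (intro allI impI)
  fix x :: "'v list"
  assume x: "length x = 7"
  have H: "is_group Hs" "semi_invariant Hs X" "uses_only K T" "d \<noteq> 0"
    and z: "zero_tree (merge_tree (chain Hs T) (add_walk Hs (- d) X alphabet Leaf))"
    using assms(1) by (auto simp: certifies_def)
  \<comment> \<open>The sign from semi-invariance meets the sign of the group element in the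
    average, and their product is 1. Each group element thus contributes one plain copy of the
    walk.\<close>
  have "iscale c (walk X (map (sub x) (map (sub h) alphabet))) = walk X x" if hc: "(h, c) \<in> set Hs" for h c
  proof -
    have "iscale c (iscale c v) = v" for v
      using is_groupD(2)[OF H(1) hc] by auto
    then show ?thesis
      using semi_invariantD[OF H(1,2) hc x] map_sub_alphabet[OF is_groupD(1)[OF H(1) hc]]
      by (simp del: map_map list.map)
  qed
  then have "sym_walk x Hs X alphabet = (\<Sum>p\<leftarrow>Hs. walk X x)"
    unfolding sym_walk_def by (intro arg_cong[of _ _ sum_list] map_cong) auto
  also have "\<dots> = scale (of_nat (length Hs)) (walk X x)"
    by (induction Hs) (auto simp: scale_left_distrib)
  finally have s: "sym_walk x Hs X alphabet = scale (of_nat (length Hs)) (walk X x)" .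
  \<comment> \<open>The relators contribute nothing, so only the multiple of \<open>X\<close>
    survives; \<open>d\<close> and the order of the group can be divided out.\<close>
  have "iscale (- d) (sym_walk x Hs X alphabet) = 0"
    using total_zero_tree[OF z, of "sym_key x Hs"] total_chain_vanishing[OF H(1,3) assms(2), of x]
    by (simp add: total_merge_tree total_add_walk[OF H(1)] del: list.map)
  with H(1,4) show "walk X x = 0"
    by (auto simp: s is_group_def)
qed

end

locale tetrad_algebra = skew_algebra scale br
  for scale :: "rat \<Rightarrow> 'v::ab_group_add \<Rightarrow> 'v" and br +
  assumes vanishes_R1: "vanishes (relator_word R1)"
    and vanishes_R2: "vanishes (relator_word R2)"

text \<open>Identity (1) is the hexagon stating that \<open>GA\<close> followed by \<open>GD\<close>
  has order 3. The flips turn round those inner brackets that the walk reads in the opposite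
  direction.\<close>

lemma (in skew_bracket) identity1_walk:
  "br (br a b c d) e f g - br (br a b f e) d c g + br (br d c f e) a b g + br g (br b a d c) f
  e - br g (br b a e f) c d + br g (br c d e f) b a
   = walk (relator_word R1) [a, b, c, d, e, f, g]"
  by (simp add: flip2[of g f e a b c d] flip1[of e f b a d c g])

lemma (in skew_bracket) identity2_walk:
  "br (br a b c d) e f g - br (br a f g c) b e d + br (br c a b d) g e f - br (br c b a f) g e
  d - br (br c g d b) a e f - br (br c g e f) a b d + br (br c g e d) b a f - br (br b a c f)
  e d g - br (br b c f g) a e d + br (br b e d g) a c f - br (br g f e d) c b a + br (br g d e
  f) c a b - br (br f a b d) e g c - br (br f c e d) g a b - br a (br b c g f) e d - br c (br
  a b d g) e f + br c (br b a f g) e d + br b (br a c g d) e f - br b (br a g f c) e d + br b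
  (br a g d e) c f + br d (br c b a e) f g
   = walk (relator_word R2) [a, b, c, d, e, f, g]"
  by (simp add: flip1[of g f c b a e d] flip2[of b c f g a e d] flip1[of d e c f g a b] flip1[of f c a b e d
  g] flip1[of b d g c a e f] flip2[of c g d b a e f] flip1[of f e g c a b d] flip1[of d b a f
  e g c] flip1[of f a b c g e d] flip1[of c g f a b e d] flip2[of a f g c b e d] flip1[of d e
  f g c b a])

section \<open>Derived closed walks\<close>

text \<open>For each closed walk, the group consists of the permutations of the letters that map its cycle to
  itself or to its negative; the coefficients solve a linear system on the orbits of edges.\<close>

lemma certifies_Q12: "certifies [R2]
  [([Va,Vb,Vc,Vd,Ve,Vf,Vg],1), ([Va,Vb,Vf,Ve,Vd,Vc,Vg],-1), ([Va,Vg,Vc,Ve,Vd,Vf,Vb],1),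
  ([Va,Vg,Vf,Vd,Ve,Vc,Vb],-1)]
  (In 2 R2 [Vd,Ve,Vc,Vb,Vf,Vg,Va])
  1 (relator_word Q12)"
  by code_simp

text \<open>Symmetrising identity (2) alone suffices: the signed sum of its images under the four
  symmetries of this walk is twice the walk.\<close>

lemma (in tetrad_algebra) vanishes_Q12: "vanishes (relator_word Q12)"
  by (rule certifies_vanishes[OF certifies_Q12]) (auto simp del: relator_word.simps intro: vanishes_R2)

text \<open>The product of \<open>GA\<close> and \<open>GB\<close> is a 3-cycle times two disjoint
  transpositions, hence of order 6, and the walk is a 12-gon. The 24 signed permutations are all its
  rotations and reflections, reflections carrying the sign -1. The large integers are a rational
  solution with denominators cleared, with common multiplier \<open>d\<close>.\<close>

lemma certifies_AB6: "certifies [R1, R2, Q12]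
  [([Va,Vb,Vc,Vd,Ve,Vf,Vg],1), ([Va,Vb,Vc,Vg,Vf,Ve,Vd],-1), ([Va,Vc,Vb,Vd,Vf,Ve,Vg],1),
  ([Va,Vc,Vb,Vg,Ve,Vf,Vd],-1), ([Va,Ve,Vf,Vd,Vc,Vb,Vg],1), ([Va,Ve,Vf,Vg,Vb,Vc,Vd],-1),
  ([Va,Vf,Ve,Vd,Vb,Vc,Vg],1), ([Va,Vf,Ve,Vg,Vc,Vb,Vd],-1), ([Vd,Vb,Vc,Va,Vf,Ve,Vg],-1),
  ([Vd,Vb,Vc,Vg,Ve,Vf,Va],1), ([Vd,Vc,Vb,Va,Ve,Vf,Vg],-1), ([Vd,Vc,Vb,Vg,Vf,Ve,Va],1),
  ([Vd,Ve,Vf,Va,Vb,Vc,Vg],-1), ([Vd,Ve,Vf,Vg,Vc,Vb,Va],1), ([Vd,Vf,Ve,Va,Vc,Vb,Vg],-1),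
  ([Vd,Vf,Ve,Vg,Vb,Vc,Va],1), ([Vg,Vb,Vc,Va,Ve,Vf,Vd],1), ([Vg,Vb,Vc,Vd,Vf,Ve,Va],-1),
  ([Vg,Vc,Vb,Va,Vf,Ve,Vd],1), ([Vg,Vc,Vb,Vd,Ve,Vf,Va],-1), ([Vg,Ve,Vf,Va,Vc,Vb,Vd],1),
  ([Vg,Ve,Vf,Vd,Vb,Vc,Va],-1), ([Vg,Vf,Ve,Va,Vb,Vc,Vd],1), ([Vg,Vf,Ve,Vd,Vc,Vb,Va],-1)]
  (Br (Br (Br (Br (Br (Br (In 3100795475032 R1 [Va,Vb,Vc,Vd,Ve,Vf,Vg]) (Br (In 2224358424456
  R2 [Vb,Vc,Va,Vd,Vf,Vg,Ve]) (In (-2206722639840) R1 [Va,Vb,Vd,Vc,Vg,Vf,Ve]))) (Br (Br (In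
  1436007662528 R2 [Vb,Va,Vc,Ve,Vf,Vg,Vd]) (In 1356849553108 R1 [Va,Vb,Vc,Ve,Vg,Vd,Vf])) (Br
  (In (-1338857699076) R2 [Va,Vb,Vd,Vg,Vc,Vf,Ve]) (In 1292239525516 R1
  [Va,Vd,Vb,Vf,Ve,Vg,Vc])))) (Br (Br (In 1027400951612 R2 [Vb,Ve,Vf,Vc,Va,Vd,Vg]) (Br (In
  1025934337584 R2 [Va,Vb,Vd,Vf,Ve,Vg,Vc]) (In 920581320700 R1 [Va,Vd,Vb,Ve,Vf,Vg,Vc]))) (Br
  (Br (In (-918378680364) R2 [Vb,Va,Ve,Vg,Vf,Vd,Vc]) (In (-760961476110) R1
  [Va,Vb,Vd,Vf,Ve,Vg,Vc])) (Br (In 728008104176 Q12 [Va,Vb,Vc,Ve,Vg,Vd,Vf]) (In 648761846032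
  R2 [Vb,Va,Vd,Vg,Vc,Vf,Ve]))))) (Br (Br (Br (In 638853474920 R2 [Vb,Va,Ve,Vd,Vc,Vf,Vg]) (Br
  (In (-627734218032) R2 [Vb,Ve,Vf,Va,Vc,Vg,Vd]) (In (-570373869420) R2
  [Va,Vb,Ve,Vf,Vc,Vd,Vg]))) (Br (Br (In 539120269084 R1 [Va,Vb,Vd,Vg,Vc,Vf,Ve]) (In
  533240864496 R2 [Vb,Va,Ve,Vc,Vd,Vg,Vf])) (Br (In (-531589416064) R2 [Va,Vd,Vb,Ve,Vg,Vf,Vc])
  (In 527123463960 R2 [Vb,Va,Ve,Vg,Vd,Vc,Vf])))) (Br (Br (In (-514831984916) R2
  [Va,Vb,Vd,Vf,Vg,Ve,Vc]) (Br (In (-495546482484) Q12 [Vb,Va,Vd,Vg,Vc,Vf,Ve]) (In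
  (-485791398068) R2 [Va,Vb,Vd,Ve,Vc,Vg,Vf]))) (Br (Br (In 474641345024 R1
  [Va,Vb,Vd,Vg,Vf,Ve,Vc]) (In (-441339510956) R2 [Vb,Ve,Va,Vf,Vg,Vc,Vd])) (Br (In
  (-438430913456) R2 [Va,Vb,Vd,Vf,Vc,Vg,Ve]) (In (-425685207276) R2
  [Vb,Ve,Va,Vd,Vf,Vc,Vg])))))) (Br (Br (Br (Br (In (-418988018232) R2 [Vb,Va,Ve,Vg,Vf,Vc,Vd])
  (Br (In (-417346811832) R2 [Va,Vd,Vg,Vb,Ve,Vc,Vf]) (In (-410088134312) R2
  [Vb,Ve,Vf,Va,Vd,Vc,Vg]))) (Br (Br (In (-410088134312) R1 [Va,Vb,Vd,Vg,Vc,Ve,Vf]) (In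
  404260549564 R2 [Va,Vb,Ve,Vc,Vg,Vf,Vd])) (Br (In (-401261982572) R2 [Va,Vb,Vc,Vd,Vg,Vf,Ve])
  (In (-378794063985) Q12 [Va,Vb,Vd,Vf,Ve,Vg,Vc])))) (Br (Br (In 374856704344 R2
  [Vb,Vc,Va,Vd,Vf,Ve,Vg]) (Br (In 374533720676 R2 [Vb,Va,Vd,Vf,Vc,Vg,Ve]) (In (-370782090884)
  R1 [Va,Vb,Vd,Vc,Ve,Vf,Vg]))) (Br (Br (In (-370484946844) R2 [Va,Vb,Ve,Vg,Vc,Vd,Vf]) (In
  343725824140 Q12 [Va,Vb,Vc,Vd,Ve,Vg,Vf])) (Br (In 329825189456 R2 [Vb,Va,Ve,Vd,Vc,Vg,Vf])
  (In (-326685148100) R1 [Va,Vb,Vc,Ve,Vg,Vf,Vd]))))) (Br (Br (Br (In (-326685148100) Q12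
  [Va,Vb,Vc,Ve,Vd,Vf,Vg]) (Br (In (-322525802628) R1 [Va,Vd,Vb,Vf,Vc,Vg,Ve]) (In
  (-315138828064) R2 [Va,Vd,Vb,Vc,Ve,Vf,Vg]))) (Br (Br (In (-311502344532) R2
  [Vb,Va,Vd,Ve,Vc,Vf,Vg]) (In 305323053088 R2 [Vb,Ve,Va,Vc,Vg,Vd,Vf])) (Br (In (-296649600816)
  R2 [Vb,Va,Vd,Vg,Vf,Vc,Ve]) (In (-283988855976) Q12 [Vb,Va,Vd,Vc,Ve,Vg,Vf])))) (Br (Br (Br
  (In 276458628920 R2 [Vb,Va,Ve,Vg,Vc,Vf,Vd]) (In (-272897240884) R2 [Vb,Ve,Va,Vc,Vd,Vg,Vf]))
  (Br (In 268482283200 R1 [Va,Vb,Vd,Vc,Ve,Vg,Vf]) (In (-261915953980) R2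
  [Vb,Va,Ve,Vd,Vg,Vc,Vf]))) (Br (Br (In (-257436830492) R2 [Vb,Va,Vc,Ve,Vd,Vf,Vg]) (In
  (-246083440780) R1 [Va,Vb,Vd,Vc,Vf,Ve,Vg])) (Br (In 244605364660 Q12 [Vb,Va,Vd,Vc,Ve,Vf,Vg])
  (In (-238616748772) Q12 [Vb,Va,Ve,Vg,Vd,Vf,Vc]))))))) (Br (Br (Br (Br (Br (In 237522319324
  R1 [Va,Vb,Vc,Ve,Vd,Vf,Vg]) (Br (In 234382277968 R2 [Va,Vb,Vd,Vg,Ve,Vf,Vc]) (In
  (-212725391044) R2 [Vb,Vc,Ve,Va,Vg,Vf,Vd]))) (Br (Br (In 207715433200 R2
  [Va,Vb,Ve,Vc,Vf,Vg,Vd]) (In 203918376512 R2 [Vb,Vc,Va,Ve,Vg,Vd,Vf])) (Br (In (-199083313592)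
  R2 [Va,Vd,Vb,Ve,Vc,Vf,Vg]) (In (-190480467104) R2 [Va,Vd,Vb,Vg,Ve,Vf,Vc])))) (Br (Br (In
  (-188040647724) R1 [Vb,Va,Vc,Ve,Vf,Vg,Vd]) (Br (In 179691905004 R2 [Va,Vb,Ve,Vd,Vc,Vg,Vf])
  (In (-179423556976) Q12 [Va,Vb,Vd,Ve,Vc,Vf,Vg]))) (Br (Br (In (-178512967768) R2
  [Vb,Ve,Vc,Vf,Va,Vd,Vg]) (In 176071194608 R2 [Va,Vb,Vd,Ve,Vf,Vg,Vc])) (Br (In 174779997432 R2
  [Va,Vb,Ve,Vg,Vf,Vd,Vc]) (In 165569241996 R1 [Vb,Va,Vc,Ve,Vf,Vd,Vg]))))) (Br (Br (Br (In
  165569241996 Q12 [Vb,Vc,Va,Vd,Vg,Vf,Ve]) (Br (In 162464529188 R2 [Vb,Ve,Va,Vd,Vg,Vc,Vf]) (In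
  (-160030210380) R2 [Vb,Va,Vc,Vd,Vg,Vf,Ve]))) (Br (Br (In (-149030594544) R2
  [Vb,Va,Vd,Vf,Vg,Vc,Ve]) (In (-144890883760) R2 [Va,Vd,Vb,Vf,Vc,Vg,Ve])) (Br (In
  (-144890883760) R1 [Va,Vb,Vc,Vd,Vf,Vg,Ve]) (In (-143362974040) R1 [Va,Vb,Vc,Vd,Vg,Vf,Ve]))))
  (Br (Br (Br (In (-141285562384) R2 [Va,Vb,Ve,Vg,Vd,Vc,Vf]) (In 138229314460 R1
  [Va,Vb,Vc,Vd,Vf,Ve,Vg])) (Br (In (-138229314460) R2 [Va,Vb,Vd,Vg,Vc,Ve,Vf]) (In
  (-135253048712) R1 [Va,Vb,Vc,Ve,Vf,Vg,Vd]))) (Br (Br (In (-126810085320) R2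
  [Vb,Va,Ve,Vg,Vd,Vf,Vc]) (In 125385567796 Q12 [Va,Vb,Vd,Vc,Ve,Vg,Vf])) (Br (In
  (-116962266579) Q12 [Va,Vb,Vd,Ve,Vf,Vg,Vc]) (In 116428418540 R2 [Va,Vb,Ve,Vd,Vg,Vf,Vc]))))))
  (Br (Br (Br (Br (In (-116353279236) R1 [Va,Vd,Vb,Ve,Vc,Vf,Vg]) (Br (In 113076056172 R2
  [Vb,Va,Vd,Vc,Vg,Vf,Ve]) (In (-113076056172) R1 [Va,Vd,Vb,Vc,Ve,Vg,Vf]))) (Br (Br (In
  111678851148 R1 [Va,Vb,Vd,Ve,Vc,Vf,Vg]) (In 94817073528 R2 [Vb,Ve,Vf,Va,Vg,Vc,Vd])) (Br (In
  (-92302870132) R2 [Vb,Va,Ve,Vc,Vf,Vg,Vd]) (In 91561148740 R1 [Va,Vb,Vc,Vd,Vg,Ve,Vf])))) (Br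
  (Br (In (-91561148740) R2 [Va,Vd,Vb,Ve,Vf,Vc,Vg]) (Br (In (-91273535280) R1
  [Vb,Va,Vd,Vc,Ve,Vf,Vg]) (In (-81424311188) Q12 [Vb,Va,Ve,Vc,Vg,Vf,Vd]))) (Br (Br (In
  (-75232551052) R2 [Vb,Va,Vd,Vf,Vg,Ve,Vc]) (In 72730078960 R1 [Va,Vd,Vb,Vc,Vf,Vg,Ve])) (Br
  (In (-68534170052) R2 [Va,Vd,Vb,Vg,Ve,Vc,Vf]) (In (-66839920712) R2
  [Vb,Va,Ve,Vc,Vg,Vf,Vd]))))) (Br (Br (Br (In 66706304316 R1 [Va,Vb,Vc,Vd,Ve,Vg,Vf]) (Br (In
  (-66362310172) R2 [Vb,Va,Vd,Vf,Ve,Vc,Vg]) (In (-62974152664) Q12 [Vb,Vc,Va,Vd,Ve,Vg,Vf])))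
  (Br (Br (In 61654214808 R1 [Va,Vd,Vb,Vc,Ve,Vf,Vg]) (In (-60093224432) R2
  [Va,Vb,Vd,Vc,Vf,Ve,Vg])) (Br (In (-55417254744) R2 [Va,Vd,Vb,Vf,Vg,Vc,Ve]) (In 50934529860
  R2 [Vb,Va,Ve,Vc,Vd,Vf,Vg])))) (Br (Br (Br (In (-48739834720) R2 [Va,Vb,Vc,Ve,Vg,Vf,Vd]) (In
  47555314928 R1 [Va,Vb,Vd,Vg,Ve,Vf,Vc])) (Br (In (-41494136808) R1 [Va,Vb,Vd,Vc,Vf,Vg,Ve])
  (In 31417023392 R2 [Va,Vd,Vb,Vf,Vc,Ve,Vg]))) (Br (Br (In 22088533830 R1
  [Va,Vb,Vd,Ve,Vf,Vg,Vc]) (In (-4675969688) Q12 [Vb,Vc,Va,Vd,Vg,Ve,Vf])) (Br (In 3373348140 R2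
  [Va,Vb,Vd,Vc,Vg,Ve,Vf]) (In (-2337984844) Q12 [Vb,Ve,Va,Vc,Vd,Vg,Vf]))))))))
  1809984154062 (relator_word AB6)"
  by code_simp

lemma (in tetrad_algebra) vanishes_AB6: "vanishes (relator_word AB6)"
  by (rule certifies_vanishes[OF certifies_AB6]) (auto simp del: relator_word.simps intro: vanishes_R1 vanishes_R2 vanishes_Q12)

lemma certifies_ABAD4: "certifies [R1, R2, Q12, AB6]
  [([Va,Vb,Vc,Vd,Ve,Vf,Vg],1), ([Va,Vb,Vd,Vc,Vf,Ve,Vg],1), ([Va,Vb,Ve,Vf,Vc,Vd,Vg],-1),
  ([Va,Vb,Vf,Ve,Vd,Vc,Vg],-1), ([Vg,Vb,Vc,Vd,Vf,Ve,Va],-1), ([Vg,Vb,Vd,Vc,Ve,Vf,Va],-1),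
  ([Vg,Vb,Ve,Vf,Vd,Vc,Va],1), ([Vg,Vb,Vf,Ve,Vc,Vd,Va],1)]
  (Br (Br (Br (Br (Br (Br (Br (Br (In 2271797426668149068888786056104 R1
  [Va,Vb,Vc,Vd,Ve,Vf,Vg]) (In 798366868306997900801216496846 AB6 [Va,Vb,Vg,Vc,Vd,Vf,Ve])) (Br
  (In 757406145402603085801428255066 R2 [Va,Vb,Vg,Vc,Vd,Vf,Ve]) (Br (In
  695634366541190725543878314428 R2 [Vb,Va,Vg,Vc,Ve,Vf,Vd]) (In
  (-648726235186294736779048903468) R1 [Va,Vc,Vd,Vb,Vg,Ve,Vf])))) (Br (Br (In
  615339327721139659018641844286 R1 [Vc,Va,Vf,Ve,Vd,Vg,Vb]) (In 455063972312106656150464654324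
  R2 [Vc,Vd,Va,Vg,Ve,Vf,Vb])) (Br (In 429073749516716969019918401014 Q12
  [Va,Vc,Vb,Vd,Vf,Ve,Vg]) (Br (In (-415626389919040967453212732370) R2 [Va,Vg,Vb,Vc,Vf,Vd,Ve])
  (In (-346056884270684859944578626698) R2 [Vc,Ve,Vb,Vd,Vf,Vg,Va]))))) (Br (Br (Br (In
  (-325017036235157556431124975848) Q12 [Vc,Vb,Va,Ve,Vg,Vd,Vf]) (In
  318101625349544480538018257450 Q12 [Vc,Va,Vb,Vg,Vd,Ve,Vf])) (Br (In
  315413186945439331704996824504 R2 [Va,Vc,Vd,Vg,Vb,Ve,Vf]) (Br (In
  304661697859978331521624220822 R2 [Vc,Vd,Va,Vf,Vb,Vg,Ve]) (In
  (-284134939052232185660070171796) R2 [Vc,Vd,Va,Ve,Vf,Vg,Vb])))) (Br (Br (In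
  (-271775901988721531478594111604) AB6 [Va,Vb,Vc,Vd,Vf,Vg,Ve]) (In
  265475781344658752863245662428 R2 [Vc,Ve,Va,Vf,Vg,Vd,Vb])) (Br (In
  (-265578141410704790393855141666) R2 [Vc,Va,Vf,Vg,Ve,Vd,Vb]) (Br (In
  264977394554121221887628915020 Q12 [Vc,Va,Vb,Vf,Ve,Vg,Vd]) (In
  262355387777586497979744502792 Q12 [Vc,Va,Vf,Vb,Ve,Vg,Vd])))))) (Br (Br (Br (Br (In
  (-237394933575186820432491858491) R1 [Vb,Vc,Va,Vd,Ve,Vg,Vf]) (In
  (-220703143402345618214916918568) Q12 [Vc,Va,Ve,Vd,Vb,Vg,Vf])) (Br (In
  209263381119377294372123965012 R1 [Va,Vb,Vc,Vd,Vg,Ve,Vf]) (Br (In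
  (-208507694674093561719338562856) Q12 [Va,Vb,Vc,Ve,Vd,Vf,Vg]) (In
  (-196057576644584288185189057470) R1 [Vb,Va,Vc,Ve,Vd,Vg,Vf])))) (Br (Br (In
  (-186875080130590603655787626964) R1 [Va,Vc,Vb,Vf,Vg,Vd,Ve]) (In
  185288611592052610945601219622 R2 [Va,Vc,Vd,Ve,Vb,Vf,Vg])) (Br (In
  180050650480257256628841283128 R2 [Vb,Vc,Vd,Va,Vg,Vf,Ve]) (Br (In
  179489315023554777541291858754 R2 [Va,Vc,Vf,Vb,Ve,Vg,Vd]) (In
  (-179567169904293513902412973456) R2 [Vb,Vc,Ve,Vf,Vd,Va,Vg]))))) (Br (Br (Br (In
  (-179542338930128201612626187808) R1 [Va,Vg,Vb,Vc,Ve,Vd,Vf]) (In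
  175873006169820723168750759732 Q12 [Va,Vb,Vc,Vd,Ve,Vf,Vg])) (Br (In
  (-175251901976365878865509957058) R1 [Va,Vb,Vc,Vf,Vd,Vg,Ve]) (Br (In
  168562560797609249458519152404 R2 [Vc,Ve,Vb,Vd,Vg,Va,Vf]) (In 167855201752005200133262927416
  R2 [Vc,Vd,Vb,Va,Vg,Vf,Ve])))) (Br (Br (In (-160012972127465496542624879638) R1
  [Va,Vb,Vc,Vd,Ve,Vg,Vf]) (In 159007143591996770349073442702 R2 [Vc,Ve,Va,Vd,Vb,Vf,Vg])) (Br
  (In (-158530909244956180301776613206) R2 [Va,Vg,Vc,Vb,Vd,Ve,Vf]) (Br (In
  (-158506749445120981641009458508) R2 [Vb,Va,Vc,Vd,Vg,Ve,Vf]) (In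
  (-157491571213329126835619509946) R2 [Vc,Va,Vd,Vb,Ve,Vf,Vg]))))))) (Br (Br (Br (Br (Br (In
  (-155685986807606225281180596282) R2 [Vc,Ve,Vb,Vf,Va,Vg,Vd]) (In
  (-155159856360464209835711353642) Q12 [Vc,Vb,Va,Ve,Vg,Vf,Vd])) (Br (In
  154598141129782142045148669872 Q12 [Va,Vc,Vd,Vg,Vb,Ve,Vf]) (Br (In
  (-154713958643885260310637915684) R2 [Vb,Va,Vc,Vf,Ve,Vd,Vg]) (In
  154029575911721940751798543090 Q12 [Va,Vb,Vc,Ve,Vf,Vg,Vd])))) (Br (Br (In
  154099729632990382753966745518 Q12 [Vc,Va,Vf,Ve,Vd,Vg,Vb]) (In
  152296307396200249985704542040 Q12 [Vc,Va,Vd,Vg,Vb,Vf,Ve])) (Br (In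
  146251553426272734251476553288 R1 [Va,Vb,Vc,Ve,Vf,Vg,Vd]) (Br (In
  (-142299959315549631612304321426) R2 [Va,Vc,Vf,Vb,Vd,Vg,Ve]) (In
  142037676493012738784853635438 AB6 [Va,Vb,Vg,Vc,Vd,Ve,Vf]))))) (Br (Br (Br (In
  137433130400334702258412201444 R2 [Va,Vc,Vb,Vg,Ve,Vf,Vd]) (In
  (-134837648912067371796379030898) Q12 [Vb,Va,Vc,Ve,Vd,Vg,Vf])) (Br (In
  131139207053402937042359258440 R2 [Vc,Va,Vf,Vd,Vb,Ve,Vg]) (Br (In
  (-129385139887099134554212449821) R1 [Vb,Vc,Va,Vd,Vf,Vg,Ve]) (In
  (-129229275456629943746652025180) AB6 [Vc,Va,Vb,Vd,Vf,Vg,Ve])))) (Br (Br (In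
  128981732712662783711009137510 R2 [Vc,Vb,Va,Ve,Vg,Vf,Vd]) (In 126602090351506590470395944974
  R2 [Va,Vc,Vf,Vb,Ve,Vd,Vg])) (Br (In (-126641630798821981277754012466) R1
  [Va,Vg,Vc,Vb,Vf,Ve,Vd]) (Br (In (-126413985382171491678824791826) R2 [Vc,Va,Vf,Vb,Vd,Vg,Ve])
  (In (-126145259421925602513773452754) R2 [Vc,Ve,Vb,Va,Vf,Vg,Vd])))))) (Br (Br (Br (Br (In
  (-125006115524866885409500615330) R2 [Vc,Vb,Va,Vg,Vd,Vf,Ve]) (In
  (-124887585727812890562252898988) R2 [Vc,Va,Vb,Vg,Vd,Ve,Vf])) (Br (In
  123200395676206300798501885586 Q12 [Va,Vb,Vc,Vf,Ve,Vg,Vd]) (Br (In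
  116330384078706954867432187802 R1 [Va,Vg,Vb,Vc,Vd,Vf,Ve]) (In 116383686910001896781170021990
  R1 [Va,Vc,Vd,Ve,Vb,Vf,Vg])))) (Br (Br (In (-115595705220606190042132862654) Q12
  [Vc,Va,Vd,Vb,Vf,Vg,Ve]) (In 114061542785280489810593416904 R2 [Vc,Vd,Ve,Vb,Vg,Vf,Va])) (Br
  (In 113846406969592471898420937310 R2 [Vc,Vd,Ve,Va,Vb,Vg,Vf]) (Br (In
  (-113591881789474263945358986276) R2 [Vc,Va,Vf,Ve,Vb,Vg,Vd]) (In
  111313130180432661627222862684 R2 [Vb,Va,Vc,Vg,Vf,Ve,Vd]))))) (Br (Br (Br (In
  (-111015594280957534758342718970) R1 [Vc,Va,Vb,Vf,Ve,Vd,Vg]) (In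
  109092358672482378193015759072 R1 [Va,Vc,Vd,Vb,Vf,Vg,Ve])) (Br (In
  109240105046864306310985489610 Q12 [Va,Vb,Vc,Vf,Vg,Vd,Ve]) (Br (In
  (-107865950722665160748482322792) R2 [Vc,Va,Vd,Vf,Vb,Ve,Vg]) (In
  106866676466034355542874247940 R2 [Vc,Va,Vb,Ve,Vg,Vf,Vd])))) (Br (Br (In
  (-105106342580876570388829394978) R1 [Va,Vg,Vb,Vc,Vf,Vd,Ve]) (Br (In
  (-104947249216340127317182157602) R2 [Vc,Va,Vf,Ve,Vg,Vb,Vd]) (In
  (-102925146011769337932015405542) R2 [Vc,Ve,Vg,Vd,Vf,Vb,Va]))) (Br (In
  (-101021787160100281932286375112) R2 [Va,Vc,Ve,Vg,Vb,Vd,Vf]) (Br (In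
  (-99147380665003402189648887032) R1 [Vb,Va,Vc,Ve,Vd,Vf,Vg]) (In
  (-98436483481491096155307398476) R2 [Va,Vc,Vd,Ve,Vg,Vb,Vf])))))))) (Br (Br (Br (Br (Br (Br
  (In (-97864781311599974996088153812) R2 [Va,Vc,Vf,Vd,Vg,Ve,Vb]) (In
  (-97581322137074363042894304282) R1 [Va,Vg,Vb,Vc,Vd,Ve,Vf])) (Br (In
  95841485055524299041474336514 R2 [Vc,Ve,Vd,Va,Vb,Vg,Vf]) (Br (In
  (-95264003741355851956036847052) R2 [Va,Vc,Vg,Vf,Vd,Ve,Vb]) (In
  95053155138986164682548128212 Q12 [Vc,Ve,Va,Vb,Vd,Vg,Vf])))) (Br (Br (In
  (-92907717136781471481883258470) R2 [Vc,Ve,Vd,Va,Vg,Vb,Vf]) (In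
  (-92735992783746989227241948407) Q12 [Va,Vc,Vb,Ve,Vf,Vg,Vd])) (Br (In
  (-92792542217523224069024635894) R2 [Vc,Va,Vf,Vg,Vb,Vd,Ve]) (Br (In
  91492404147846637907621769542 Q12 [Vc,Vb,Va,Vd,Vg,Vf,Ve]) (In 90621329978647542640305686496
  R1 [Va,Vg,Vc,Vb,Vf,Vd,Ve]))))) (Br (Br (Br (In (-90123328054390806691460746600) R2
  [Vc,Va,Vb,Vd,Ve,Vg,Vf]) (In 89551907291979279734451925558 AB6 [Vc,Va,Vg,Vd,Vb,Ve,Vf])) (Br
  (In 88415120257700696392008007202 AB6 [Va,Vc,Ve,Vb,Vd,Vg,Vf]) (Br (In
  (-87829494032317285715230489600) R2 [Va,Vc,Vf,Ve,Vd,Vg,Vb]) (In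
  87388506017349048702487328318 R2 [Vb,Va,Vc,Vd,Vg,Vf,Ve])))) (Br (Br (In
  86809332581587639819407312296 R2 [Vb,Va,Vc,Ve,Vf,Vg,Vd]) (In
  (-86598011645956755844780549542) R2 [Vc,Vd,Vb,Ve,Vf,Vg,Va])) (Br (In
  (-83491744323287393162930054657) AB6 [Vb,Va,Vg,Vc,Vd,Vf,Ve]) (Br (In
  83309468420169538192196899290 R2 [Vc,Vd,Vb,Va,Ve,Vg,Vf]) (In 83340831502039043938522482534
  R2 [Va,Vg,Vc,Vf,Vb,Vd,Ve])))))) (Br (Br (Br (Br (In 81749647698194350222906494542 R2
  [Vb,Vc,Ve,Va,Vd,Vf,Vg]) (In 81807587882578475659997856928 R1 [Va,Vc,Vd,Vb,Vg,Vf,Ve])) (Br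
  (In (-81635567947776303774536587060) R2 [Vc,Ve,Vf,Vd,Va,Vg,Vb]) (Br (In
  80656819842077514769573766264 R2 [Vc,Ve,Vb,Vg,Vf,Vd,Va]) (In
  (-79235908157767326526714838614) R2 [Va,Vg,Vc,Ve,Vd,Vb,Vf])))) (Br (Br (In
  78971782658427562109616792000 R2 [Va,Vg,Vc,Vd,Vf,Ve,Vb]) (In 77898876614522014922846941046
  R2 [Va,Vc,Vd,Vf,Vg,Ve,Vb])) (Br (In 75815617797867175334016111354 R2 [Vc,Ve,Vd,Vf,Vb,Vg,Va])
  (Br (In 75487807038897336455419280724 R1 [Va,Vc,Vd,Vb,Ve,Vf,Vg]) (In
  (-75317366291599513868935763350) R2 [Vc,Vb,Ve,Vd,Vg,Vf,Va]))))) (Br (Br (Br (In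
  (-75233042109020480819984305578) R2 [Va,Vc,Vb,Vf,Ve,Vg,Vd]) (In
  (-75151702397023998989982196494) R2 [Va,Vc,Ve,Vb,Vd,Vg,Vf])) (Br (In
  74833890053606193727549872870 R2 [Va,Vc,Vd,Vf,Vb,Vg,Ve]) (Br (In
  (-74211575904296079855396055302) Q12 [Vb,Vc,Va,Vd,Vg,Ve,Vf]) (In
  (-73997719578453233851521367092) R1 [Va,Vc,Vd,Ve,Vg,Vf,Vb])))) (Br (Br (In
  73661744272845855305177462232 R2 [Va,Vc,Vf,Vg,Vd,Vb,Ve]) (Br (In
  73606264758358009022633319156 R2 [Vc,Va,Vd,Vg,Vf,Ve,Vb]) (In 72783639488266799745249362622
  R2 [Vb,Vc,Ve,Vd,Va,Vg,Vf]))) (Br (In (-72222014434398276354557744574) R1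
  [Va,Vc,Vd,Vf,Vg,Ve,Vb]) (Br (In (-72047138301181045160247638450) R2 [Vc,Vd,Va,Vf,Vg,Vb,Ve])
  (In 70895296607453448537535609788 R2 [Va,Vc,Vg,Vd,Ve,Vf,Vb]))))))) (Br (Br (Br (Br (Br (In
  (-70800969148729538247949346382) Q12 [Vc,Vb,Vd,Va,Vg,Ve,Vf]) (In
  69779095109454834893360398320 R1 [Va,Vc,Ve,Vb,Vd,Vf,Vg])) (Br (In
  (-69331551304317330864194255168) R2 [Vc,Va,Vf,Vg,Ve,Vb,Vd]) (Br (In
  (-66853083252984070646975414722) AB6 [Vc,Va,Vg,Vd,Vb,Vf,Ve]) (In
  (-66399585236742672828060307210) R1 [Vb,Vc,Va,Ve,Vf,Vg,Vd])))) (Br (Br (In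
  65947126468139988476559961022 R2 [Vb,Vc,Va,Vd,Ve,Vg,Vf]) (In
  (-64356874333730942641422384836) R2 [Vc,Vb,Ve,Vd,Vf,Vg,Va])) (Br (In
  (-63695135988331854108088331242) R2 [Vc,Ve,Vd,Va,Vg,Vf,Vb]) (Br (In
  63671155515141484437560236810 R2 [Vb,Vc,Va,Ve,Vf,Vd,Vg]) (In 63221709661995607509973657226
  Q12 [Va,Vb,Vc,Vd,Vg,Vf,Ve]))))) (Br (Br (Br (In (-62294957053132241910646023276) R2
  [Va,Vc,Vf,Vb,Vd,Ve,Vg]) (In 61386309466931568610544206186 R1 [Va,Vc,Vb,Vd,Ve,Vf,Vg])) (Br
  (In (-60606923647811386863276684298) Q12 [Va,Vc,Vd,Vb,Vf,Ve,Vg]) (Br (In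
  59601080687893499166131488073 R1 [Va,Vc,Vb,Vf,Ve,Vd,Vg]) (In 59125714576475918506563240530
  R2 [Vb,Vc,Va,Vd,Vf,Vg,Ve])))) (Br (Br (In 58399232576947044961621964038 R2
  [Vb,Vc,Vd,Va,Vg,Ve,Vf]) (In 58425258709526225099564522478 Q12 [Vb,Vc,Va,Vf,Vg,Vd,Ve])) (Br
  (In (-57727397914216028934059781090) R2 [Vb,Vc,Va,Vg,Ve,Vf,Vd]) (Br (In
  57498506100662859500236888528 Q12 [Vc,Va,Vd,Vf,Ve,Vg,Vb]) (In
  (-57287039883794855005624731088) R2 [Vc,Ve,Vf,Va,Vb,Vd,Vg])))))) (Br (Br (Br (Br (In
  57122968839942852828125763902 R2 [Vc,Ve,Vd,Vb,Vg,Vf,Va]) (In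
  (-56635734273810949692110911728) Q12 [Va,Vc,Vd,Ve,Vb,Vf,Vg])) (Br (In
  55601740754300045269664192284 R2 [Vc,Ve,Vf,Vg,Va,Vd,Vb]) (Br (In
  55534686457633350498220872544 R2 [Vc,Ve,Vf,Vb,Va,Vg,Vd]) (In
  (-55379199886119953123496485446) R2 [Va,Vb,Vc,Ve,Vf,Vg,Vd])))) (Br (Br (In
  55403739624097869942174879266 R2 [Vc,Vb,Vd,Ve,Va,Vf,Vg]) (In 55257485099875786963379098484
  Q12 [Vc,Vb,Va,Vf,Ve,Vg,Vd])) (Br (In 55102707176072272654218921626 Q12
  [Vc,Va,Vb,Ve,Vf,Vg,Vd]) (Br (In 54664404013636769297289391218 AB6 [Va,Vb,Vc,Ve,Vg,Vd,Vf])
  (In (-54527967383014578759441820418) R2 [Va,Vg,Vc,Ve,Vb,Vd,Vf]))))) (Br (Br (Br (In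
  54514481492548743953694480418 R1 [Vb,Va,Vc,Vd,Ve,Vf,Vg]) (In
  (-54191139295084913731368847476) Q12 [Va,Vb,Vc,Vd,Vf,Vg,Ve])) (Br (In
  52560695881346937597258735210 R2 [Vb,Vc,Va,Vf,Vd,Ve,Vg]) (Br (In
  52374708644544010979337382998 Q12 [Va,Vc,Vb,Vd,Vg,Vf,Ve]) (In
  (-52114029883789672473272935024) AB6 [Va,Vb,Vc,Vd,Vf,Ve,Vg])))) (Br (Br (In
  51991634131537735842929644859 R1 [Va,Vb,Vc,Vf,Ve,Vg,Vd]) (Br (In
  51731449372015775335801821704 R2 [Vc,Ve,Vb,Vf,Vg,Va,Vd]) (In
  (-51125813181929124889048702986) R1 [Va,Vc,Vd,Vg,Ve,Vf,Vb]))) (Br (In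
  48885158746658891226827684162 Q12 [Vc,Vd,Vb,Va,Vg,Vf,Ve]) (Br (In
  (-47670138481291161589614451850) AB6 [Va,Vb,Vc,Vd,Vg,Ve,Vf]) (In
  (-46733251496671886726138953642) Q12 [Va,Vc,Vd,Ve,Vb,Vg,Vf]))))))))) (Br (Br (Br (Br (Br (Br
  (Br (In (-46477593987136655032166244844) R1 [Vc,Va,Ve,Vf,Vd,Vg,Vb]) (In
  46191036476840242033117314752 Q12 [Va,Vc,Vb,Ve,Vf,Vd,Vg])) (Br (In
  45984014223019060710041159259 R2 [Vc,Ve,Vg,Vd,Va,Vf,Vb]) (Br (In
  45618585153791755647710327260 Q12 [Va,Vc,Vd,Vb,Ve,Vf,Vg]) (In 45364522518290651319117019595
  R2 [Vc,Ve,Vg,Vf,Vb,Vd,Va])))) (Br (Br (In (-45132575843323135668827809210) R2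
  [Vc,Ve,Vg,Va,Vf,Vb,Vd]) (In (-45008437508860309373650120091) R1 [Va,Vc,Vb,Vf,Vd,Vg,Ve])) (Br
  (In 44999087557108708914351296548 Q12 [Va,Vb,Vc,Vf,Vd,Ve,Vg]) (Br (In
  (-44539845260032795210794642198) R2 [Vc,Ve,Vd,Vg,Vf,Va,Vb]) (In
  (-44539845260032795210794642198) Q12 [Vc,Vb,Va,Vg,Vf,Vd,Ve]))))) (Br (Br (Br (In
  (-44268995279060533734135216628) Q12 [Vb,Va,Vc,Ve,Vg,Vf,Vd]) (In
  43323650327477758902527746560 Q12 [Vc,Va,Ve,Vd,Vf,Vg,Vb])) (Br (In
  42913371393095812897987482942 Q12 [Vb,Vc,Va,Ve,Vg,Vf,Vd]) (Br (In
  42083084095694361414399630084 R2 [Vc,Ve,Vg,Vf,Va,Vb,Vd]) (In 41567974570989945890352367366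
  R1 [Va,Vc,Vb,Ve,Vd,Vg,Vf])))) (Br (Br (In (-39106471268855401120603838734) R2
  [Vb,Vc,Ve,Vf,Vg,Va,Vd]) (In 39158782115266235327083995794 R1 [Va,Vc,Ve,Vb,Vd,Vg,Vf])) (Br
  (In 38587381412707648672128142648 R2 [Vc,Ve,Vf,Va,Vd,Vg,Vb]) (Br (In
  (-38362995402364152740463577140) R2 [Vb,Vc,Ve,Vd,Vg,Va,Vf]) (In
  (-37481006227767480124355333712) R2 [Va,Vb,Vc,Vg,Ve,Vf,Vd])))))) (Br (Br (Br (Br (In
  (-37237327842724575445676640270) R2 [Vc,Ve,Vd,Vf,Vb,Va,Vg]) (In
  36917226936770552208467804950 R1 [Va,Vc,Vb,Vd,Ve,Vg,Vf])) (Br (In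
  36379271494386319001999446718 R2 [Vb,Vc,Vd,Ve,Vg,Va,Vf]) (Br (In
  36124685961713955042047590310 R1 [Vb,Vc,Va,Vd,Ve,Vf,Vg]) (In 35914440724196860401190163230
  R1 [Va,Vc,Vd,Vb,Vf,Ve,Vg])))) (Br (Br (In 34993276621763078553890765866 R2
  [Va,Vc,Vd,Vb,Ve,Vg,Vf]) (In 34615999058642774942461879962 R1 [Va,Vg,Vc,Vf,Vd,Ve,Vb])) (Br
  (In 34025646781377713516528968138 R2 [Va,Vc,Vb,Ve,Vd,Vf,Vg]) (Br (In
  33803639167263921885668735077 R2 [Vc,Va,Vf,Vg,Vb,Ve,Vd]) (In
  (-33803639167263921885668735077) R1 [Va,Vb,Vc,Vd,Vf,Ve,Vg]))))) (Br (Br (Br (In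
  (-32532301205089295797072032648) R2 [Vc,Ve,Vf,Vb,Va,Vd,Vg]) (In
  32282778092757783404181708172 R2 [Va,Vc,Vg,Vf,Vb,Vd,Ve])) (Br (In
  31889278446134199024022600740 Q12 [Vc,Va,Vf,Vd,Ve,Vg,Vb]) (Br (In
  31787873509646004475613154447 Q12 [Vc,Va,Vb,Vf,Vg,Ve,Vd]) (In 31809599458957371275837167604
  R1 [Va,Vb,Vc,Vf,Vd,Ve,Vg])))) (Br (Br (In 31218811759836802721284064096 R2
  [Va,Vb,Vc,Ve,Vd,Vf,Vg]) (Br (In 31218811759836802721284064096 R2 [Vc,Vb,Va,Vg,Vf,Ve,Vd]) (In
  (-31218811759836802721284064096) Q12 [Vc,Va,Vd,Vb,Vg,Ve,Vf]))) (Br (In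
  (-30621765553879456744657730256) R1 [Va,Vc,Vd,Vf,Vb,Ve,Vg]) (Br (In
  29525016732458197930000320998 R2 [Va,Vc,Ve,Vf,Vg,Vb,Vd]) (In 29173343299608481517350300686
  R2 [Va,Vb,Vg,Vc,Ve,Vd,Vf]))))))) (Br (Br (Br (Br (Br (In 28669356152730502387778887786 R2
  [Vc,Ve,Va,Vg,Vd,Vb,Vf]) (In (-28771930670548460380678182713) AB6 [Va,Vb,Vg,Vc,Ve,Vd,Vf]))
  (Br (In 27813207178247494690518333626 R2 [Vc,Va,Ve,Vd,Vb,Vf,Vg]) (Br (In
  (-27754762246221376719045895044) R2 [Vb,Vc,Va,Vd,Vf,Ve,Vg]) (In
  26899650101803658464363152412 R2 [Vb,Vc,Va,Vg,Vf,Ve,Vd])))) (Br (Br (In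
  26867115272057636491722761726 Q12 [Vc,Ve,Va,Vd,Vb,Vg,Vf]) (In 26597074013883551130279409002
  R2 [Va,Vc,Vg,Vb,Vf,Ve,Vd])) (Br (In 26450354582754590942149046680 Q12
  [Va,Vc,Vb,Vf,Ve,Vd,Vg]) (Br (In (-26282836240956550191340361822) R1 [Vc,Va,Vb,Vf,Vd,Vg,Ve])
  (In 26011089124640095473579488220 R2 [Vc,Ve,Vg,Vb,Va,Vf,Vd]))))) (Br (Br (Br (In
  (-25724251937712230754704126040) R1 [Vc,Va,Vb,Ve,Vd,Vf,Vg]) (In
  (-25963799021894829365988575083) R2 [Va,Vc,Vf,Ve,Vb,Vg,Vd])) (Br (In
  25650427511082714596518471366 R2 [Vb,Vc,Vd,Va,Vf,Vg,Ve]) (Br (In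
  (-25797441520629577280462752996) Q12 [Vc,Va,Ve,Vb,Vg,Vf,Vd]) (In
  (-25580303191406308538109569862) R1 [Va,Vb,Vc,Ve,Vd,Vg,Vf])))) (Br (Br (In
  (-25740071495512848078928528202) R2 [Vc,Vd,Va,Vb,Vg,Vf,Ve]) (In
  (-25562003507417066892096810290) R2 [Vc,Vd,Ve,Vb,Va,Vg,Vf])) (Br (In
  (-24798345383874405055123302920) Q12 [Vb,Vc,Vd,Va,Vg,Vf,Ve]) (Br (In
  (-24535758831765688317399357920) R1 [Vc,Va,Vb,Vd,Ve,Vg,Vf]) (In
  23312998471663663071958578852 R1 [Va,Vc,Vf,Vd,Ve,Vg,Vb])))))) (Br (Br (Br (Br (In
  (-23072480452900484335090231576) Q12 [Vb,Va,Vc,Vd,Vg,Vf,Ve]) (In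
  (-22872465079980563553760864668) R2 [Va,Vc,Vd,Vf,Ve,Vg,Vb])) (Br (In
  22747843104587046896550045638 R2 [Vc,Va,Vd,Vf,Vg,Vb,Ve]) (Br (In
  22319049479460787673615350706 Q12 [Vb,Vc,Va,Vd,Vg,Vf,Ve]) (In
  (-21853505438826574204950587966) Q12 [Vc,Vb,Va,Vd,Ve,Vg,Vf])))) (Br (Br (In
  (-21619105448083648983184147572) R2 [Va,Vb,Vc,Ve,Vg,Vf,Vd]) (In
  21510459075720579887050841080 R2 [Va,Vc,Vf,Vd,Ve,Vg,Vb])) (Br (In
  21194626552901690912405309842 R1 [Vb,Va,Vc,Vd,Ve,Vg,Vf]) (Br (In
  (-21054724604075347465574984616) R2 [Va,Vc,Vd,Vb,Vg,Ve,Vf]) (In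
  (-20912117229399318140792268140) AB6 [Va,Vb,Vc,Ve,Vd,Vf,Vg]))))) (Br (Br (Br (In
  20663034696226682886754271910 Q12 [Va,Vc,Vb,Vf,Vd,Ve,Vg]) (In
  (-20663034696226682886754271910) R2 [Va,Vg,Vc,Vb,Ve,Vd,Vf])) (Br (In
  20663034696226682886754271910 R2 [Vc,Ve,Vb,Va,Vg,Vf,Vd]) (Br (In
  (-20524269998988856230558533320) Q12 [Vc,Vb,Va,Vg,Ve,Vd,Vf]) (In
  20662562127705314657170708334 R1 [Va,Vc,Vd,Vf,Vb,Vg,Ve])))) (Br (Br (In
  20390393272352025230593414936 R2 [Vc,Vb,Ve,Vf,Va,Vg,Vd]) (Br (In
  (-19661318553051338757299009364) Q12 [Vc,Vb,Vd,Va,Vg,Vf,Ve]) (In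
  (-19563007877587179957994251900) R2 [Va,Vc,Vg,Ve,Vf,Vd,Vb]))) (Br (In
  19579391057633117663541997897 R2 [Vc,Ve,Vg,Vf,Va,Vd,Vb]) (Br (In
  19512899923211831897161610855 AB6 [Va,Vc,Vd,Vb,Ve,Vf,Vg]) (In
  (-19228031446937358153925136812) Q12 [Vc,Vd,Va,Vb,Vf,Vg,Ve])))))))) (Br (Br (Br (Br (Br (Br
  (In (-19174401764650183912085518378) R2 [Vc,Va,Vg,Ve,Vb,Vd,Vf]) (In
  18853695246414233378912389766 Q12 [Vc,Va,Ve,Vd,Vb,Vf,Vg])) (Br (In
  (-18748725322689070958586065348) R2 [Vc,Va,Vb,Ve,Vd,Vg,Vf]) (Br (In
  (-18663637343843719359817403518) R1 [Vb,Vc,Va,Vf,Ve,Vd,Vg]) (In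
  18081086228012173410134281721 R2 [Vc,Ve,Vb,Vf,Vg,Vd,Va])))) (Br (Br (In
  (-17619830468391789000317274186) Q12 [Vb,Vc,Va,Ve,Vf,Vg,Vd]) (In
  16107631543097504795071078084 R1 [Va,Vc,Vf,Ve,Vb,Vg,Vd])) (Br (In
  (-15975316117332470654507475446) R2 [Vc,Ve,Va,Vb,Vg,Vd,Vf]) (Br (In
  15983855201457143878836171742 R2 [Va,Vc,Ve,Vg,Vb,Vf,Vd]) (In
  (-15095651979452052216784915942) Q12 [Vc,Va,Ve,Vb,Vd,Vg,Vf]))))) (Br (Br (Br (In
  14899046743267171083280851004 Q12 [Vb,Va,Vc,Vd,Vf,Vg,Ve]) (In 15075582249469286059094217478
  R2 [Vc,Vd,Vb,Va,Vg,Ve,Vf])) (Br (In (-14510810289443678924170078954) Q12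
  [Vb,Va,Vc,Vf,Vg,Vd,Ve]) (Br (In 14510810289443678924170078954 R2 [Va,Vc,Vf,Ve,Vd,Vb,Vg]) (In
  (-14626118461209093956707621280) R2 [Vb,Vc,Va,Vf,Ve,Vd,Vg])))) (Br (Br (In
  14225605786290749711868465026 R2 [Vc,Vb,Ve,Va,Vg,Vd,Vf]) (In 13727274305522239508243306746
  Q12 [Va,Vc,Vb,Ve,Vg,Vd,Vf])) (Br (In 13773002135001668297531873682 R2
  [Vc,Ve,Vd,Vg,Vb,Vf,Va]) (Br (In (-13532685600160535988646557978) R1 [Va,Vg,Vb,Vc,Vf,Ve,Vd])
  (In (-13352589324015209176522664582) R2 [Vc,Vb,Va,Vd,Ve,Vg,Vf])))))) (Br (Br (Br (Br (In
  (-12825213755541357298259235683) Q12 [Va,Vc,Vd,Vg,Vb,Vf,Ve]) (In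
  12561014076828971225365205090 R1 [Va,Vb,Vc,Vf,Vg,Vd,Ve])) (Br (In
  11817330926732398593231445368 R2 [Va,Vb,Vg,Vc,Vd,Ve,Vf]) (Br (In
  (-10995742464455939078341628938) R2 [Vc,Va,Vd,Vg,Vf,Vb,Ve]) (In
  10889882907612397783133875236 Q12 [Vc,Va,Vb,Vf,Vd,Vg,Ve])))) (Br (Br (In
  10645808014549527830823349922 R1 [Va,Vc,Vd,Vb,Ve,Vg,Vf]) (In 10270172998050550040838453168
  R1 [Vc,Va,Vd,Ve,Vf,Vg,Vb])) (Br (In (-9929858446273443145019275630) Q12
  [Va,Vb,Vc,Ve,Vg,Vd,Vf]) (Br (In 9616308353787502794647648832 Q12 [Vc,Vb,Va,Vd,Vg,Ve,Vf]) (In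
  (-9290186661010673676895345530) R2 [Vc,Vb,Ve,Vg,Vf,Va,Vd]))))) (Br (Br (Br (In
  8951573064905945604098142550 Q12 [Vc,Va,Vb,Vd,Vg,Ve,Vf]) (In (-8884428937058000085309555908)
  R2 [Vc,Ve,Vg,Vd,Vb,Vf,Va])) (Br (In (-8430192984543259387566849464) R2
  [Vc,Ve,Vf,Va,Vb,Vg,Vd]) (Br (In (-8354554554863673332945053398) Q12 [Va,Vb,Vc,Ve,Vg,Vf,Vd])
  (In 8442803328064459504821537702 R1 [Va,Vb,Vc,Ve,Vg,Vf,Vd])))) (Br (Br (In
  8145376576975537494193713120 R1 [Va,Vc,Vb,Vd,Vg,Ve,Vf]) (Br (In 7924834324574297942002247606
  R1 [Va,Vc,Vb,Vd,Vf,Ve,Vg]) (In 7322218244052464726224101014 R1 [Va,Vc,Vf,Vb,Vd,Vg,Ve]))) (Br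
  (In 7401525213099326229813597630 R2 [Vb,Vc,Va,Vf,Vg,Vd,Ve]) (Br (In
  (-7401525213099326229813597630) R1 [Vc,Va,Vb,Vd,Vf,Ve,Vg]) (In
  (-7345449505303661148563137806) R2 [Vb,Vc,Ve,Va,Vd,Vg,Vf]))))))) (Br (Br (Br (Br (Br (In
  (-6407902893699561072246974392) R2 [Vc,Ve,Vb,Vd,Vg,Vf,Va]) (In 6473520601627371780935131576
  R1 [Vc,Va,Vb,Ve,Vf,Vd,Vg])) (Br (In (-6156255734580005591225025556) R2
  [Vc,Vd,Va,Vb,Ve,Vg,Vf]) (Br (In (-5943757600925455503500455720) R2 [Vc,Va,Vd,Vf,Ve,Vg,Vb])
  (In 5952463847325146538666499550 R1 [Va,Vb,Vc,Ve,Vg,Vd,Vf])))) (Br (Br (In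
  5664371098779388999179703022 R2 [Vc,Va,Vb,Vf,Vd,Vg,Ve]) (In 4671273782886864684267735058 Q12
  [Vc,Va,Ve,Vf,Vb,Vg,Vd])) (Br (In 4852303481769231999178667452 R2 [Va,Vb,Vc,Vg,Vd,Vf,Ve]) (Br
  (In (-4820919133046093063930084624) R2 [Va,Vg,Vc,Vd,Ve,Vf,Vb]) (In
  (-4926152809411274577886171702) R2 [Va,Vc,Vb,Vd,Ve,Vf,Vg]))))) (Br (Br (Br (In
  4792484830228491082518829980 R1 [Va,Vb,Vc,Ve,Vd,Vf,Vg]) (In 4381262556347919698721722880 R1
  [Va,Vc,Vd,Ve,Vf,Vg,Vb])) (Br (In (-4233042468077269438398448282) R1 [Va,Vc,Vd,Vf,Ve,Vg,Vb])
  (Br (In (-3779726492873204326637049172) R2 [Vc,Ve,Va,Vg,Vd,Vf,Vb]) (In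
  3763126898160780637258477016 Q12 [Vb,Va,Vc,Vd,Vg,Ve,Vf])))) (Br (Br (In
  (-3577889502774027388388182012) R1 [Va,Vb,Vc,Vd,Vg,Vf,Ve]) (In
  (-3410606755566541607446708920) R1 [Vb,Vc,Va,Ve,Vd,Vf,Vg])) (Br (In
  2993176489186958702958755480 R2 [Vc,Ve,Vb,Vd,Vf,Va,Vg]) (Br (In
  (-2992228390925801182378482564) R1 [Vb,Va,Vc,Vd,Vf,Ve,Vg]) (In 2485706925437004426278823092
  Q12 [Vc,Va,Vb,Vd,Ve,Vg,Vf])))))) (Br (Br (Br (Br (In (-2657338161929002693213563664) Q12
  [Va,Vc,Vd,Vb,Vf,Vg,Ve]) (In (-2045468460228321203933763410) R2 [Vc,Ve,Va,Vd,Vf,Vb,Vg])) (Br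
  (In 2045468460228321203933763410 R2 [Va,Vc,Ve,Vb,Vf,Vg,Vd]) (Br (In
  1927064624973543031874878094 Q12 [Vb,Va,Vc,Vf,Vd,Vg,Ve]) (In (-1884644605906184672542653850)
  R2 [Vc,Va,Vb,Vg,Vf,Ve,Vd])))) (Br (Br (In 1675437229630950011823549988 R2
  [Vc,Vb,Ve,Va,Vg,Vf,Vd]) (In 1628976376877288417895863330 R2 [Vb,Vc,Vd,Va,Ve,Vf,Vg])) (Br (In
  1629897179815124319587386028 R2 [Va,Vc,Vd,Ve,Vb,Vg,Vf]) (Br (In 1313489445252493075787968552
  R2 [Vc,Ve,Vg,Va,Vf,Vd,Vb]) (In 922740546145488198140465128 R2 [Vc,Ve,Vf,Vd,Vb,Va,Vg])))))
  (Br (Br (Br (In 1001716143175344129455262546 R2 [Vc,Va,Vf,Vd,Vg,Vb,Ve]) (In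
  949279203945342114618499724 R1 [Va,Vc,Vb,Vd,Vg,Vf,Ve])) (Br (In 928400009605644542076749006
  AB6 [Va,Vb,Vc,Ve,Vf,Vd,Vg]) (Br (In 926752608863365599327633950 R2 [Va,Vg,Vc,Vf,Ve,Vb,Vd])
  (In 837718614815475005911774994 R2 [Va,Vb,Vc,Ve,Vf,Vd,Vg])))) (Br (Br (In
  (-792153916242062904374958944) R2 [Vb,Vc,Ve,Vf,Vd,Vg,Va]) (Br (In
  (-507462514293283104998851368) Q12 [Vb,Vc,Vd,Va,Vg,Ve,Vf]) (In 313049425685485884512315670
  R2 [Vc,Ve,Vd,Va,Vf,Vg,Vb]))) (Br (In 167034523161330651122727912 R2 [Vc,Va,Vd,Vf,Vg,Ve,Vb])
  (Br (In 158906171708902631216161812 Q12 [Va,Vc,Vb,Vf,Ve,Vg,Vd]) (In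
  89033994047890593415858956 R2 [Va,Vc,Ve,Vd,Vg,Vb,Vf]))))))))))
  846461735748232983955544029653 (relator_word ABAD4)"
  by code_simp

lemma (in tetrad_algebra) vanishes_ABAD4: "vanishes (relator_word ABAD4)"
  by (rule certifies_vanishes[OF certifies_ABAD4]) (auto simp del: relator_word.simps intro: vanishes_R1 vanishes_R2 vanishes_Q12 vanishes_AB6)

text \<open>\<open>GC\<close> and \<open>GD\<close> act on positions 2 to 6 as two reflections of a
  pentagon, so their product has order 5. The symmetries are the dihedral permutations of the five
  inner letters, with or without an exchange of the outer two.\<close>

lemma certifies_CD5: "certifies [R1, R2, Q12, AB6, ABAD4]
  [([Va,Vb,Vc,Vd,Ve,Vf,Vg],1), ([Va,Vb,Vf,Ve,Vd,Vc,Vg],-1), ([Va,Vc,Vb,Vf,Ve,Vd,Vg],-1),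
  ([Va,Vc,Vd,Ve,Vf,Vb,Vg],1), ([Va,Vd,Vc,Vb,Vf,Ve,Vg],-1), ([Va,Vd,Ve,Vf,Vb,Vc,Vg],1),
  ([Va,Ve,Vd,Vc,Vb,Vf,Vg],-1), ([Va,Ve,Vf,Vb,Vc,Vd,Vg],1), ([Va,Vf,Vb,Vc,Vd,Ve,Vg],1),
  ([Va,Vf,Ve,Vd,Vc,Vb,Vg],-1), ([Vg,Vb,Vc,Vd,Ve,Vf,Va],1), ([Vg,Vb,Vf,Ve,Vd,Vc,Va],-1),
  ([Vg,Vc,Vb,Vf,Ve,Vd,Va],-1), ([Vg,Vc,Vd,Ve,Vf,Vb,Va],1), ([Vg,Vd,Vc,Vb,Vf,Ve,Va],-1),
  ([Vg,Vd,Ve,Vf,Vb,Vc,Va],1), ([Vg,Ve,Vd,Vc,Vb,Vf,Va],-1), ([Vg,Ve,Vf,Vb,Vc,Vd,Va],1),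
  ([Vg,Vf,Vb,Vc,Vd,Ve,Va],1), ([Vg,Vf,Ve,Vd,Vc,Vb,Va],-1)]
  (Br (Br (Br (Br (In 16 R1 [Va,Vb,Vc,Vd,Ve,Vf,Vg]) (In 16 ABAD4 [Va,Vb,Vc,Vg,Vd,Ve,Vf])) (Br
  (In (-16) Q12 [Vb,Va,Vd,Vf,Vg,Ve,Vc]) (Br (In 16 R1 [Vb,Va,Vc,Ve,Vd,Vg,Vf]) (In 16 R1
  [Vb,Va,Vc,Vd,Vf,Ve,Vg])))) (Br (Br (In (-16) Q12 [Vb,Vd,Va,Vf,Vg,Vc,Ve]) (Br (In 12 AB6
  [Va,Vb,Vd,Ve,Vc,Vg,Vf]) (In (-8) ABAD4 [Vb,Va,Vc,Ve,Vd,Vg,Vf]))) (Br (In (-8) Q12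
  [Va,Vb,Vc,Vg,Vd,Ve,Vf]) (Br (In 8 R2 [Vb,Va,Vd,Vg,Vc,Ve,Vf]) (In 6 AB6
  [Va,Vb,Vc,Vd,Vg,Ve,Vf]))))) (Br (Br (Br (In (-4) R1 [Va,Vb,Vc,Vf,Ve,Vg,Vd]) (Br (In 4 R2
  [Vb,Vd,Va,Vf,Vc,Ve,Vg]) (In (-2) R2 [Vb,Va,Vc,Vg,Ve,Vf,Vd]))) (Br (In (-2) R2
  [Vb,Vc,Va,Vd,Ve,Vf,Vg]) (Br (In 2 R2 [Va,Vb,Vc,Vf,Ve,Vg,Vd]) (In (-2) ABAD4
  [Va,Vb,Vc,Vf,Ve,Vg,Vd])))) (Br (Br (In (-2) Q12 [Vb,Va,Vd,Vc,Vf,Vg,Ve]) (Br (In (-2) R1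
  [Va,Vb,Vc,Ve,Vg,Vd,Vf]) (In (-1) R1 [Va,Vb,Vd,Vf,Vc,Ve,Vg]))) (Br (In 1 ABAD4
  [Vb,Va,Vc,Vd,Vg,Vf,Ve]) (Br (In 1 R1 [Va,Vg,Vb,Vc,Ve,Vf,Vd]) (In (-1) Q12
  [Va,Vb,Vd,Vf,Vc,Ve,Vg]))))))
  4 (relator_word CD5)"
  by code_simp

lemma (in tetrad_algebra) vanishes_CD5: "vanishes (relator_word CD5)"
  by (rule certifies_vanishes[OF certifies_CD5]) (auto simp del: relator_word.simps intro: vanishes_R1 vanishes_R2 vanishes_Q12 vanishes_AB6 vanishes_ABAD4)

lemma certifies_Y12: "certifies [R1, R2, Q12, AB6, ABAD4]
  [([Va,Vb,Vc,Vd,Ve,Vf,Vg],1), ([Va,Vd,Vc,Vb,Ve,Vg,Vf],-1)]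
  (Br (Br (Br (In 4 R2 [Vb,Vc,Vd,Va,Ve,Vg,Vf]) (Br (In 4 AB6 [Va,Vb,Vc,Vd,Ve,Vf,Vg]) (In (-2)
  R1 [Vb,Ve,Vd,Vc,Vf,Vg,Va]))) (Br (In 2 R2 [Vb,Vd,Vc,Vf,Ve,Vg,Va]) (Br (In (-2) AB6
  [Vc,Va,Ve,Vf,Vd,Vb,Vg]) (In 2 Q12 [Vf,Vb,Vd,Vg,Va,Ve,Vc])))) (Br (Br (In 2 ABAD4
  [Va,Vf,Vb,Vc,Ve,Vd,Vg]) (Br (In (-2) R1 [Vb,Vd,Va,Vf,Vc,Ve,Vg]) (In 2 R1
  [Va,Vb,Vc,Vg,Vf,Ve,Vd]))) (Br (Br (In (-2) R1 [Va,Vc,Vb,Vg,Vf,Vd,Ve]) (In 2 Q12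
  [Vf,Va,Vb,Vd,Ve,Vc,Vg])) (Br (In (-1) Q12 [Va,Vf,Vb,Vc,Ve,Vd,Vg]) (In (-1) ABAD4
  [Vf,Va,Vb,Vd,Ve,Vc,Vg])))))
  4 (relator_word Y12)"
  by code_simp

lemma (in tetrad_algebra) vanishes_Y12: "vanishes (relator_word Y12)"
  by (rule certifies_vanishes[OF certifies_Y12]) (auto simp del: relator_word.simps intro: vanishes_R1 vanishes_R2 vanishes_Q12 vanishes_AB6 vanishes_ABAD4)

lemma certifies_X12: "certifies [R1, R2, Q12, AB6, ABAD4, Y12]
  [([Va,Vb,Vc,Vd,Ve,Vf,Vg],1), ([Va,Vb,Vd,Vc,Ve,Vg,Vf],1), ([Va,Vb,Vf,Vg,Ve,Vd,Vc],1),
  ([Va,Vb,Vg,Vf,Ve,Vc,Vd],1), ([Va,Ve,Vc,Vd,Vb,Vg,Vf],-1), ([Va,Ve,Vd,Vc,Vb,Vf,Vg],-1),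
  ([Va,Ve,Vf,Vg,Vb,Vc,Vd],-1), ([Va,Ve,Vg,Vf,Vb,Vd,Vc],-1)]
  (Br (Br (Br (In 4 ABAD4 [Vb,Ve,Va,Vc,Vf,Vd,Vg]) (Br (In 4 Y12 [Vc,Vb,Va,Ve,Vd,Vf,Vg]) (In
  (-4) R1 [Vb,Ve,Va,Vc,Vf,Vd,Vg]))) (Br (Br (In 4 R2 [Vb,Vc,Va,Vd,Vf,Vg,Ve]) (In (-4) Y12
  [Vc,Va,Vb,Ve,Vg,Vd,Vf])) (Br (In 4 Q12 [Vb,Vc,Vd,Va,Vg,Vf,Ve]) (In 4 R2
  [Va,Vb,Ve,Vc,Vg,Vf,Vd])))) (Br (Br (Br (In 4 Y12 [Vc,Va,Vb,Vf,Vd,Vg,Ve]) (In 4 AB6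
  [Vb,Va,Ve,Vc,Vd,Vf,Vg])) (Br (In (-4) R1 [Vb,Vc,Vd,Ve,Vf,Vg,Va]) (In (-2) ABAD4
  [Vb,Vc,Va,Vd,Vf,Vg,Ve]))) (Br (Br (In 2 R2 [Va,Vb,Vc,Ve,Vg,Vd,Vf]) (In 2 Y12
  [Vc,Vb,Va,Vd,Vf,Vg,Ve])) (Br (In 2 Q12 [Vc,Vb,Vd,Ve,Va,Vf,Vg]) (In 2 Q12
  [Vc,Vb,Vf,Vd,Va,Vg,Ve])))))
  3 (relator_word X12)"
  by code_simp

lemma (in tetrad_algebra) vanishes_X12: "vanishes (relator_word X12)"
  by (rule certifies_vanishes[OF certifies_X12]) (auto simp del: relator_word.simps intro: vanishes_R1 vanishes_R2 vanishes_Q12 vanishes_AB6 vanishes_ABAD4 vanishes_Y12)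

lemma certifies_ACDC3: "certifies [R1, AB6, ABAD4, Y12]
  [([Va,Vb,Vc,Vd,Ve,Vf,Vg],1), ([Va,Vc,Vb,Vf,Ve,Vd,Vg],-1), ([Vd,Vb,Vc,Vf,Ve,Va,Vg],1),
  ([Vd,Vc,Vb,Va,Ve,Vf,Vg],-1), ([Vf,Vb,Vc,Va,Ve,Vd,Vg],1), ([Vf,Vc,Vb,Vd,Ve,Va,Vg],-1)]
  (Br (Br (In 6 R1 [Va,Ve,Vb,Vc,Vg,Vd,Vf]) (In (-3) Y12 [Va,Vd,Vg,Vf,Ve,Vc,Vb])) (Br (In 3
  ABAD4 [Va,Ve,Vb,Vc,Vf,Vg,Vd]) (In (-1) AB6 [Va,Vb,Vc,Vd,Vg,Ve,Vf])))
  1 (relator_word ACDC3)"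
  by code_simp

lemma (in tetrad_algebra) vanishes_ACDC3: "vanishes (relator_word ACDC3)"
  by (rule certifies_vanishes[OF certifies_ACDC3]) (auto simp del: relator_word.simps intro: vanishes_R1 vanishes_AB6 vanishes_ABAD4 vanishes_Y12)

lemma certifies_AC5: "certifies [R1, R2, CD5, Y12]
  [([Va,Vb,Vc,Vd,Ve,Vf,Vg],1), ([Va,Ve,Vd,Vc,Vb,Vf,Vg],-1), ([Vb,Va,Ve,Vd,Vc,Vf,Vg],-1),
  ([Vb,Vc,Vd,Ve,Va,Vf,Vg],1), ([Vc,Vb,Va,Ve,Vd,Vf,Vg],-1), ([Vc,Vd,Ve,Va,Vb,Vf,Vg],1),
  ([Vd,Vc,Vb,Va,Ve,Vf,Vg],-1), ([Vd,Ve,Va,Vb,Vc,Vf,Vg],1), ([Ve,Va,Vb,Vc,Vd,Vf,Vg],1),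
  ([Ve,Vd,Vc,Vb,Va,Vf,Vg],-1)]
  (Br (Br (Br (In 10 R2 [Va,Vb,Ve,Vc,Vf,Vg,Vd]) (In 10 Y12 [Va,Vc,Vb,Vd,Vf,Ve,Vg])) (Br (In
  (-5) Y12 [Vg,Va,Vf,Vb,Vd,Vc,Ve]) (In (-5) R1 [Va,Vc,Vb,Vd,Vf,Ve,Vg]))) (Br (Br (In (-5) Y12
  [Vg,Va,Vf,Vc,Vb,Ve,Vd]) (In (-5) R1 [Va,Vb,Vc,Vf,Ve,Vd,Vg])) (Br (In (-1) CD5
  [Vf,Va,Vc,Ve,Vb,Vd,Vg]) (In 1 CD5 [Vf,Va,Vb,Vc,Vd,Ve,Vg]))))
  4 (relator_word AC5)"
  by code_simp

lemma (in tetrad_algebra) vanishes_AC5: "vanishes (relator_word AC5)"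
  by (rule certifies_vanishes[OF certifies_AC5]) (auto simp del: relator_word.simps intro: vanishes_R1 vanishes_R2 vanishes_CD5 vanishes_Y12)

lemma certifies_ACBD3: "certifies [R1, Y12]
  [([Va,Vb,Vc,Vd,Ve,Vf,Vg],1), ([Vb,Va,Vc,Ve,Vd,Vg,Vf],1), ([Vd,Ve,Vc,Vf,Vg,Va,Vb],1),
  ([Ve,Vd,Vc,Vg,Vf,Vb,Va],1), ([Vf,Vg,Vc,Va,Vb,Vd,Ve],1), ([Vg,Vf,Vc,Vb,Va,Ve,Vd],1)]
  (Br (In (-3) Y12 [Va,Vc,Vg,Vf,Vb,Vd,Ve]) (In 1 R1 [Va,Vb,Ve,Vd,Vf,Vg,Vc]))
  1 (relator_word ACBD3)"
  by code_simp

lemma (in tetrad_algebra) vanishes_ACBD3: "vanishes (relator_word ACBD3)"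
  by (rule certifies_vanishes[OF certifies_ACBD3]) (auto simp del: relator_word.simps intro: vanishes_R1 vanishes_Y12)

lemma certifies_Z12: "certifies [R1, Q12, ABAD4, Y12, ACBD3]
  [([Va,Vb,Vc,Vd,Ve,Vf,Vg],1), ([Va,Vd,Vc,Vb,Vf,Ve,Vg],-1), ([Vg,Vb,Vc,Vd,Vf,Ve,Va],-1),
  ([Vg,Vd,Vc,Vb,Ve,Vf,Va],1)]
  (Br (Br (In 2 R1 [Va,Vb,Vc,Vd,Ve,Vf,Vg]) (Br (In (-2) Y12 [Va,Ve,Vf,Vg,Vb,Vc,Vd]) (In 2
  ACBD3 [Va,Vb,Vd,Vc,Vg,Vf,Ve]))) (Br (In (-2) Q12 [Vc,Va,Vb,Vf,Ve,Vg,Vd]) (Br (In 2 R1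
  [Va,Vg,Vb,Vd,Vc,Vf,Ve]) (In 1 ABAD4 [Vc,Ve,Va,Vg,Vd,Vb,Vf]))))
  1 (relator_word Z12)"
  by code_simp

lemma (in tetrad_algebra) vanishes_Z12: "vanishes (relator_word Z12)"
  by (rule certifies_vanishes[OF certifies_Z12]) (auto simp del: relator_word.simps intro: vanishes_R1 vanishes_Q12 vanishes_ABAD4 vanishes_Y12 vanishes_ACBD3)

lemma certifies_ABCD7: "certifies [R1, Q12, ABAD4, Y12, ACBD3, Z12]
  [([Va,Vb,Vc,Vd,Ve,Vf,Vg],1), ([Va,Ve,Vf,Vg,Vb,Vc,Vd],-1), ([Vb,Va,Vc,Ve,Vd,Vg,Vf],-1),
  ([Vb,Vd,Vg,Vf,Va,Vc,Ve],1), ([Vc,Vf,Va,Vd,Vg,Vb,Ve],-1), ([Vc,Vg,Vb,Ve,Vf,Va,Vd],1),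
  ([Vd,Vb,Vg,Va,Vf,Ve,Vc],-1), ([Vd,Vf,Ve,Vc,Vb,Vg,Va],1), ([Ve,Va,Vf,Vb,Vg,Vd,Vc],1),
  ([Ve,Vg,Vd,Vc,Va,Vf,Vb],-1), ([Vf,Vc,Va,Vg,Vd,Ve,Vb],1), ([Vf,Vd,Ve,Vb,Vc,Va,Vg],-1),
  ([Vg,Vc,Vb,Vf,Ve,Vd,Va],-1), ([Vg,Ve,Vd,Va,Vc,Vb,Vf],1)]
  (Br (Br (Br (Br (In 10 R1 [Va,Vb,Vc,Vd,Ve,Vf,Vg]) (In 8 Z12 [Va,Vb,Vc,Vd,Ve,Vf,Vg])) (Br (In
  7 Y12 [Va,Vb,Vc,Vd,Ve,Vf,Vg]) (Br (In (-5) R1 [Va,Vb,Vd,Vc,Vf,Ve,Vg]) (In 5 ACBD3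
  [Va,Vb,Vd,Vc,Vg,Vf,Ve])))) (Br (Br (In (-4) Y12 [Va,Vc,Vd,Vf,Ve,Vb,Vg]) (Br (In (-4) Z12
  [Va,Vb,Vd,Ve,Vc,Vg,Vf]) (In (-3) R1 [Va,Vc,Ve,Vf,Vb,Vg,Vd]))) (Br (In (-3) R1
  [Va,Vb,Vc,Ve,Vg,Vd,Vf]) (Br (In 3 Z12 [Va,Vb,Ve,Vd,Vf,Vg,Vc]) (In 2 Y12
  [Va,Vb,Vg,Vd,Vc,Ve,Vf]))))) (Br (Br (Br (In 2 Y12 [Va,Vc,Vb,Vd,Vg,Vf,Ve]) (In (-2) R1
  [Va,Vd,Ve,Vb,Vf,Vg,Vc])) (Br (In 2 Z12 [Va,Vb,Vd,Vc,Vg,Vf,Ve]) (Br (In (-2) R1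
  [Va,Vb,Ve,Vc,Vd,Vg,Vf]) (In (-2) ACBD3 [Va,Vc,Vb,Vd,Ve,Vg,Vf])))) (Br (Br (In (-1) ACBD3
  [Va,Vb,Vf,Vc,Ve,Vg,Vd]) (Br (In (-1) Q12 [Va,Vc,Vb,Ve,Vf,Vd,Vg]) (In 1 R1
  [Va,Vb,Ve,Vd,Vf,Vg,Vc]))) (Br (In (-1) ABAD4 [Va,Vb,Vc,Ve,Vg,Vd,Vf]) (Br (In 1 Q12
  [Va,Vc,Ve,Vb,Vd,Vf,Vg]) (In 1 R1 [Va,Vc,Vb,Vf,Vd,Ve,Vg]))))))
  3 (relator_word ABCD7)"
  by code_simp

lemma (in tetrad_algebra) vanishes_ABCD7: "vanishes (relator_word ABCD7)"
  by (rule certifies_vanishes[OF certifies_ABCD7]) (auto simp del: relator_word.simps intro: vanishes_R1 vanishes_Q12 vanishes_ABAD4 vanishes_Y12 vanishes_ACBD3 vanishes_Z12)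

lemma certifies_ACD4: "certifies [R1, Y12, ACBD3, Z12, ABCD7]
  [([Va,Vb,Vc,Vd,Ve,Vf,Vg],1), ([Vc,Vb,Va,Vf,Ve,Vd,Vg],1), ([Vd,Ve,Vf,Vc,Vb,Va,Vg],1),
  ([Vf,Ve,Vd,Va,Vb,Vc,Vg],1)]
  (Br (Br (Br (Br (In 9 R1 [Va,Vb,Vc,Vd,Ve,Vf,Vg]) (In 7 Z12 [Va,Vb,Vc,Vd,Ve,Vf,Vg])) (Br (In
  (-7) Y12 [Vg,Va,Vf,Ve,Vd,Vb,Vc]) (Br (In (-6) R1 [Va,Ve,Vc,Vb,Vg,Vf,Vd]) (In 3 ACBD3
  [Va,Vb,Vc,Vd,Ve,Vf,Vg])))) (Br (Br (In (-3) R1 [Va,Vb,Vd,Vc,Vg,Vf,Ve]) (In (-3) ACBD3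
  [Va,Vb,Ve,Vg,Vc,Vf,Vd])) (Br (In 3 R1 [Va,Vb,Ve,Vg,Vc,Vf,Vd]) (Br (In 2 ABCD7
  [Va,Vb,Vc,Vd,Ve,Vf,Vg]) (In (-2) R1 [Va,Vc,Vd,Vb,Vf,Vg,Ve]))))) (Br (Br (Br (In (-2) ACBD3
  [Va,Vb,Ve,Vc,Vd,Vg,Vf]) (In 2 R1 [Va,Vb,Ve,Vc,Vd,Vg,Vf])) (Br (In (-2) R1
  [Va,Vc,Vb,Ve,Vf,Vd,Vg]) (Br (In 2 ACBD3 [Va,Vc,Vd,Vb,Vf,Vg,Ve]) (In (-1) R1
  [Va,Vd,Vb,Vg,Vf,Vc,Ve])))) (Br (Br (In (-1) ACBD3 [Va,Vd,Vc,Vb,Vf,Ve,Vg]) (Br (In (-1) ABCD7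
  [Va,Vd,Vb,Vc,Vg,Ve,Vf]) (In 1 R1 [Va,Vg,Vd,Vb,Ve,Vf,Vc]))) (Br (In (-1) R1
  [Vb,Vd,Va,Ve,Vg,Vc,Vf]) (Br (In 1 ACBD3 [Va,Vd,Vc,Vf,Vg,Vb,Ve]) (In 1 R1
  [Va,Vc,Vb,Vd,Ve,Vg,Vf]))))))
  7 (relator_word ACD4)"
  by code_simp

lemma (in tetrad_algebra) vanishes_ACD4: "vanishes (relator_word ACD4)"
  by (rule certifies_vanishes[OF certifies_ACD4]) (auto simp del: relator_word.simps intro: vanishes_R1 vanishes_Y12 vanishes_ACBD3 vanishes_Z12 vanishes_ABCD7)

lemma certifies_P10: "certifies [AB6, ABAD4, CD5, Z12]
  [([Va,Vb,Vc,Vd,Ve,Vf,Vg],1), ([Va,Vd,Vc,Vb,Ve,Vf,Vg],1), ([Vg,Vb,Vc,Vd,Vf,Ve,Va],-1),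
  ([Vg,Vd,Vc,Vb,Vf,Ve,Va],-1)]
  (Br (Br (Br (In 2 Z12 [Va,Vb,Ve,Vf,Vc,Vd,Vg]) (In (-2) Z12 [Va,Vc,Ve,Vf,Vb,Vd,Vg])) (Br (In
  1 ABAD4 [Va,Vb,Vc,Vd,Ve,Vf,Vg]) (Br (In 1 AB6 [Va,Vb,Vc,Vd,Ve,Vf,Vg]) (In (-2) CD5
  [Va,Vb,Vc,Vd,Ve,Vf,Vg])))) (Br (Br (In 2 Z12 [Va,Vb,Vc,Vd,Ve,Vf,Vg]) (Br (In 2 Z12
  [Va,Vb,Ve,Vf,Vd,Vc,Vg]) (In (-1) ABAD4 [Va,Vc,Vb,Vd,Ve,Vf,Vg]))) (Br (In (-1) AB6
  [Va,Vb,Vd,Vc,Ve,Vf,Vg]) (Br (In 1 AB6 [Va,Vb,Vc,Vd,Vf,Ve,Vg]) (In 1 ABAD4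
  [Va,Vb,Vc,Vd,Vf,Ve,Vg])))))
  2 (relator_word P10)"
  by code_simp

lemma (in tetrad_algebra) vanishes_P10: "vanishes (relator_word P10)"
  by (rule certifies_vanishes[OF certifies_P10]) (auto simp del: relator_word.simps intro: vanishes_AB6 vanishes_ABAD4 vanishes_CD5 vanishes_Z12)

section \<open>Walks for adjacent transpositions\<close>

text \<open>Along the path 7, 5, 2, 4, 6, 3, 1 of positions, transposing adjacent positions and then
  reversing takes at most seven steps.\<close>

definition sw0 :: "gen list" where "sw0 = [GA, GB, GD, GC, GA, GR]"
definition sw1 :: "gen list" where "sw1 = [GA, GC, GA, GB, GA, GC, GB, GR]"
definition sw2 :: "gen list" where "sw2 = [GA, GB, GA, GC, GD, GR]"
definition sw3 :: "gen list" where "sw3 = [GB, GA, GB, GD, GC, GR]"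
definition sw4 :: "gen list" where "sw4 = [GB, GD, GB, GA, GB, GD, GA, GR]"
definition sw5 :: "gen list" where "sw5 = [GB, GA, GC, GD, GB, GR]"

text \<open>Moving both copies of \<open>GR\<close> to the end mirrors the second half of the
  squared walk and leaves block reversals only. For \<open>sw2\<close> the result is
  \<open>P10\<close> itself, for \<open>sw0\<close> a rotation of it, and for \<open>sw1\<close> a
  rotation after removal of steps that cancel cyclically. This is the origin of
  \<open>P10\<close>.\<close>

lemma certifies_invol_0: "certifies [P10]
  [([Va,Vb,Vc,Vd,Ve,Vf,Vg],1), ([Va,Vb,Vc,Vd,Vg,Vf,Ve],1), ([Vd,Vc,Vb,Va,Ve,Vf,Vg],-1),
  ([Vd,Vc,Vb,Va,Vg,Vf,Ve],-1)]
  (In (-1) P10 [Va,Ve,Vf,Vg,Vb,Vc,Vd])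
  1 (concat [sw0, sw0])"
  by code_simp

lemma (in tetrad_algebra) vanishes_invol_0: "vanishes (concat [sw0, sw0])"
  by (rule certifies_vanishes[OF certifies_invol_0]) (auto simp del: relator_word.simps intro: vanishes_P10)

lemma certifies_invol_1: "certifies [P10]
  [([Va,Vb,Vc,Vd,Ve,Vf,Vg],1), ([Va,Vb,Vf,Vg,Ve,Vc,Vd],-1), ([Va,Ve,Vc,Vd,Vb,Vf,Vg],1),
  ([Va,Ve,Vf,Vg,Vb,Vc,Vd],-1)]
  (In 1 P10 [Vd,Vb,Va,Ve,Vc,Vf,Vg])
  1 (concat [sw1, sw1])"
  by code_simp

lemma (in tetrad_algebra) vanishes_invol_1: "vanishes (concat [sw1, sw1])"
  by (rule certifies_vanishes[OF certifies_invol_1]) (auto simp del: relator_word.simps intro: vanishes_P10)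

lemma certifies_invol_2: "certifies [P10]
  [([Va,Vb,Vc,Vd,Ve,Vf,Vg],1), ([Va,Vd,Vc,Vb,Ve,Vf,Vg],1), ([Vg,Vb,Vc,Vd,Vf,Ve,Va],-1),
  ([Vg,Vd,Vc,Vb,Vf,Ve,Va],-1)]
  (In 1 P10 [Va,Vb,Vc,Vd,Ve,Vf,Vg])
  1 (concat [sw2, sw2])"
  by code_simp

lemma (in tetrad_algebra) vanishes_invol_2: "vanishes (concat [sw2, sw2])"
  by (rule certifies_vanishes[OF certifies_invol_2]) (auto simp del: relator_word.simps intro: vanishes_P10)

lemma certifies_braid_0: "certifies [R1, R2, Q12, ABAD4, Y12, X12, AC5, ACBD3, P10]
  [([Va,Vb,Vc,Vd,Ve,Vf,Vg],1), ([Va,Ve,Vc,Vd,Vg,Vf,Vb],1), ([Va,Vg,Vc,Vd,Vb,Vf,Ve],1)]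
  (Br (Br (Br (Br (Br (In (-6) P10 [Va,Vb,Vf,Ve,Vg,Vc,Vd]) (In 6 X12 [Vd,Vb,Va,Ve,Vc,Vf,Vg]))
  (Br (In (-5) AC5 [Va,Vb,Vf,Ve,Vg,Vc,Vd]) (Br (In 5 Y12 [Vd,Vb,Va,Ve,Vc,Vf,Vg]) (In (-3) P10
  [Vb,Ve,Va,Vg,Vf,Vc,Vd])))) (Br (Br (In (-3) P10 [Vd,Va,Vb,Vg,Vc,Ve,Vf]) (In 2 Y12
  [Vd,Vb,Va,Ve,Vc,Vg,Vf])) (Br (In 2 ACBD3 [Va,Vb,Vg,Vf,Ve,Vd,Vc]) (Br (In (-2) Q12
  [Vb,Va,Ve,Vc,Vd,Vg,Vf]) (In (-2) Y12 [Vd,Vb,Vg,Vf,Vc,Va,Ve]))))) (Br (Br (Br (In (-1) Y12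
  [Vd,Vb,Vf,Ve,Vc,Va,Vg]) (In 2 Y12 [Vd,Va,Vb,Vg,Vc,Vf,Ve])) (Br (In (-2) R1
  [Va,Vb,Vc,Vd,Vf,Ve,Vg]) (Br (In (-2) R2 [Vc,Vd,Vb,Vf,Ve,Va,Vg]) (In 2 Y12
  [Vf,Vb,Vc,Vd,Vg,Va,Ve])))) (Br (Br (In (-1) Q12 [Vb,Va,Ve,Vd,Vc,Vg,Vf]) (In 1 P10
  [Vb,Vf,Ve,Vg,Va,Vc,Vd])) (Br (In (-1) X12 [Vd,Vb,Va,Vg,Vc,Vf,Ve]) (Br (In (-1) ACBD3
  [Va,Vb,Ve,Vf,Vg,Vd,Vc]) (In 1 X12 [Vd,Vb,Va,Vg,Vc,Ve,Vf])))))) (Br (Br (Br (Br (In (-1) AC5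
  [Va,Vb,Ve,Vf,Vg,Vc,Vd]) (In (-1) R1 [Va,Vb,Vd,Vc,Vg,Ve,Vf])) (Br (In (-1) Y12
  [Vb,Ve,Va,Vg,Vf,Vc,Vd]) (Br (In 1 X12 [Vf,Vb,Va,Ve,Vg,Vd,Vc]) (In (-1) AC5
  [Va,Vb,Ve,Vd,Vc,Vg,Vf])))) (Br (Br (In 1 ACBD3 [Va,Vb,Ve,Vd,Vc,Vf,Vg]) (In 1 ACBD3
  [Va,Vb,Ve,Vf,Vg,Vc,Vd])) (Br (In (-1) Y12 [Vf,Vb,Vd,Vc,Vg,Ve,Va]) (Br (In 1 AC5
  [Va,Vb,Vc,Vd,Vg,Vf,Ve]) (In 1 R2 [Vc,Vd,Vb,Va,Vg,Vf,Ve]))))) (Br (Br (Br (In 1 AC5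
  [Vb,Vd,Vc,Vf,Ve,Vg,Va]) (In 1 P10 [Vb,Vd,Vc,Ve,Va,Vg,Vf])) (Br (In (-1) R2
  [Vc,Vd,Vf,Vb,Va,Ve,Vg]) (Br (In (-1) P10 [Vb,Va,Vc,Vd,Vg,Ve,Vf]) (In (-1) Y12
  [Vf,Va,Vb,Vg,Ve,Vc,Vd])))) (Br (Br (In (-1) ABAD4 [Va,Vb,Vc,Vd,Ve,Vg,Vf]) (In 1 X12
  [Vb,Va,Vc,Vd,Vf,Ve,Vg])) (Br (In (-1) P10 [Va,Vb,Vf,Ve,Vg,Vd,Vc]) (Br (In 1 ACBD3
  [Vb,Ve,Va,Vd,Vc,Vf,Vg]) (In (-1) Y12 [Vc,Vb,Va,Ve,Vd,Vg,Vf])))))))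
  5 (concat [sw0, sw1, sw0, sw1, sw0, sw1])"
  by code_simp

lemma (in tetrad_algebra) vanishes_braid_0: "vanishes (concat [sw0, sw1, sw0, sw1, sw0, sw1])"
  by (rule certifies_vanishes[OF certifies_braid_0]) (auto simp del: relator_word.simps intro: vanishes_R1 vanishes_R2 vanishes_Q12 vanishes_ABAD4 vanishes_Y12 vanishes_X12 vanishes_AC5 vanishes_ACBD3 vanishes_P10)

lemma certifies_braid_1: "certifies [R1, R2, Q12, ABAD4, Y12, X12, AC5, ACBD3, P10]
  [([Va,Vb,Vc,Vd,Ve,Vf,Vg],1), ([Va,Vd,Vc,Ve,Vb,Vf,Vg],1), ([Va,Ve,Vc,Vb,Vd,Vf,Vg],1)]
  (Br (Br (Br (Br (Br (In 6 P10 [Va,Vb,Vc,Vd,Ve,Vf,Vg]) (In (-6) X12 [Vg,Vb,Va,Vd,Vf,Vc,Ve]))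
  (Br (In 5 AC5 [Va,Vb,Vc,Vd,Ve,Vf,Vg]) (Br (In (-5) Y12 [Vg,Vb,Va,Vd,Vf,Vc,Ve]) (In 3 P10
  [Vb,Vd,Va,Ve,Vc,Vf,Vg])))) (Br (Br (In (-3) P10 [Vc,Va,Vb,Ve,Vd,Vf,Vg]) (In (-2) Y12
  [Vg,Vb,Va,Vd,Vf,Ve,Vc])) (Br (In (-2) ACBD3 [Va,Vb,Ve,Vc,Vd,Vg,Vf]) (Br (In 2 Q12
  [Vb,Va,Vd,Vf,Vg,Ve,Vc]) (In 2 Y12 [Vg,Vb,Ve,Vc,Vf,Va,Vd]))))) (Br (Br (Br (In 1 Y12
  [Vg,Vb,Vc,Vd,Vf,Va,Ve]) (In (-2) R1 [Va,Vb,Vd,Vc,Vg,Vf,Ve])) (Br (In (-2) Y12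
  [Vg,Va,Vb,Ve,Vf,Vc,Vd]) (Br (In 2 R2 [Vf,Vg,Vb,Vc,Vd,Va,Ve]) (In (-2) Y12
  [Vc,Vb,Vf,Vg,Ve,Va,Vd])))) (Br (Br (In 1 Q12 [Vb,Va,Vd,Vg,Vf,Ve,Vc]) (In 1 X12
  [Vg,Vb,Va,Ve,Vf,Vc,Vd])) (Br (In (-1) P10 [Vb,Vc,Vd,Ve,Va,Vf,Vg]) (Br (In 1 ACBD3
  [Va,Vb,Vd,Vc,Ve,Vg,Vf]) (In (-1) X12 [Vg,Vb,Va,Ve,Vf,Vd,Vc])))))) (Br (Br (Br (Br (In (-1)
  R1 [Va,Vb,Vd,Ve,Vf,Vg,Vc]) (In (-1) X12 [Vc,Vb,Va,Vd,Ve,Vg,Vf])) (Br (In 1 AC5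
  [Va,Vb,Vd,Vg,Vf,Ve,Vc]) (Br (In 1 Y12 [Vb,Vd,Va,Ve,Vc,Vf,Vg]) (In (-1) ACBD3
  [Va,Vb,Vd,Vg,Vf,Vc,Ve])))) (Br (Br (In (-1) ACBD3 [Va,Vb,Vd,Vc,Ve,Vf,Vg]) (In 1 Y12
  [Vc,Vb,Vg,Vf,Ve,Vd,Va])) (Br (In (-1) R2 [Vf,Vg,Vb,Va,Ve,Vc,Vd]) (Br (In 1 AC5
  [Vb,Vc,Vf,Vg,Ve,Vd,Va]) (In (-1) AC5 [Va,Vb,Vf,Vg,Ve,Vc,Vd]))))) (Br (Br (Br (In (-1) AC5
  [Va,Vb,Vc,Ve,Vd,Vf,Vg]) (In (-1) P10 [Vb,Vd,Vf,Vg,Va,Ve,Vc])) (Br (In 1 R2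
  [Vf,Vg,Vc,Vb,Va,Vd,Ve]) (Br (In 1 P10 [Vb,Va,Vf,Vg,Ve,Vd,Vc]) (In 1 Y12
  [Vc,Va,Vb,Ve,Vd,Vf,Vg])))) (Br (Br (In (-1) ABAD4 [Va,Vb,Vd,Ve,Vf,Vg,Vc]) (In (-1) X12
  [Vb,Va,Vd,Ve,Vc,Vg,Vf])) (Br (In 1 P10 [Va,Vb,Vc,Vd,Ve,Vg,Vf]) (Br (In (-1) ACBD3
  [Vb,Vc,Va,Ve,Vd,Vf,Vg]) (In 1 Y12 [Vf,Vb,Va,Vd,Vg,Ve,Vc])))))))
  5 (concat [sw1, sw2, sw1, sw2, sw1, sw2])"
  by code_simp

lemma (in tetrad_algebra) vanishes_braid_1: "vanishes (concat [sw1, sw2, sw1, sw2, sw1, sw2])"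
  by (rule certifies_vanishes[OF certifies_braid_1]) (auto simp del: relator_word.simps intro: vanishes_R1 vanishes_R2 vanishes_Q12 vanishes_ABAD4 vanishes_Y12 vanishes_X12 vanishes_AC5 vanishes_ACBD3 vanishes_P10)

lemma certifies_braid_2: "certifies [R1, Q12, AB6, ABAD4, CD5, Y12, ACDC3, AC5, Z12, P10]
  [([Va,Vb,Vc,Vd,Ve,Vf,Vg],1), ([Va,Vd,Vc,Vf,Ve,Vb,Vg],1), ([Va,Vf,Vc,Vb,Ve,Vd,Vg],1),
  ([Vg,Vb,Ve,Vd,Vc,Vf,Va],1), ([Vg,Vd,Ve,Vf,Vc,Vb,Va],1), ([Vg,Vf,Ve,Vb,Vc,Vd,Va],1)]
  (Br (Br (Br (Br (In 54 Z12 [Va,Vb,Vc,Vd,Ve,Vf,Vg]) (Br (In 48 P10 [Va,Vb,Vc,Vd,Ve,Vf,Vg])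
  (In 18 ABAD4 [Va,Vb,Vc,Vd,Ve,Vf,Vg]))) (Br (Br (In 24 CD5 [Va,Vb,Vc,Vd,Ve,Vf,Vg]) (In 30 R1
  [Va,Vb,Vc,Vf,Vd,Ve,Vg])) (Br (In 6 AB6 [Va,Vb,Vc,Ve,Vd,Vf,Vg]) (In 24 Z12
  [Va,Vb,Vc,Vd,Vf,Ve,Vg])))) (Br (Br (Br (In (-24) R1 [Va,Vb,Vc,Vd,Vf,Ve,Vg]) (In (-18) P10
  [Va,Ve,Vb,Vg,Vd,Vc,Vf])) (Br (In (-9) Z12 [Va,Vc,Vb,Ve,Vf,Vd,Vg]) (In 18 P10
  [Va,Vc,Vb,Vg,Vf,Ve,Vd]))) (Br (Br (In (-18) Q12 [Va,Vb,Vc,Vd,Vg,Ve,Vf]) (In 18 AC5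
  [Va,Vb,Vc,Vd,Vg,Ve,Vf])) (Br (In 6 P10 [Va,Ve,Vb,Vg,Vf,Vc,Vd]) (In 6 Y12
  [Va,Ve,Vb,Vg,Vf,Vd,Vc]))))) (Br (Br (Br (Br (In (-12) Y12 [Va,Ve,Vb,Vg,Vd,Vc,Vf]) (In (-6)
  Y12 [Va,Vb,Vg,Vd,Vf,Ve,Vc])) (Br (In 12 Y12 [Va,Vc,Vb,Vg,Vf,Ve,Vd]) (In (-9) Q12
  [Vb,Vc,Vd,Vg,Va,Vf,Ve]))) (Br (Br (In (-6) Y12 [Va,Vc,Vb,Vg,Vd,Vf,Ve]) (In 6 ABAD4
  [Va,Vb,Vd,Vg,Ve,Vf,Vc])) (Br (In (-6) P10 [Va,Vc,Vb,Vg,Vd,Ve,Vf]) (In (-6) Y12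
  [Va,Vb,Ve,Vd,Vf,Vc,Vg])))) (Br (Br (Br (In 6 ABAD4 [Va,Vb,Vc,Vd,Vf,Vg,Ve]) (In (-6) ACDC3
  [Va,Vb,Vd,Vc,Vf,Ve,Vg])) (Br (In 6 Z12 [Va,Ve,Vb,Vg,Vf,Vd,Vc]) (In 3 AB6
  [Vb,Va,Vg,Vd,Vc,Ve,Vf]))) (Br (Br (In (-3) Q12 [Vb,Va,Vd,Ve,Vc,Vf,Vg]) (In 2 ACDC3
  [Vb,Vc,Ve,Vd,Va,Vf,Vg])) (Br (In (-6) Y12 [Va,Vb,Vc,Vd,Vf,Vg,Ve]) (In (-6) Z12
  [Va,Vc,Vb,Vg,Vd,Vf,Ve]))))))
  26 (concat [sw2, sw3, sw2, sw3, sw2, sw3])"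
  by code_simp

lemma (in tetrad_algebra) vanishes_braid_2: "vanishes (concat [sw2, sw3, sw2, sw3, sw2, sw3])"
  by (rule certifies_vanishes[OF certifies_braid_2]) (auto simp del: relator_word.simps intro: vanishes_R1 vanishes_Q12 vanishes_AB6 vanishes_ABAD4 vanishes_CD5 vanishes_Y12 vanishes_ACDC3 vanishes_AC5 vanishes_Z12 vanishes_P10)

lemma certifies_commute_0_2: "certifies [ACD4, P10]
  [([Va,Vb,Vc,Vd,Ve,Vf,Vg],1), ([Va,Vd,Vc,Vb,Vg,Vf,Ve],1), ([Va,Ve,Vf,Vg,Vb,Vc,Vd],-1),
  ([Va,Vg,Vf,Ve,Vd,Vc,Vb],-1)]
  (Br (In 2 P10 [Va,Vb,Vc,Vd,Ve,Vf,Vg]) (In (-1) ACD4 [Vb,Vc,Vd,Ve,Vf,Vg,Va]))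
  1 (concat [sw0, sw2, sw0, sw2])"
  by code_simp

lemma (in tetrad_algebra) vanishes_commute_0_2: "vanishes (concat [sw0, sw2, sw0, sw2])"
  by (rule certifies_vanishes[OF certifies_commute_0_2]) (auto simp del: relator_word.simps intro: vanishes_ACD4 vanishes_P10)

lemma certifies_commute_0_3: "certifies [R2, Y12]
  [([Va,Vb,Vc,Vd,Ve,Vf,Vg],1), ([Va,Vb,Vc,Ve,Vf,Vg,Vd],1), ([Va,Vb,Vc,Vf,Vg,Vd,Ve],1),
  ([Va,Vb,Vc,Vg,Vd,Ve,Vf],1)]
  (Br (In (-4) Y12 [Va,Vd,Ve,Vf,Vb,Vc,Vg]) (Br (In (-2) R2 [Vb,Va,Vd,Vf,Vg,Vc,Ve]) (In 2 Y12
  [Vd,Vb,Va,Vf,Ve,Vg,Vc])))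
  1 (concat [sw0, sw3, sw0, sw3])"
  by code_simp

lemma (in tetrad_algebra) vanishes_commute_0_3: "vanishes (concat [sw0, sw3, sw0, sw3])"
  by (rule certifies_vanishes[OF certifies_commute_0_3]) (auto simp del: relator_word.simps intro: vanishes_R2 vanishes_Y12)

lemma certifies_commute_0_4: "certifies [R2, Y12]
  [([Va,Vb,Vc,Vd,Ve,Vf,Vg],1), ([Va,Vb,Ve,Vd,Vf,Vg,Vc],1), ([Va,Vb,Vf,Vd,Vg,Vc,Ve],1),
  ([Va,Vb,Vg,Vd,Vc,Ve,Vf],1)]
  (Br (In (-2) R2 [Vb,Va,Vc,Vf,Ve,Vd,Vg]) (In 2 Y12 [Vc,Vb,Va,Vf,Vg,Ve,Vd]))
  1 (concat [sw0, sw4, sw0, sw4])"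
  by code_simp

lemma (in tetrad_algebra) vanishes_commute_0_4: "vanishes (concat [sw0, sw4, sw0, sw4])"
  by (rule certifies_vanishes[OF certifies_commute_0_4]) (auto simp del: relator_word.simps intro: vanishes_R2 vanishes_Y12)

lemma certifies_commute_0_5: "certifies [ACD4]
  [([Va,Vb,Vc,Vd,Ve,Vf,Vg],1), ([Vc,Vb,Va,Vd,Vg,Vf,Ve],1), ([Ve,Vf,Vg,Vd,Vc,Vb,Va],1),
  ([Vg,Vf,Ve,Vd,Va,Vb,Vc],1)]
  (In 1 ACD4 [Va,Vb,Vc,Ve,Vf,Vg,Vd])
  1 (concat [sw0, sw5, sw0, sw5])"
  by code_simp

lemma (in tetrad_algebra) vanishes_commute_0_5: "vanishes (concat [sw0, sw5, sw0, sw5])"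
  by (rule certifies_vanishes[OF certifies_commute_0_5]) (auto simp del: relator_word.simps intro: vanishes_ACD4)

lemma certifies_commute_1_3: "certifies [R1, R2, Q12, ABAD4, Y12, X12, ACDC3, AC5, ACBD3, ACD4, P10]
  [([Va,Vb,Vc,Vd,Ve,Vf,Vg],1), ([Va,Ve,Vc,Vf,Vb,Vd,Vg],1)]
  (Br (Br (Br (Br (In 2 P10 [Vd,Vb,Va,Ve,Vc,Vf,Vg]) (In 2 ACD4 [Va,Vb,Vc,Vd,Ve,Vf,Vg])) (Br
  (In 2 ACDC3 [Va,Vb,Vf,Vc,Ve,Vd,Vg]) (Br (In 2 P10 [Vd,Va,Ve,Vc,Vb,Vf,Vg]) (In 2 AC5
  [Va,Vb,Vc,Vd,Ve,Vf,Vg])))) (Br (Br (In (-2) Y12 [Vg,Vb,Va,Ve,Vd,Vc,Vf]) (In (-2) R1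
  [Vb,Va,Vc,Vf,Vg,Vd,Ve])) (Br (In 2 Q12 [Vd,Ve,Va,Vb,Vc,Vf,Vg]) (Br (In (-2) Y12
  [Vd,Vb,Vf,Vg,Vc,Ve,Va]) (In (-2) R1 [Vb,Vf,Vc,Vg,Vd,Ve,Va]))))) (Br (Br (Br (In 2 R2
  [Vd,Vg,Vc,Va,Ve,Vf,Vb]) (In 2 Y12 [Vc,Va,Vg,Vd,Vb,Vf,Ve])) (Br (In 2 ACD4
  [Vb,Va,Vg,Vd,Ve,Vc,Vf]) (Br (In 2 R1 [Va,Vb,Vc,Vg,Vd,Ve,Vf]) (In 2 ABAD4
  [Va,Vb,Vc,Vg,Vd,Ve,Vf])))) (Br (Br (In 2 Y12 [Vc,Vb,Va,Vg,Ve,Vd,Vf]) (In (-2) X12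
  [Vc,Vb,Va,Ve,Vg,Vf,Vd])) (Br (In 2 ACBD3 [Va,Vb,Ve,Vd,Vg,Vc,Vf]) (Br (In 2 P10
  [Vb,Vf,Vd,Vg,Va,Ve,Vc]) (In (-2) Q12 [Vd,Vc,Vb,Ve,Va,Vg,Vf]))))))
  3 (concat [sw1, sw3, sw1, sw3])"
  by code_simp

lemma (in tetrad_algebra) vanishes_commute_1_3: "vanishes (concat [sw1, sw3, sw1, sw3])"
  by (rule certifies_vanishes[OF certifies_commute_1_3]) (auto simp del: relator_word.simps intro: vanishes_R1 vanishes_R2 vanishes_Q12 vanishes_ABAD4 vanishes_Y12 vanishes_X12 vanishes_ACDC3 vanishes_AC5 vanishes_ACBD3 vanishes_ACD4 vanishes_P10)

lemma certifies_commute_1_4: "certifies [R1, Q12, Y12, X12, Z12, ACD4, P10]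
  [([Va,Vb,Vc,Vd,Ve,Vf,Vg],1), ([Va,Ve,Vf,Vd,Vb,Vc,Vg],1), ([Vg,Vc,Ve,Vd,Vf,Vb,Va],1),
  ([Vg,Vf,Vb,Vd,Vc,Ve,Va],1)]
  (Br (Br (Br (In (-2) P10 [Va,Vc,Vg,Vf,Vb,Ve,Vd]) (In (-2) X12 [Vd,Vb,Va,Ve,Vc,Vf,Vg])) (Br
  (In 2 Y12 [Vd,Va,Vb,Vc,Ve,Vg,Vf]) (In 2 R1 [Vb,Va,Ve,Vc,Vf,Vg,Vd]))) (Br (Br (In (-2) Z12
  [Vb,Vc,Va,Ve,Vf,Vg,Vd]) (In (-2) ACD4 [Va,Vb,Ve,Vc,Vg,Vf,Vd])) (Br (In 2 R1
  [Vb,Va,Vf,Vd,Ve,Vg,Vc]) (In (-1) Q12 [Vd,Vb,Va,Vc,Vf,Vg,Ve]))))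
  1 (concat [sw1, sw4, sw1, sw4])"
  by code_simp

lemma (in tetrad_algebra) vanishes_commute_1_4: "vanishes (concat [sw1, sw4, sw1, sw4])"
  by (rule certifies_vanishes[OF certifies_commute_1_4]) (auto simp del: relator_word.simps intro: vanishes_R1 vanishes_Q12 vanishes_Y12 vanishes_X12 vanishes_Z12 vanishes_ACD4 vanishes_P10)

text \<open>The conjugate \<open>sw3\<close>, \<open>sw4\<close>, \<open>sw3\<close> exchanges
  positions 4 and 3, and \<open>sw1\<close> exchanges 5 and 2. Together they reverse the block from
  2 to 5, so appending \<open>GC\<close> closes the walk.\<close>

lemma certifies_GC: "certifies [R1, R2, Y12, X12, AC5, ACBD3, P10]
  [([Va,Vb,Vc,Vd,Ve,Vf,Vg],1)]
  (Br (Br (Br (Br (In 2 P10 [Vc,Vb,Va,Ve,Vd,Vf,Vg]) (In (-2) R2 [Vb,Va,Vc,Ve,Vf,Vg,Vd])) (Br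
  (In 2 R1 [Va,Vb,Vd,Vc,Ve,Vf,Vg]) (In (-1) P10 [Ve,Vb,Va,Vc,Vf,Vd,Vg]))) (Br (Br (In (-1) P10
  [Va,Vc,Vg,Vd,Vb,Vf,Ve]) (In (-1) P10 [Va,Vc,Ve,Vf,Vb,Vd,Vg])) (Br (In 1 Y12
  [Vg,Vc,Ve,Vf,Vd,Va,Vb]) (In 1 Y12 [Ve,Vb,Va,Vc,Vf,Vd,Vg])))) (Br (Br (Br (In (-1) Y12
  [Va,Vc,Vg,Vd,Vb,Ve,Vf]) (In (-1) ACBD3 [Va,Vb,Vc,Vg,Vd,Ve,Vf])) (Br (In (-1) AC5
  [Vc,Vf,Ve,Vd,Vg,Vb,Va]) (In (-1) AC5 [Va,Vb,Vg,Vd,Vc,Vf,Ve]))) (Br (Br (In (-1) AC5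
  [Va,Vb,Vc,Ve,Vf,Vd,Vg]) (In (-1) X12 [Vg,Vc,Va,Vb,Vd,Vf,Ve])) (Br (In (-1) X12
  [Ve,Vc,Va,Vb,Vf,Vg,Vd]) (In 1 X12 [Va,Vb,Vd,Vg,Vc,Ve,Vf])))))
  2 (concat [sw3, sw4, sw3, sw1, [GC]])"
  by code_simp

lemma (in tetrad_algebra) vanishes_GC: "vanishes (concat [sw3, sw4, sw3, sw1, [GC]])"
  by (rule certifies_vanishes[OF certifies_GC]) (auto simp del: relator_word.simps intro: vanishes_R1 vanishes_R2 vanishes_Y12 vanishes_X12 vanishes_AC5 vanishes_ACBD3 vanishes_P10)

text \<open>Here \<open>GC\<close> and \<open>GD\<close> may occur as intermediate steps because
  their exactness is obtained before that of \<open>GA\<close>; this keeps the expression of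
  \<open>GA\<close> short.\<close>

lemma certifies_GA: "certifies [R1, CD5, Y12, X12, ACDC3, AC5, Z12, ACD4, P10]
  [([Va,Vb,Vc,Vd,Ve,Vf,Vg],1)]
  (Br (Br (Br (Br (In (-1) P10 [Vd,Vc,Vb,Vf,Ve,Va,Vg]) (In 1 P10 [Vd,Va,Vb,Vc,Ve,Vf,Vg])) (Br
  (In (-1) P10 [Vb,Ve,Vd,Vf,Vc,Va,Vg]) (In 1 P10 [Vb,Va,Ve,Vd,Vc,Vf,Vg]))) (Br (Br (In (-1)
  ACD4 [Va,Ve,Vd,Vc,Vb,Vf,Vg]) (In 1 ACD4 [Va,Vb,Vc,Vf,Ve,Vd,Vg])) (Br (In (-1) Z12
  [Vf,Va,Vc,Vb,Vd,Ve,Vg]) (In 1 Z12 [Va,Vd,Ve,Vf,Vc,Vb,Vg])))) (Br (Br (Br (In (-1) Y12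
  [Vg,Vc,Vb,Vf,Va,Ve,Vd]) (In 1 Y12 [Vg,Va,Ve,Vd,Vf,Vb,Vc])) (Br (In (-1) ACDC3
  [Va,Vd,Ve,Vf,Vc,Vb,Vg]) (In (-1) ACDC3 [Va,Vb,Vc,Vf,Ve,Vd,Vg]))) (Br (Br (In (-1) AC5
  [Va,Vb,Vc,Vd,Ve,Vf,Vg]) (In 1 CD5 [Va,Vb,Vc,Vf,Ve,Vd,Vg])) (Br (In 1 X12
  [Vg,Va,Vb,Vc,Vf,Ve,Vd]) (In (-1) R1 [Vb,Vc,Va,Vf,Vd,Ve,Vg])))))
  2 (concat [sw3, [GC], [GD], sw5, [GC], [GA]])"
  by code_simp

lemma (in tetrad_algebra) vanishes_GA: "vanishes (concat [sw3, [GC], [GD], sw5, [GC], [GA]])"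
  by (rule certifies_vanishes[OF certifies_GA]) (auto simp del: relator_word.simps intro: vanishes_R1 vanishes_CD5 vanishes_Y12 vanishes_X12 vanishes_ACDC3 vanishes_AC5 vanishes_Z12 vanishes_ACD4 vanishes_P10)

section \<open>Cocycles on adjacent swaps\<close>

fun swp :: "nat \<Rightarrow> 'a list \<Rightarrow> 'a list" where
  "swp 0 (x # y # zs) = y # x # zs"
| "swp (Suc i) (x # zs) = x # swp i zs"
| "swp _ zs = zs"

lemma swp_single [simp]: "swp i [x] = [x]"
  by (cases i) auto

lemma length_swp [simp]: "length (swp i z) = length z"
  by (induction i z rule: swp.induct) auto

lemma swp_swp [simp]: "swp i (swp i z) = z"
  by (induction i z rule: swp.induct) auto

lemma swp_commute: "Suc i < j \<Longrightarrow> swp j (swp i z) = swp i (swp j z)"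
proof -
  have "swp (Suc (Suc (i + k))) (swp i z) = swp i (swp (Suc (Suc (i + k))) z)" for k
    by (induction i z rule: swp.induct) auto
  then show "Suc i < j \<Longrightarrow> ?thesis"
    by (auto simp: less_iff_Suc_add)
qed

lemma swp_braid:
  "Suc (Suc i) < length z \<Longrightarrow> swp i (swp (Suc i) (swp i z)) = swp (Suc i) (swp i (swp (Suc i) z))"
proof (induction i z rule: swp.induct)
  case (1 x y zs)
  then show ?case by (cases zs) auto
qed auto

text \<open>\<open>D\<close> is a 1-cochain on the Cayley graph of the symmetric group with its
  Coxeter generators, and the three conditions say that it vanishes on the Coxeter relations. The
  square and the hexagon are stated as equality of their two sides, the form needed for confluence.
  \<open>rk\<close> only supplies an order by which words are sorted.\<close>

locale swap_cocycle =
  fixes n :: nat and rk :: "'a \<Rightarrow> nat" and D :: "nat \<Rightarrow> 'a list \<Rightarrow> 'v::ab_group_add"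
  assumes rk: "inj rk"
    and invol: "\<And>i z. \<lbrakk>length z = n; Suc i < n\<rbrakk> \<Longrightarrow> D i (swp i z) = - D i z"
    and commute: "\<And>i j z. \<lbrakk>length z = n; Suc i < j; Suc j < n\<rbrakk> \<Longrightarrow>
      D i z + D j (swp i z) = D j z + D i (swp j z)"
    and braid: "\<And>i z. \<lbrakk>length z = n; Suc (Suc i) < n\<rbrakk> \<Longrightarrow>
      D i z + (D (Suc i) (swp i z) + D i (swp (Suc i) (swp i z))) =
      D (Suc i) z + (D i (swp (Suc i) z) + D (Suc i) (swp i (swp (Suc i) z)))"
begin

fun desc :: "nat \<Rightarrow> 'a list \<Rightarrow> bool" where
  "desc 0 (x # y # zs) \<longleftrightarrow> rk y < rk x"
| "desc (Suc i) (x # zs) \<longleftrightarrow> desc i zs"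
| "desc _ _ \<longleftrightarrow> False"

lemma desc_single [simp]: "\<not> desc i [x]"
  by (cases i) auto

text \<open>Each rank is multiplied by the number of letters from there to the end. Removing a
  descent moves the larger letter to the smaller factor and lowers the weight by the difference of
  the two ranks.\<close>

fun weight :: "'a list \<Rightarrow> nat" where
  "weight [] = 0"
| "weight (x # zs) = rk x * Suc (length zs) + weight zs"

lemma weight_swp: "desc i z \<Longrightarrow> weight (swp i z) < weight z"
  by (induction i z rule: desc.induct) (auto simp: algebra_simps)

lemma desc_less: "desc i z \<Longrightarrow> Suc i < length z"
  by (induction i z rule: desc.induct) auto

lemma desc_or_swp: "distinct z \<Longrightarrow> Suc i < length z \<Longrightarrow> desc i z \<or> desc i (swp i z)"
proof (induction i z rule: desc.induct)
  case (1 x y zs)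
  then have "rk x \<noteq> rk y"
    using rk by (auto dest: injD)
  then show ?case by auto
qed auto

lemma desc_swp_far:
  "Suc i < j \<Longrightarrow> desc i (swp j z) = desc i z"
  "Suc i < j \<Longrightarrow> desc j (swp i z) = desc j z"
proof -
  have "desc i (swp (Suc (Suc (i + k))) z) = desc i z \<and>
    desc (Suc (Suc (i + k))) (swp i z) = desc (Suc (Suc (i + k))) z" for k
    by (induction i z rule: desc.induct) auto
  then show "Suc i < j \<Longrightarrow> desc i (swp j z) = desc i z"
    "Suc i < j \<Longrightarrow> desc j (swp i z) = desc j z"
    by (auto simp: less_iff_Suc_add)
qed

lemma desc_swp_near:
  assumes "desc i z" "desc (Suc i) z"
  shows "desc (Suc i) (swp i z)" "desc i (swp (Suc i) (swp i z))"
    "desc i (swp (Suc i) z)" "desc (Suc i) (swp i (swp (Suc i) z))"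
proof -
  have "desc (Suc i) (swp i z) \<and> desc i (swp (Suc i) (swp i z)) \<and>
    desc i (swp (Suc i) z) \<and> desc (Suc i) (swp i (swp (Suc i) z))"
    using assms
  proof (induction i z rule: desc.induct)
    case (1 x y zs)
    then show ?case by (cases zs) auto
  qed auto
  then show "desc (Suc i) (swp i z)" "desc i (swp (Suc i) (swp i z))"
    "desc i (swp (Suc i) z)" "desc (Suc i) (swp i (swp (Suc i) z))"
    by auto
qed

text \<open>The value accumulated while the word is sorted by removing descents. Which descent is
  removed is an arbitrary choice here; \<open>potential_desc\<close> shows that it does not
  matter.\<close>

function potential :: "'a list \<Rightarrow> 'v" where
  "potential z = (if \<exists>i. desc i z
     then D (SOME i. desc i z) z + potential (swp (SOME i. desc i z) z) else 0)"
  by auto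
termination
proof (relation "Wellfounded.measure weight")
  fix z :: "'a list"
  assume "\<exists>i. desc i z"
  then show "(swp (SOME i. desc i z) z, z) \<in> Wellfounded.measure weight"
    using weight_swp[OF someI_ex[of "\<lambda>i. desc i z"]] by simp
qed auto

declare potential.simps [simp del]

text \<open>A confluence argument by induction on the weight: two descents of one word lead to two
  smaller words, whose sorting paths can be rejoined by a square or a hexagon on which
  \<open>D\<close> is consistent.\<close>

lemma potential_desc:
  "length z = n \<Longrightarrow> desc i z \<Longrightarrow> D i z + potential (swp i z) = potential z"
proof (induction "weight z" arbitrary: i z rule: less_induct)
  case less
  have IH: "D k y + potential (swp k y) = potential y"
    if "weight y < weight z" "length y = n" "desc k y" for k y
    using less.hyps that by blast
  \<comment> \<open>Descents at \<open>i\<close> and \<open>Suc i\<close> mean three decreasing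
    letters. The two ways of reversing them by adjacent swaps are the sides of the braid hexagon,
    and every step on either side again removes a descent.\<close>
  have near: "D i z + potential (swp i z) = D (Suc i) z + potential (swp (Suc i) z)"
    if d: "desc i z" "desc (Suc i) z" for i
  proof -
    note d' = desc_swp_near[OF d]
    have w: "weight (swp i z) < weight z" "weight (swp (Suc i) (swp i z)) < weight z"
      "weight (swp (Suc i) z) < weight z" "weight (swp i (swp (Suc i) z)) < weight z"
      using weight_swp[OF d(1)] weight_swp[OF d(2)] weight_swp[OF d'(1)] weight_swp[OF d'(3)] by auto
    have len: "Suc (Suc i) < n"
      using desc_less[OF d(2)] less.prems by simp
    then have b: "swp (Suc i) (swp i (swp (Suc i) z)) = swp i (swp (Suc i) (swp i z))"
      using swp_braid[of i z] less.prems by simp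
    have "potential (swp i z) = D (Suc i) (swp i z) +
        (D i (swp (Suc i) (swp i z)) + potential (swp i (swp (Suc i) (swp i z))))"
      using IH[OF w(1) _ d'(1)] IH[OF w(2) _ d'(2)] less.prems by simp
    moreover have "potential (swp (Suc i) z) = D i (swp (Suc i) z) +
        (D (Suc i) (swp i (swp (Suc i) z)) + potential (swp i (swp (Suc i) (swp i z))))"
      using IH[OF w(3) _ d'(3)] IH[OF w(4) _ d'(4)] less.prems by (simp add: b)
    ultimately show ?thesis
      using braid[of z i] less.prems len by (simp add: add.assoc[symmetric])
  qed
  \<comment> \<open>Distant swaps do not affect each other's descents, so both orders reach the same
    word through smaller ones.\<close>
  have far: "D i z + potential (swp i z) = D j z + potential (swp j z)"
    if d: "desc i z" "desc j z" "Suc i < j" for i j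
  proof -
    have w: "potential (swp i z) = D j (swp i z) + potential (swp j (swp i z))"
      "potential (swp j z) = D i (swp j z) + potential (swp j (swp i z))"
      using IH[OF weight_swp[OF d(1)], of j] IH[OF weight_swp[OF d(2)], of i] d less.prems
      by (simp_all add: desc_swp_far swp_commute)
    have "D i z + D j (swp i z) = D j z + D i (swp j z)"
      using commute d(3) desc_less[OF d(2)] less.prems by simp
    then show ?thesis
      unfolding w by (simp only: add.assoc[symmetric])
  qed
  have any: "D i z + potential (swp i z) = D j z + potential (swp j z)"
    if "desc i z" "desc j z" for i j
  proof -
    consider "i = j" | "j = Suc i" | "i = Suc j" | "Suc i < j" | "Suc j < i"
      by linarith
    then show ?thesis
    proof cases
      case 2 with that near show ?thesis by blast
    next
      case 3 with that near[of j] show ?thesis by simp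
    next
      case 4 with that far show ?thesis by blast
    next
      case 5 with that far[of j i] show ?thesis by simp
    qed simp
  qed
  have "desc (SOME i. desc i z) z"
    using less.prems(2) by (rule someI)
  moreover have "potential z = D (SOME i. desc i z) z + potential (swp (SOME i. desc i z) z)"
    using less.prems(2) potential.simps[of z] by auto
  ultimately show ?case
    using any[OF less.prems(2)] by simp
qed

text \<open>With distinct letters exactly one direction of the swap removes a descent; the other
  direction follows from antisymmetry.\<close>

theorem potential_swp:
  assumes "length z = n" "distinct z" "Suc i < n"
  shows "D i z = potential z - potential (swp i z)"
proof -
  consider "desc i z" | "desc i (swp i z)"
    using desc_or_swp assms by blast
  then show ?thesis
  proof cases
    case 1
    with potential_desc[of z i] assms show ?thesis
      by (simp add: algebra_simps)
  next
    case 2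
    with potential_desc[of "swp i z" i] invol[of z i] assms show ?thesis
      by (simp add: algebra_simps)
  qed
qed

end

section \<open>The path order of positions and the Coxeter relations\<close>

definition swap_word :: "nat \<Rightarrow> gen list" where
  "swap_word i = [sw0, sw1, sw2, sw3, sw4, sw5] ! i"

lemmas sw_defs = sw0_def sw1_def sw2_def sw3_def sw4_def sw5_def

text \<open>Coordinates are laid along the path of positions 7, 5, 2, 4, 6, 3, 1, so neighbouring
  coordinates sit at neighbouring positions of the path and \<open>swp\<close> becomes the
  transposition realised by \<open>swap_word\<close>.\<close>

fun path_word :: "'a list \<Rightarrow> 'a list" where
  "path_word [a, b, c, d, e, f, g] = [g, c, f, d, b, e, a]"

fun path_coords :: "'a list \<Rightarrow> 'a list" where
  "path_coords [g, c, f, d, b, e, a] = [a, b, c, d, e, f, g]"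

lemma length_path_word [simp]: "length z = 7 \<Longrightarrow> length (path_word z) = 7"
  by (erule length_eq_7E) auto

lemma path_coords:
  assumes "length w = 7"
  shows "length (path_coords w) = 7" "path_word (path_coords w) = w"
    "distinct (path_coords w) = distinct w"
  using assms by (auto elim!: length_eq_7E)

lemma path_coords_path_word: "length z = 7 \<Longrightarrow> path_coords (path_word z) = z"
  by (erule length_eq_7E) auto

lemma less_6_cases: "i < 6 \<Longrightarrow> i = 0 \<or> i = 1 \<or> i = 2 \<or> i = 3 \<or> i = 4 \<or> i = (5::nat)"
  by linarith

lemma acts_swap_word:
  assumes "length z = 7" "i < 6"
  shows "acts (swap_word i) (path_word z) = path_word (swp i z)"
proof -
  obtain a b c d e f g where "z = [a, b, c, d, e, f, g]"
    using assms(1) by (rule length_eq_7E)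
  then show ?thesis
    using less_6_cases[OF assms(2)] by (auto simp: swap_word_def sw_defs numeral_eq_Suc)
qed

context tetrad_algebra
begin

text \<open>The path is mapped to itself backwards when position p becomes 8 - p. Hence
  \<open>mirror\<close> turns \<open>swap_word i\<close> into \<open>swap_word (5 - i)\<close>, and
  certificates for one half of the path give the other half.\<close>

lemma vanishes_invol: "i < 6 \<Longrightarrow> vanishes (concat [swap_word i, swap_word i])"
  using less_6_cases[of i] vanishes_invol_0 vanishes_invol_1 vanishes_invol_2
    vanishes_mirror[OF vanishes_invol_0] vanishes_mirror[OF vanishes_invol_1]
    vanishes_mirror[OF vanishes_invol_2]
  by (auto simp: swap_word_def sw_defs)

text \<open>Mirroring sends the pair (i, j) to (5 - i, 5 - j) and so reverses its order. This is the
  reason for the disjunction; either alternative yields the symmetric relation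
  \<open>swap_val_commute\<close>. The braid relations behave in the same way.\<close>

lemma vanishes_commute:
  assumes "Suc i < j" "j < 6"
  shows "vanishes (concat [swap_word i, swap_word j, swap_word i, swap_word j]) \<or>
    vanishes (concat [swap_word j, swap_word i, swap_word j, swap_word i])"
proof -
  have "(i, j) \<in> {(0, 2), (0, 3), (0, 4), (0, 5), (1, 3), (1, 4), (1, 5), (2, 4), (2, 5), (3, 5)}"
    using assms less_6_cases[of i] less_6_cases[of j] by auto
  then show ?thesis
    using vanishes_commute_0_2 vanishes_commute_0_3 vanishes_commute_0_4 vanishes_commute_0_5
      vanishes_commute_1_3 vanishes_commute_1_4
      vanishes_mirror[OF vanishes_commute_0_2] vanishes_mirror[OF vanishes_commute_0_3]
      vanishes_mirror[OF vanishes_commute_0_4] vanishes_mirror[OF vanishes_commute_1_3]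
    by (auto simp: swap_word_def sw_defs)
qed

lemma vanishes_braid:
  assumes "Suc i < 6"
  shows "vanishes (concat [swap_word i, swap_word (Suc i), swap_word i,
      swap_word (Suc i), swap_word i, swap_word (Suc i)]) \<or>
    vanishes (concat [swap_word (Suc i), swap_word i, swap_word (Suc i),
      swap_word i, swap_word (Suc i), swap_word i])"
proof -
  have "i \<in> {0, 1, 2, 3, 4}"
    using assms less_6_cases[of i] by auto
  then show ?thesis
    using vanishes_braid_0 vanishes_braid_1 vanishes_braid_2
      vanishes_mirror[OF vanishes_braid_0] vanishes_mirror[OF vanishes_braid_1]
    by (auto simp: swap_word_def sw_defs)
qed

definition swap_val :: "('a \<Rightarrow> 'v) \<Rightarrow> nat \<Rightarrow> 'a list \<Rightarrow> 'v" where
  "swap_val v i z = walk (swap_word i) (map v (path_word z))"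

fun swap_walk :: "('a \<Rightarrow> 'v) \<Rightarrow> nat list \<Rightarrow> 'a list \<Rightarrow> 'v" where
  "swap_walk v [] z = 0"
| "swap_walk v (i # is) z = swap_val v i z + swap_walk v is (swp i z)"

lemma walk_swap_words:
  assumes "length z = 7" "\<forall>i \<in> set is. i < 6"
  shows "walk (concat (map swap_word is)) (map v (path_word z)) = swap_walk v is z"
  using assms
proof (induction "is" arbitrary: z)
  case (Cons i "is")
  then show ?case
    by (simp add: walk_append acts_map acts_swap_word swap_val_def)
qed simp

lemma swap_walk_closed:
  assumes "vanishes (concat (map swap_word is))" "length z = 7" "\<forall>i \<in> set is. i < 6"
  shows "swap_walk v is z = 0"
  using walk_swap_words[OF assms(2,3), of v] assms(1,2) by (simp add: vanishes_def)

lemma swap_val_swp: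
  assumes "length z = 7" "i < 6"
  shows "swap_val v i (swp i z) = - swap_val v i z"
  using swap_walk_closed[of "[i, i]" z v] vanishes_invol[OF assms(2)] assms
  by (simp add: eq_neg_iff_add_eq_0 add.commute)

lemma swap_val_commute:
  assumes z: "length z = 7" and ij: "i < 6" "j < 6" and sc: "swp j (swp i z) = swp i (swp j z)"
    and closed: "vanishes (concat [swap_word i, swap_word j, swap_word i, swap_word j])"
  shows "swap_val v i z + swap_val v j (swp i z) = swap_val v j z + swap_val v i (swp j z)"
proof -
  let ?D = "swap_val v"
  \<comment> \<open>The last two steps of the closed walk run along the other side of the square
    backwards, so they count with the opposite sign.\<close>
  have "?D i (swp i (swp j z)) = - ?D i (swp j z)" "?D j (swp j z) = - ?D j z"
    by (simp_all add: swap_val_swp z ij)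
  moreover have "swap_walk v [i, j, i, j] z = 0"
    using swap_walk_closed[of "[i, j, i, j]"] closed z ij by simp
  ultimately have "?D i z + (?D j (swp i z) + (- ?D i (swp j z) + - ?D j z)) = 0"
    by (simp add: sc)
  then have "(?D i z + ?D j (swp i z)) - (?D j z + ?D i (swp j z)) = 0"
    by (simp add: algebra_simps)
  then show ?thesis
    by simp
qed

lemma swap_val_braid:
  assumes z: "length z = 7" and ij: "i < 6" "j < 6"
    and b: "swp j (swp i (swp j z)) = swp i (swp j (swp i z))"
    and closed: "vanishes (concat [swap_word i, swap_word j, swap_word i, swap_word j,
      swap_word i, swap_word j])"
  shows "swap_val v i z + (swap_val v j (swp i z) + swap_val v i (swp j (swp i z))) =
    swap_val v j z + (swap_val v i (swp j z) + swap_val v j (swp i (swp j z)))"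
proof -
  let ?D = "swap_val v"
  have "?D j (swp j (swp i (swp j z))) = - ?D j (swp i (swp j z))"
    "?D i (swp i (swp j z)) = - ?D i (swp j z)" "?D j (swp j z) = - ?D j z"
    by (simp_all add: swap_val_swp z ij)
  moreover have "swap_walk v [i, j, i, j, i, j] z = 0"
    using swap_walk_closed[of "[i, j, i, j, i, j]"] closed z ij by simp
  ultimately have "?D i z + (?D j (swp i z) + (?D i (swp j (swp i z)) +
      (- ?D j (swp i (swp j z)) + (- ?D i (swp j z) + - ?D j z)))) = 0"
    by (simp add: b[symmetric])
  then have "(?D i z + (?D j (swp i z) + ?D i (swp j (swp i z)))) -
      (?D j z + (?D i (swp j z) + ?D j (swp i (swp j z)))) = 0"
    by (simp add: algebra_simps)
  then show ?thesis
    by simp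
qed

lemma swap_cocycle:
  fixes rk :: "'x \<Rightarrow> nat"
  assumes "inj rk"
  shows "swap_cocycle 7 rk (swap_val v)"
proof
  show "inj rk"
    by fact
  show "swap_val v i (swp i z) = - swap_val v i z" if "length z = 7" "Suc i < 7" for i z
    using that by (simp add: swap_val_swp)
  show "swap_val v i z + swap_val v j (swp i z) = swap_val v j z + swap_val v i (swp j z)"
    if "length z = 7" "Suc i < j" "Suc j < 7" for i j z
    using vanishes_commute[of i j] swap_val_commute[of z i j v] swap_val_commute[of z j i v]
      swp_commute[of i j z] that by auto
  show "swap_val v i z + (swap_val v (Suc i) (swp i z) + swap_val v i (swp (Suc i) (swp i z))) =
    swap_val v (Suc i) z + (swap_val v i (swp (Suc i) z) + swap_val v (Suc i) (swp i (swp (Suc i) z)))"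
    if "length z = 7" "Suc (Suc i) < 7" for i z
    using vanishes_braid[of i] swap_val_braid[of z i "Suc i" v] swap_val_braid[of z "Suc i" i v]
      swp_braid[of i z] that by auto
qed

end

section \<open>The potential on words and exactness of the block reversals\<close>

locale tetrad_word_algebra = tetrad_algebra scale br
  for scale :: "rat \<Rightarrow> 'v::ab_group_add \<Rightarrow> 'v" and br +
  fixes v :: "'x \<Rightarrow> 'v" and rk :: "'x \<Rightarrow> nat"
  assumes inj_rk: "inj rk"
begin

interpretation swaps: swap_cocycle 7 rk "swap_val v"
  using inj_rk by (rule swap_cocycle)

definition pot :: "'x list \<Rightarrow> 'v" where
  "pot w = swaps.potential (path_coords w)"

definition exact :: "gen list \<Rightarrow> bool" where
  "exact r \<longleftrightarrow>
    (\<forall>w. length w = 7 \<longrightarrow> distinct w \<longrightarrow> walk r (map v w) = pot w - pot (acts r w))"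

lemma distinct_acts [simp]: "length x = 7 \<Longrightarrow> distinct (acts r x) = distinct x"
  by (induction r arbitrary: x) auto

lemma exact_append: "exact r \<Longrightarrow> exact r' \<Longrightarrow> exact (r @ r')"
  by (simp add: exact_def walk_append acts_map)

lemma exact_swap_word:
  assumes "i < 6"
  shows "exact (swap_word i)"
  unfolding exact_def
proof (intro allI impI)
  fix w :: "'x list"
  assume w: "length w = 7" "distinct w"
  define z where "z = path_coords w"
  note z = path_coords[OF w(1), folded z_def]
  have "swap_val v i z = swaps.potential z - swaps.potential (swp i z)"
    using w z assms by (intro swaps.potential_swp) auto
  moreover have "acts (swap_word i) w = path_word (swp i z)"
    using acts_swap_word[OF z(1) assms] z(2) by simp
  ultimately show "walk (swap_word i) (map v w) = pot w - pot (acts (swap_word i) w)"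
    using z by (simp add: swap_val_def pot_def path_coords_path_word)
      (simp add: z_def)
qed

text \<open>Going along \<open>r\<close> and back along \<open>s\<close> costs nothing in total, so
  the step \<open>s\<close> inherits the potential difference already known for
  \<open>r\<close>.\<close>

lemma exact_closing:
  assumes "vanishes (r @ [s])" "exact r" "\<And>w :: 'x list. length w = 7 \<Longrightarrow> acts (r @ [s]) w = w"
  shows "exact [s]"
  unfolding exact_def
proof (intro allI impI)
  fix w :: "'x list"
  assume w: "length w = 7" "distinct w"
  have a: "acts r w = act s w"
    using assms(3)[OF w(1)] act_act[of "acts r w" s] w by simp
  moreover have "walk r (map v w) + val s (acts r (map v w)) = 0"
    using assms(1) w unfolding vanishes_def walk_append by (metis walk.simps add_0_right length_map)
  ultimately have "walk r (map v w) + val s (act s (map v w)) = 0"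
    using w by (simp add: acts_map act_map)
  then show "walk [s] (map v w) = pot w - pot (acts [s] w)"
    using assms(2) w a by (simp add: val_act exact_def)
qed

lemma exact_sw: "exact sw0" "exact sw1" "exact sw2" "exact sw3" "exact sw4" "exact sw5"
  using exact_swap_word[of 0] exact_swap_word[of 1] exact_swap_word[of 2]
    exact_swap_word[of 3] exact_swap_word[of 4] exact_swap_word[of 5] by (simp_all add: swap_word_def)

lemma exact_GC: "exact [GC]"
proof (rule exact_closing[of "sw3 @ sw4 @ sw3 @ sw1"])
  show "vanishes ((sw3 @ sw4 @ sw3 @ sw1) @ [GC])"
    using vanishes_GC by simp
  show "exact (sw3 @ sw4 @ sw3 @ sw1)"
    by (intro exact_append exact_sw)
qed (auto elim!: length_eq_7E simp: sw_defs)

lemma exact_GD: "exact [GD]"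
proof (rule exact_closing[of "sw2 @ sw1 @ sw2 @ sw4"])
  show "vanishes ((sw2 @ sw1 @ sw2 @ sw4) @ [GD])"
    using vanishes_mirror[OF vanishes_GC] by (simp add: sw_defs)
  show "exact (sw2 @ sw1 @ sw2 @ sw4)"
    by (intro exact_append exact_sw)
qed (auto elim!: length_eq_7E simp: sw_defs)

lemma exact_GA: "exact [GA]"
proof (rule exact_closing[of "sw3 @ [GC] @ [GD] @ sw5 @ [GC]"])
  show "vanishes ((sw3 @ [GC] @ [GD] @ sw5 @ [GC]) @ [GA])"
    using vanishes_GA by simp
  show "exact (sw3 @ [GC] @ [GD] @ sw5 @ [GC])"
    by (intro exact_append exact_sw exact_GC exact_GD)
qed (auto elim!: length_eq_7E simp: sw_defs)

lemma exact_GB: "exact [GB]"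
proof (rule exact_closing[of "sw2 @ [GD] @ [GC] @ sw0 @ [GD]"])
  show "vanishes ((sw2 @ [GD] @ [GC] @ sw0 @ [GD]) @ [GB])"
    using vanishes_mirror[OF vanishes_GA] by (simp add: sw_defs)
  show "exact (sw2 @ [GD] @ [GC] @ sw0 @ [GD])"
    by (intro exact_append exact_sw exact_GC exact_GD)
qed (auto elim!: length_eq_7E simp: sw_defs)

text \<open>\<open>pot\<close> arises from sorting and is not known to be invariant under reversal.
  The same edge is therefore evaluated twice, once from \<open>w\<close> and once as its mirror
  image from the reversed word. The sum is symmetric and matches the four words in
  \<open>W(w) - W(w')\<close>, at the price of a factor 2 on the left.\<close>

lemma val_pot:
  assumes "length w = 7" "distinct w" "s \<in> {GA, GC}"
  shows "val s (map v w) + val s (map v w) =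
    pot w + pot (act GR w) - (pot (act s w) + pot (act GR (act s w)))"
proof -
  have e: "val s' (map v u) = pot u - pot (act s' u)"
    if "length u = 7" "distinct u" "s' \<in> {GA, GB, GC, GD}" for u s'
    using that exact_GA exact_GB exact_GC exact_GD by (auto simp: exact_def)
  have "val s (map v w) = val (mirror s) (map v (act GR w))"
    "act (mirror s) (act GR w) = act GR (act s w)"
    using assms by (auto elim!: length_eq_7E)
  moreover have "mirror s \<in> {GA, GB, GC, GD}" "s \<in> {GA, GB, GC, GD}"
    using assms(3) by auto
  ultimately have "val s (map v w) = pot (act GR w) - pot (act GR (act s w))"
    using e[of "act GR w" "mirror s"] assms(1,2) by simp
  with e[of w s] \<open>s \<in> {GA, GB, GC, GD}\<close> assms(1,2) show ?thesis
    by (metis (no_types, opaque_lifting) add_diff_add)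
qed

end

section \<open>Linear extension of functions on monomials\<close>

locale rat_vector_space = vector_space scale
  for scale :: "rat \<Rightarrow> 'v::ab_group_add \<Rightarrow> 'v"
begin

definition lin_ext :: "('k \<Rightarrow> 'v) \<Rightarrow> ('k \<Rightarrow>\<^sub>0 rat) \<Rightarrow> 'v" where
  "lin_ext f p = (\<Sum>k \<in> Poly_Mapping.keys p. scale (Poly_Mapping.lookup p k) (f k))"

lemma lin_ext_superset:
  assumes "finite S" "Poly_Mapping.keys p \<subseteq> S"
  shows "lin_ext f p = (\<Sum>k \<in> S. scale (Poly_Mapping.lookup p k) (f k))"
  unfolding lin_ext_def
  by (rule sum.mono_neutral_left) (use assms in \<open>auto simp: in_keys_iff\<close>)

lemma lin_ext_add: "lin_ext f (p + q) = lin_ext f p + lin_ext f q"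
proof -
  let ?S = "Poly_Mapping.keys p \<union> Poly_Mapping.keys q"
  have "Poly_Mapping.keys (p + q) \<subseteq> ?S"
    by (rule Poly_Mapping.keys_add)
  then have "lin_ext f (p + q) = (\<Sum>k \<in> ?S. scale (Poly_Mapping.lookup (p + q) k) (f k))"
    by (intro lin_ext_superset) auto
  also have "\<dots> = (\<Sum>k \<in> ?S. scale (Poly_Mapping.lookup p k) (f k)) +
      (\<Sum>k \<in> ?S. scale (Poly_Mapping.lookup q k) (f k))"
    by (simp add: lookup_add scale_left_distrib sum.distrib)
  also have "\<dots> = lin_ext f p + lin_ext f q"
    by (simp add: lin_ext_superset[of ?S])
  finally show ?thesis .
qed

lemma lin_ext_zero [simp]: "lin_ext f 0 = 0"
  by (simp add: lin_ext_def)

lemma lin_ext_uminus: "lin_ext f (- p) = - lin_ext f p"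
  using lin_ext_add[of f p "- p"] by (simp add: eq_neg_iff_add_eq_0 add.commute)

lemma lin_ext_diff: "lin_ext f (p - q) = lin_ext f p - lin_ext f q"
  using lin_ext_add[of f p "- q"] by (simp add: lin_ext_uminus)

lemma lin_ext_single: "lin_ext f (Poly_Mapping.single k c) = scale c (f k)"
  by (simp add: lin_ext_def)

lemma lin_ext_sum: "lin_ext f (sum p A) = (\<Sum>a \<in> A. lin_ext f (p a))"
  by (induction A rule: infinite_finite_induct) (auto simp: lin_ext_add)

lemma eval_poly_lin_ext: "eval_poly scale br v p = lin_ext (eval_monomial br v) p"
  by (simp add: eval_poly_def lin_ext_def)

lemmas eval_poly_simps = eval_poly_lin_ext lin_ext_add lin_ext_diff lin_ext_single

lemma eval_identities:
  assumes "skew_bracket br"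
  shows "eval_poly scale br v identity1 = skew_bracket.walk br (relator_word R1) (map v alphabet)"
    and "eval_poly scale br v identity2 = skew_bracket.walk br (relator_word R2) (map v alphabet)"
  unfolding list.map skew_bracket.identity1_walk[OF assms, symmetric]
    skew_bracket.identity2_walk[OF assms, symmetric]
  by (simp_all add: identity1_def identity1_at_def identity2_def identity2_at_def eval_poly_simps)

end

sublocale quaternary_algebra \<subseteq> rat_vector_space
  by unfold_locales

lemma lookup_free_scale: "Poly_Mapping.lookup (free_scale c p) u = c * Poly_Mapping.lookup p u"
  by (simp add: free_scale_def map.rep_eq when_def)

interpretation free: rat_vector_space free_scale
  by standard
    (auto intro!: poly_mapping_eqI simp: lookup_free_scale lookup_add algebra_simps)

section \<open>The free associative algebra\<close>

abbreviation monic :: "'x list \<Rightarrow> 'x free_algebra" where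
  "monic w \<equiv> Poly_Mapping.single (Word w) 1"

lemma monic_mult: "monic u * monic w = monic (u @ w)"
  by (simp add: mult_single plus_word_def)

lemma prod_list_generator: "prod_list (map generator w) = monic w"
proof (induction w)
  case Nil
  then show ?case
    by (metis list.map(1) prod_list.Nil single_one zero_word_def)
next
  case (Cons x w)
  then show ?case
    by (simp add: generator_def monic_mult)
qed

interpretation anti: skew_bracket "antitetrad :: 'r::ring \<Rightarrow> _"
  by standard (simp_all add: antitetrad_def algebra_simps)

definition sym_prod :: "'r::ring_1 list \<Rightarrow> 'r" where
  "sym_prod x = prod_list x + prod_list (rev x)"

lemma anti_val: "length x = 7 \<Longrightarrow> anti.val s x = sym_prod x - sym_prod (act s x)"
  by (erule length_eq_7E, cases s) (simp_all add: antitetrad_def sym_prod_def algebra_simps)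

lemma anti_walk: "length x = 7 \<Longrightarrow> anti.walk r x = sym_prod x - sym_prod (acts r x)"
  by (induction r arbitrary: x) (auto simp: anti_val)

lemma rev_eq_act: "length x = 7 \<Longrightarrow> rev x = act GR x"
  by (erule length_eq_7E) auto

lemma sym_prod_generator:
  "length w = 7 \<Longrightarrow> sym_prod (map generator w) = monic w + monic (act GR w)"
  by (simp add: sym_prod_def rev_map prod_list_generator rev_eq_act)

section \<open>Monomials of degree 7\<close>

primrec ops :: "'x monomial \<Rightarrow> nat" where
  "ops (Var x) = 0"
| "ops \<langle>s, t, u, w\<rangle> = Suc (ops s + ops t + ops u + ops w)"

lemma length_leaves: "length (leaves m) = 3 * ops m + 1"
  by (induction m) auto

lemma ops_eq_0: "ops m = 0 \<Longrightarrow> \<exists>x. m = Var x"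
  by (cases m) auto

lemma ops_eq_1: "ops m = 1 \<Longrightarrow> \<exists>a b c d. m = \<langle>Var a, Var b, Var c, Var d\<rangle>"
  by (cases m) (auto dest!: ops_eq_0)

lemma ops_eq_2:
  assumes "ops m = 2"
  obtains a b c d e f g where "m = \<langle>\<langle>Var a, Var b, Var c, Var d\<rangle>, Var e, Var f, Var g\<rangle>"
  | a b c d e f g where "m = \<langle>Var a, \<langle>Var b, Var c, Var d, Var e\<rangle>, Var f, Var g\<rangle>"
  | a b c d e f g where "m = \<langle>Var a, Var b, \<langle>Var c, Var d, Var e, Var f\<rangle>, Var g\<rangle>"
  | a b c d e f g where "m = \<langle>Var a, Var b, Var c, \<langle>Var d, Var e, Var f, Var g\<rangle>\<rangle>"
proof (cases m)
  case (Op s t u w)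
  with assms consider "ops s = 1" "ops t = 0" "ops u = 0" "ops w = 0"
    | "ops s = 0" "ops t = 1" "ops u = 0" "ops w = 0"
    | "ops s = 0" "ops t = 0" "ops u = 1" "ops w = 0"
    | "ops s = 0" "ops t = 0" "ops u = 0" "ops w = 1"
    by fastforce
  then show ?thesis
    by cases (use Op that in \<open>auto dest!: ops_eq_0 ops_eq_1[unfolded One_nat_def]\<close>)
qed (use assms in simp)

text \<open>An inner bracket in the third or fourth place moves to the second or first place by
  skew-symmetry of the outer bracket. So \<open>GA\<close> and \<open>GC\<close> cover all four
  shapes up to sign.\<close>

lemma (in skew_bracket) eval_monomial_val:
  "eval_monomial br v \<langle>\<langle>Var a, Var b, Var c, Var d\<rangle>, Var e, Var f, Var g\<rangle> =
     val GA (map v [a, b, c, d, e, f, g])"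
  "eval_monomial br v \<langle>Var a, \<langle>Var b, Var c, Var d, Var e\<rangle>, Var f, Var g\<rangle> =
     val GC (map v [a, b, c, d, e, f, g])"
  "eval_monomial br v \<langle>Var a, Var b, \<langle>Var c, Var d, Var e, Var f\<rangle>, Var g\<rangle> =
     - val GC (map v [g, c, d, e, f, b, a])"
  "eval_monomial br v \<langle>Var a, Var b, Var c, \<langle>Var d, Var e, Var f, Var g\<rangle>\<rangle> =
     - val GA (map v [d, e, f, g, c, b, a])"
  using skew[of "v a" "v b" "br (v c) (v d) (v e) (v f)" "v g"]
    skew[of "v a" "v b" "v c" "br (v d) (v e) (v f) (v g)"]
  by simp_all

section \<open>The main theorem\<close>

context tetrad_word_algebra
begin

definition word_functional :: "'x free_algebra \<Rightarrow> 'v" where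
  "word_functional = lin_ext (\<lambda>u. pot (letters u))"

lemma word_functional_val:
  assumes "length w = 7" "distinct w" "s \<in> {GA, GC}"
  shows "word_functional (anti.val s (map generator w)) = val s (map v w) + val s (map v w)"
  unfolding val_pot[OF assms] using assms
  by (simp add: anti_val act_map sym_prod_generator word_functional_def
      lin_ext_add lin_ext_diff lin_ext_single)

lemma word_functional_eval_monomial:
  assumes "ops m = 2" "distinct (leaves m)"
  shows "word_functional (eval_monomial antitetrad generator m) =
    eval_monomial br v m + eval_monomial br v m"
  using assms(1)
proof (cases rule: ops_eq_2)
  case (1 a b c d e f g)
  with assms(2) show ?thesis
    using word_functional_val[of "[a, b, c, d, e, f, g]" GA]
    unfolding 1 eval_monomial_val anti.eval_monomial_val by simp
next
  case (2 a b c d e f g)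
  with assms(2) show ?thesis
    using word_functional_val[of "[a, b, c, d, e, f, g]" GC]
    unfolding 2 eval_monomial_val anti.eval_monomial_val by simp
next
  case (3 a b c d e f g)
  with assms(2) have "word_functional (anti.val GC (map generator [g, c, d, e, f, b, a])) =
    val GC (map v [g, c, d, e, f, b, a]) + val GC (map v [g, c, d, e, f, b, a])"
    by (intro word_functional_val) auto
  then show ?thesis
    unfolding 3 eval_monomial_val anti.eval_monomial_val
    by (simp add: word_functional_def lin_ext_uminus del: anti.val.simps val.simps list.map)
next
  case (4 a b c d e f g)
  with assms(2) have "word_functional (anti.val GA (map generator [d, e, f, g, c, b, a])) =
    val GA (map v [d, e, f, g, c, b, a]) + val GA (map v [d, e, f, g, c, b, a])"
    by (intro word_functional_val) auto
  then show ?thesis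
    unfolding 4 eval_monomial_val anti.eval_monomial_val
    by (simp add: word_functional_def lin_ext_uminus del: anti.val.simps val.simps list.map)
qed

lemma word_functional_scale: "word_functional (free_scale c p) = scale c (word_functional p)"
proof -
  have "Poly_Mapping.keys (free_scale c p) \<subseteq> Poly_Mapping.keys p"
    by (auto simp: in_keys_iff lookup_free_scale)
  then have "word_functional (free_scale c p) = (\<Sum>u \<in> Poly_Mapping.keys p.
      scale (Poly_Mapping.lookup (free_scale c p) u) (pot (letters u)))"
    unfolding word_functional_def by (intro lin_ext_superset) auto
  then show ?thesis
    by (simp add: word_functional_def lin_ext_def lookup_free_scale scale_sum_right)
qed

lemma word_functional_eval_poly:
  assumes "\<And>m. m \<in> Poly_Mapping.keys I \<Longrightarrow> ops m = 2 \<and> distinct (leaves m)"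
  shows "word_functional (eval_poly free_scale antitetrad generator I) =
    eval_poly scale br v I + eval_poly scale br v I"
proof -
  have "word_functional (eval_poly free_scale antitetrad generator I) =
      (\<Sum>m \<in> Poly_Mapping.keys I. scale (Poly_Mapping.lookup I m)
        (word_functional (eval_monomial antitetrad generator m)))"
    by (simp add: eval_poly_def word_functional_scale[symmetric])
      (simp add: word_functional_def lin_ext_sum)
  also have "\<dots> = eval_poly scale br v I + eval_poly scale br v I"
    unfolding eval_poly_def sum.distrib[symmetric]
    by (rule sum.cong) (use assms in \<open>auto simp: word_functional_eval_monomial scale_right_distrib\<close>)
  finally show ?thesis .
qed

end

lemma UNIV_var: "(UNIV :: var set) = set alphabet"
  using var.exhaust by auto

lemma vanishing_eval_poly:
  fixes I :: "var polynomial" and br :: "'v::ab_group_add \<Rightarrow> _"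
  assumes "tetrad_algebra scale br" "multilinear UNIV I" "antitetrad_identity I"
  shows "eval_poly scale br v I = 0"
proof -
  interpret tetrad_algebra scale br
    by fact
  \<comment> \<open>An arbitrary injective numbering of the letters, to fix what a sorted word
    is.\<close>
  define rk where "rk = (\<lambda>x. case x of Va \<Rightarrow> 0 | Vb \<Rightarrow> 1 | Vc \<Rightarrow> 2 | Vd \<Rightarrow> 3 | Ve \<Rightarrow> 4 | Vf \<Rightarrow> 5 | Vg \<Rightarrow> (6::nat))"
  have "inj rk"
    by (rule injI) (auto simp: rk_def split: var.splits)
  then interpret tetrad_word_algebra scale br v rk
    by unfold_locales
  have "ops m = 2 \<and> distinct (leaves m)" if "m \<in> Poly_Mapping.keys I" for m
  proof -
    have m: "distinct (leaves m)" "set (leaves m) = set alphabet"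
      using assms(2) that unfolding multilinear_def UNIV_var by auto
    then show ?thesis
      using distinct_card[OF m(1)] by (simp add: length_leaves)
  qed
  then have "eval_poly scale br v I + eval_poly scale br v I = 0"
    using word_functional_eval_poly[of I] assms(3)
    by (simp add: antitetrad_identity_def word_functional_def)
  then have "scale 2 (eval_poly scale br v I) = 0"
    by (metis one_add_one scale_left_distrib scale_one)
  then show ?thesis
    by simp
qed

section \<open>The three given identities and the algebras satisfying them\<close>

lemma multilinear_add: "multilinear V p \<Longrightarrow> multilinear V q \<Longrightarrow> multilinear V (p + q)"
  unfolding multilinear_def using Poly_Mapping.keys_add[of p q] by blast

lemma multilinear_diff: "multilinear V p \<Longrightarrow> multilinear V q \<Longrightarrow> multilinear V (p - q)"
  using multilinear_add[of V p "- q"] by (simp add: multilinear_def)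

lemma multilinear_mon: "distinct (leaves m) \<Longrightarrow> set (leaves m) = V \<Longrightarrow> multilinear V (mon m)"
  by (simp add: multilinear_def)

lemma multilinear_identities: "multilinear UNIV identity1" "multilinear UNIV identity2"
  unfolding identity1_def identity1_at_def identity2_def identity2_at_def UNIV_var
  by (intro multilinear_add multilinear_diff multilinear_mon; fastforce)+

lemma antitetrad_identities:
  "antitetrad_identity skew_symmetry" "antitetrad_identity identity1" "antitetrad_identity identity2"
proof -
  show "antitetrad_identity skew_symmetry"
    by (simp add: antitetrad_identity_def skew_symmetry_def skew_symmetry_at_def
        free.eval_poly_simps antitetrad_def)
  \<comment> \<open>In the free algebra the value of a walk telescopes to the difference between its
    two end points, so it suffices that both walks return to their starting word.\<close>
  have "acts (relator_word R1) (map generator alphabet) = map generator alphabet"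
    "acts (relator_word R2) (map generator alphabet) = map generator alphabet"
    by simp_all
  then show "antitetrad_identity identity1" "antitetrad_identity identity2"
    unfolding antitetrad_identity_def free.eval_identities[OF anti.skew_bracket_axioms]
    by (simp_all add: anti_walk del: relator_word.simps list.map)
qed

lemma tetrad_algebraI:
  fixes br :: "'v::ab_group_add \<Rightarrow> _"
  assumes "quaternary_algebra scale br"
    and "\<forall>J \<in> {skew_symmetry, identity1, identity2}. satisfies scale br J"
  shows "tetrad_algebra scale br"
proof -
  interpret quaternary_algebra scale br
    by fact
  have sat: "eval_poly scale br v skew_symmetry = 0" "eval_poly scale br v identity1 = 0"
    "eval_poly scale br v identity2 = 0" for v
    using assms(2) by (auto simp: satisfies_def)
  \<comment> \<open>Skew-symmetry involves the first four variables only; the last three entries of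
    the assignment are fillers.\<close>
  have "br w z y x = - br x y z w" for x y z w
    using sat(1)[of "sub [x, y, z, w, w, w, w]"]
    by (simp add: skew_symmetry_def skew_symmetry_at_def eval_poly_simps
        eq_neg_iff_add_eq_0 add.commute)
  then interpret skew_algebra scale br
    by unfold_locales
  have "walk (relator_word R1) x = 0" "walk (relator_word R2) x = 0" if "length x = 7" for x
    using sat(2,3)[of "sub x"]
    unfolding eval_identities[OF skew_bracket_axioms] map_sub_alphabet[OF that] by blast+
  then show ?thesis
    by unfold_locales (auto simp: vanishes_def)
qed

theorem theorem6p2:
  shows "antitetrad_identity skew_symmetry
    \<and> multilinear UNIV identity1 \<and> antitetrad_identity identity1
    \<and> multilinear UNIV identity2 \<and> antitetrad_identity identity2
    \<and> (\<forall>I :: var polynomial. multilinear UNIV I \<and> antitetrad_identity I \<longrightarrow>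
         consequence TYPE('v::ab_group_add) {skew_symmetry, identity1, identity2} I)"
proof (intro conjI allI impI antitetrad_identities multilinear_identities)
  fix I :: "var polynomial"
  assume I: "multilinear UNIV I \<and> antitetrad_identity I"
  show "consequence TYPE('v) {skew_symmetry, identity1, identity2} I"
    unfolding consequence_def
  proof (intro allI impI)
    fix scale :: "rat \<Rightarrow> 'v \<Rightarrow> 'v" and br
    assume "quaternary_algebra scale br"
      and "\<forall>J \<in> {skew_symmetry, identity1, identity2}. satisfies scale br J"
    then have "tetrad_algebra scale br"
      by (rule tetrad_algebraI)
    with I show "satisfies scale br I"
      unfolding satisfies_def by (blast intro: vanishing_eval_poly)
  qed
qed

end
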